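(* Let $\{\phi_t\}_{t\ge 0}$ be a nontrivial one-parameter semigroup of analytic self-maps of the unit disk $\mathbb{D}$. Let $X\subset H(\mathbb{D})$ be a Banach space of analytic functions on $\mathbb{D}$ on which $\{\phi_t\}$ acts, and suppose $H^\infty\subseteq X\subseteq\mathcal{B}$. Then $[\phi_t,X]\subsetneqq X$. In particular, $[\phi_t,\mathrm{BMOA}]\subsetneqq\mathrm{BMOA}$.
   Context: $\mathbb{D}=\{z\in\mathbb{C}:|z|<1\}$ and $H(\mathbb{D})$ is the set of analytic functions on $\mathbb{D}$. A one-parameter semigroup $\{\phi_t\}_{t\ge0}$ of analytic functions on $\mathbb{D}$ is a family of analytic functions $\phi_t:\mathbb{D}\to\mathbb{D}$ such that: $\phi_0(z)=z$ for $z\in\mathbb{D}$; $\phi_{s+t}=\phi_s\circ\phi_t$ for all $s,t\ge0$; and $(t,z)\mapsto\phi_t(z)$ is continuous on $[0,\infty)\times\mathbb{D}$. It is trivial if $\phi_t(z)=z$ for all $t\ge0$ and nontrivial otherwise. Put $C_t(f)=f\circ\phi_t$ for $f\in H(\mathbb{D})$. A Banach space of analytic functions on $\mathbb{D}$ is a linear subspace $X\subset H(\mathbb{D})$ with a complete norm $\|\cdot\|_X$ for which point evaluations at points of $\mathbb{D}$ are continuous. The semigroup $\{\phi_t\}$ acts on $X$ if $C_t$ is a bounded operator on $X$ for every $t\ge0$. In that case $[\phi_t,X]$ denotes the maximal closed subspace of $X$ on which $\{C_t\}$ is strongly continuous, i.e. on which $\lim_{t\to0^+}\|f\circ\phi_t-f\|_X=0$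 for every element $f$. $H^\infty$ is the space of bounded functions in $H(\mathbb{D})$ with the supremum norm. The Bloch space is $\mathcal{B}=\{f\in H(\mathbb{D}):\|f\|_{\mathcal{B}}=|f(0)|+\sup_{z\in\mathbb{D}}|f'(z)|(1-|z|^2)<\infty\}$. $\mathrm{BMOA}$ is the space of $f$ in the Hardy space $H^2$ whose boundary values have bounded mean oscillation, equivalently those for which $$\|f\|_*=|f(0)|+\sup_{I\subset\partial\mathbb{D}}\left(\frac1{|I|}\int_{R(I)}|f'(z)|^2(1-|z|^2)\,dA(z)\right)^{1/2}<\infty,$$ where $I$ ranges over arcs of $\partial\mathbb{D}$, $|I|$ is the length of $I$, $R(I)=\{re^{i\theta}\in\mathbb{D}:1-\frac{|I|}{2\pi}<r<1,\ e^{i\theta}\in I\}$, and $dA$ is normalized Lebesgue measure on $\mathbb{D}$; $\|\cdot\|_*$ is its norm. It is known that $H^\infty\subset\mathrm{BMOA}\subset\mathcal{B}$, and every semigroup acts on $\mathrm{BMOA}$. *)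

theory Defs
  imports "HOL-Complex_Analysis.Complex_Analysis"
begin

abbreviation disc :: "complex set" where
  "disc \<equiv> ball 0 1"

text \<open>Functions on the disc are represented by total functions vanishing outside of it, so that
  equality of elements of \<open>H_disc\<close> is equality on the disc.\<close>

definition H_disc :: "(complex \<Rightarrow> complex) set" where
  "H_disc = {f. f holomorphic_on disc \<and> (\<forall>z. z \<notin> disc \<longrightarrow> f z = 0)}"

definition H_infty :: "(complex \<Rightarrow> complex) set" where
  "H_infty = {f \<in> H_disc. bounded (f ` disc)}"

definition Bloch :: "(complex \<Rightarrow> complex) set" where
  "Bloch = {f \<in> H_disc. bdd_above ((\<lambda>z. cmod (deriv f z) * (1 - (cmod z)\<^sup>2)) ` disc)}"


subsection \<open>BMOA\<close>

text \<open>A pair \<open>(a, b)\<close> in \<open>arcs\<close> stands for the arc \<open>cis ` {a..b}\<close> of length \<open>b - a\<close>. Including or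
  excluding end points changes the integrals below by nothing.\<close>

definition arcs :: "(real \<times> real) set" where
  "arcs = {(a, b). 0 < b - a \<and> b - a \<le> 2 * pi}"

definition carleson_box :: "real \<Rightarrow> real \<Rightarrow> complex set" where
  "carleson_box a b = {rcis r \<theta> | r \<theta>. 1 - (b - a) / (2 * pi) < r \<and> r < 1 \<and> \<theta> \<in> {a..b}}"

text \<open>The factor \<open>1 / pi\<close> normalizes Lebesgue measure on the disc.\<close>

definition box_mean :: "(complex \<Rightarrow> complex) \<Rightarrow> real \<Rightarrow> real \<Rightarrow> ennreal" where
  "box_mean f a b = ennreal (1 / (b - a)) * (ennreal (1 / pi) *
     (\<integral>\<^sup>+ z \<in> carleson_box a b. ennreal ((cmod (deriv f z))\<^sup>2 * (1 - (cmod z)\<^sup>2)) \<partial>lborel))"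

definition BMOA :: "(complex \<Rightarrow> complex) set" where
  "BMOA = {f \<in> H_disc. (SUP (a, b) \<in> arcs. box_mean f a b) < \<infinity>}"

text \<open>Only meaningful for \<open>f \<in> BMOA\<close>.\<close>

definition bmoa_norm :: "(complex \<Rightarrow> complex) \<Rightarrow> real" where
  "bmoa_norm f = cmod (f 0) + (SUP (a, b) \<in> arcs. sqrt (enn2real (box_mean f a b)))"


subsection \<open>Banach spaces of analytic functions\<close>

definition linear_subspace :: "(complex \<Rightarrow> complex) set \<Rightarrow> bool" where
  "linear_subspace Y \<longleftrightarrow>
     (\<lambda>z. 0) \<in> Y \<and>
     (\<forall>f\<in>Y. \<forall>g\<in>Y. (\<lambda>z. f z + g z) \<in> Y) \<and>
     (\<forall>c. \<forall>f\<in>Y. (\<lambda>z. c * f z) \<in> Y)"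

definition norm_converges ::
  "((complex \<Rightarrow> complex) \<Rightarrow> real) \<Rightarrow> (nat \<Rightarrow> complex \<Rightarrow> complex) \<Rightarrow> (complex \<Rightarrow> complex) \<Rightarrow> bool" where
  "norm_converges N u f \<longleftrightarrow> (\<lambda>n. N (\<lambda>z. u n z - f z)) \<longlonglongrightarrow> 0"

definition norm_on :: "(complex \<Rightarrow> complex) set \<Rightarrow> ((complex \<Rightarrow> complex) \<Rightarrow> real) \<Rightarrow> bool" where
  "norm_on X N \<longleftrightarrow>
     (\<forall>f\<in>X. 0 \<le> N f) \<and>
     (\<forall>f\<in>X. N f = 0 \<longleftrightarrow> f = (\<lambda>z. 0)) \<and>
     (\<forall>c. \<forall>f\<in>X. N (\<lambda>z. c * f z) = cmod c * N f) \<and>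
     (\<forall>f\<in>X. \<forall>g\<in>X. N (\<lambda>z. f z + g z) \<le> N f + N g)"

definition complete_norm :: "(complex \<Rightarrow> complex) set \<Rightarrow> ((complex \<Rightarrow> complex) \<Rightarrow> real) \<Rightarrow> bool" where
  "complete_norm X N \<longleftrightarrow>
     (\<forall>u. (\<forall>n. u n \<in> X) \<longrightarrow>
          (\<forall>e>0. \<exists>M. \<forall>m\<ge>M. \<forall>n\<ge>M. N (\<lambda>z. u m z - u n z) < e) \<longrightarrow>
          (\<exists>f\<in>X. norm_converges N u f))"

definition banach_space_analytic ::
  "(complex \<Rightarrow> complex) set \<Rightarrow> ((complex \<Rightarrow> complex) \<Rightarrow> real) \<Rightarrow> bool" where
  "banach_space_analytic X N \<longleftrightarrow>
     X \<subseteq> H_disc \<and> linear_subspace X \<and> norm_on X N \<and> complete_norm X N \<and>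
     (\<forall>w\<in>disc. \<forall>u f. (\<forall>n. u n \<in> X) \<longrightarrow> f \<in> X \<longrightarrow> norm_converges N u f \<longrightarrow>
        (\<lambda>n. u n w) \<longlonglongrightarrow> f w)"

definition closed_subspace ::
  "(complex \<Rightarrow> complex) set \<Rightarrow> ((complex \<Rightarrow> complex) \<Rightarrow> real) \<Rightarrow> (complex \<Rightarrow> complex) set \<Rightarrow> bool" where
  "closed_subspace X N Y \<longleftrightarrow>
     Y \<subseteq> X \<and> linear_subspace Y \<and>
     (\<forall>u f. (\<forall>n. u n \<in> Y) \<longrightarrow> f \<in> X \<longrightarrow> norm_converges N u f \<longrightarrow> f \<in> Y)"


subsection \<open>Semigroups of analytic self-maps and composition operators\<close>

text \<open>Only the values \<open>\<phi> t z\<close> with \<open>t \<ge> 0\<close> and \<open>z \<in> disc\<close> matter.\<close>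

definition analytic_semigroup :: "(real \<Rightarrow> complex \<Rightarrow> complex) \<Rightarrow> bool" where
  "analytic_semigroup \<phi> \<longleftrightarrow>
     (\<forall>t\<ge>0. \<phi> t holomorphic_on disc \<and> \<phi> t ` disc \<subseteq> disc) \<and>
     (\<forall>z\<in>disc. \<phi> 0 z = z) \<and>
     (\<forall>s\<ge>0. \<forall>t\<ge>0. \<forall>z\<in>disc. \<phi> (s + t) z = \<phi> s (\<phi> t z)) \<and>
     continuous_on ({0..} \<times> disc) (\<lambda>(t, z). \<phi> t z)"

definition trivial_semigroup :: "(real \<Rightarrow> complex \<Rightarrow> complex) \<Rightarrow> bool" where
  "trivial_semigroup \<phi> \<longleftrightarrow> (\<forall>t\<ge>0. \<forall>z\<in>disc. \<phi> t z = z)"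

definition comp_op ::
  "(real \<Rightarrow> complex \<Rightarrow> complex) \<Rightarrow> real \<Rightarrow> (complex \<Rightarrow> complex) \<Rightarrow> complex \<Rightarrow> complex" where
  "comp_op \<phi> t f = (\<lambda>z. if z \<in> disc then f (\<phi> t z) else 0)"

definition acts_on ::
  "(real \<Rightarrow> complex \<Rightarrow> complex) \<Rightarrow> (complex \<Rightarrow> complex) set \<Rightarrow> ((complex \<Rightarrow> complex) \<Rightarrow> real) \<Rightarrow> bool" where
  "acts_on \<phi> X N \<longleftrightarrow>
     (\<forall>t\<ge>0. (\<forall>f\<in>X. comp_op \<phi> t f \<in> X) \<and> (\<exists>K. \<forall>f\<in>X. N (comp_op \<phi> t f) \<le> K * N f))"

definition strongly_continuous_on ::
  "(real \<Rightarrow> complex \<Rightarrow> complex) \<Rightarrow> ((complex \<Rightarrow> complex) \<Rightarrow> real) \<Rightarrow> (complex \<Rightarrow> complex) set \<Rightarrow> bool" where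
  "strongly_continuous_on \<phi> N Y \<longleftrightarrow>
     (\<forall>f\<in>Y. ((\<lambda>t. N (\<lambda>z. comp_op \<phi> t f z - f z)) \<longlongrightarrow> 0) (at_right 0))"

text \<open>The maximal closed subspace of strong continuity, \<open>[\<phi>\<^sub>t, X]\<close>, as the supremum with respect to
  inclusion of all closed subspaces of strong continuity. Whenever there is a largest such subspace,
  it is this one, see \<open>max_sc_subspace_eq\<close>.\<close>

definition max_sc_subspace ::
  "(real \<Rightarrow> complex \<Rightarrow> complex) \<Rightarrow> (complex \<Rightarrow> complex) set \<Rightarrow> ((complex \<Rightarrow> complex) \<Rightarrow> real)
    \<Rightarrow> (complex \<Rightarrow> complex) set" where
  "max_sc_subspace \<phi> X N = \<Union>{Y. closed_subspace X N Y \<and> strongly_continuous_on \<phi> N Y}"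

lemma max_sc_subspace_eq:
  assumes "closed_subspace X N Y" "strongly_continuous_on \<phi> N Y"
    and "\<And>Z. closed_subspace X N Z \<Longrightarrow> strongly_continuous_on \<phi> N Z \<Longrightarrow> Z \<subseteq> Y"
  shows "max_sc_subspace \<phi> X N = Y"
  using assms unfolding max_sc_subspace_def by blast

end

(*
  If f is strongly continuous under the semigroup in X, then f o phi_t - f tends to 0 in the Bloch
  norm: for X this is the closed graph theorem, for BMOA a mean value estimate on Carleson boxes. So it
  suffices to find f in H^infinity for which (1 - |a|^2) |(f o phi_t - f)'(a)| >= 1/8 for arbitrarily
  small t and suitable a.

  If phi_t is not the identity then, by the maximum principle, phi_t(z) - z fails to tend to 0 at
  infinitely many points of the circle. Close to such a point zeta there are a with phi_t(a) far away
  from a in the hyperbolic metric, and by the Schwarz-Pick lemma the function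
  (1 - |a|^2) / (1 - cnj a z) has a large gap at a. Choosing t -> 0 and boundary points accumulating
  at some p different from all of them, a gliding hump argument adds up such functions to f: the
  earlier summands contribute little since otherwise one of their partial sums would already do, and
  the later ones since they are uniformly small on the relevant compact sets.

  That f o phi_t - f lies in BMOA requires H^infinity to be contained in BMOA. This follows from the
  Littlewood-Paley inequality, applied to f u and u for the kernels u(z) = 1 / (1 - cnj a z).
*)
theory Submission
  imports Defs "HOL-Real_Asymp.Real_Asymp"
begin

section \<open>Rotation invariance of the area measure\<close>

text \<open>Each bump keeps Bloch density close to 1 at its centre, so the norms of the bumps are
  not summable and the sum is bounded only because the bumps are large at different places. This is
  why infinitely many bad boundary points are wanted: they leave room to avoid p, and a bump placed
  at a positive distance from p is negligible near p, where its successors go.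

  Arbitrarily small times are available because a nontrivial semigroup cannot be the identity at
  t0/n when it is not the identity at t0.

  The closed graph theorem takes the form of uniform boundedness, used twice: for difference
  quotients, which makes evaluation of the derivative bounded, and for the family of Bloch densities
  indexed by the points of the disc.

  Area integrals are treated without polar coordinates. Rotation invariance replaces an integrand by
  its circle means, Parseval evaluates these, and the law of the squared modulus turns what is left
  into integrals over [0, 1].\<close>

text \<open>Lebesgue measure is determined by its values on open boxes, and these are rectangles in
  the two real coordinates. This makes Tonelli available for area integrals.\<close>

lemma lborel_complex: "lborel = distr (lborel \<Otimes>\<^sub>M lborel) borel (\<lambda>(x, y). Complex x y)"
proof (rule lborel_eqI)
  show "sets (distr (lborel \<Otimes>\<^sub>M lborel) borel (\<lambda>(x, y). Complex x y)) = sets borel" by simp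
next
  fix l u :: complex
  assume lu: "\<And>b. b \<in> Basis \<Longrightarrow> l \<bullet> b \<le> u \<bullet> b"
  have le: "Re l \<le> Re u" "Im l \<le> Im u"
    using lu[of 1] lu[of \<i>] by (auto simp: Basis_complex_def)
  have m: "(\<lambda>(x, y). Complex x y) \<in> borel_measurable (lborel \<Otimes>\<^sub>M lborel)"
    unfolding Complex_eq case_prod_unfold by measurable
  have vim: "(\<lambda>(x, y). Complex x y) -` box l u \<inter> space (lborel \<Otimes>\<^sub>M lborel)
      = {Re l<..<Re u} \<times> {Im l<..<Im u}"
    by (auto simp: box_complex_eq space_pair_measure)
  have "emeasure (distr (lborel \<Otimes>\<^sub>M lborel) borel (\<lambda>(x, y). Complex x y)) (box l u)
      = emeasure (lborel \<Otimes>\<^sub>M lborel) ({Re l<..<Re u} \<times> {Im l<..<Im u})"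
    by (subst emeasure_distr[OF m]) (simp_all add: vim)
  also have "\<dots> = ennreal ((Re u - Re l) * (Im u - Im l))"
    using le by (subst lborel.emeasure_pair_measure_Times) (simp_all add: ennreal_mult)
  also have "(Re u - Re l) * (Im u - Im l) = (\<Prod>b\<in>Basis. (u - l) \<bullet> b)"
    by (simp add: Basis_complex_def)
  finally show "emeasure (distr (lborel \<Otimes>\<^sub>M lborel) borel (\<lambda>(x, y). Complex x y)) (box l u)
      = ennreal (\<Prod>b\<in>Basis. (u - l) \<bullet> b)" .
qed

lemma measurable_Complex [measurable (raw)]:
  assumes "f \<in> borel_measurable M" "g \<in> borel_measurable M"
  shows "(\<lambda>x. Complex (f x) (g x)) \<in> borel_measurable M"
  using assms unfolding Complex_eq by measurable

lemma
  fixes F :: "complex \<Rightarrow> ennreal"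
  assumes [measurable]: "F \<in> borel_measurable borel"
  shows nn_integral_complex_Re_first:
      "(\<integral>\<^sup>+z. F z \<partial>lborel) = (\<integral>\<^sup>+y. \<integral>\<^sup>+x. F (Complex x y) \<partial>lborel \<partial>lborel)" (is ?A)
    and nn_integral_complex_Im_first:
      "(\<integral>\<^sup>+z. F z \<partial>lborel) = (\<integral>\<^sup>+x. \<integral>\<^sup>+y. F (Complex x y) \<partial>lborel \<partial>lborel)" (is ?B)
proof -
  have "(\<integral>\<^sup>+z. F z \<partial>lborel) = (\<integral>\<^sup>+(x, y). F (Complex x y) \<partial>(lborel \<Otimes>\<^sub>M lborel))"
    by (subst lborel_complex, subst nn_integral_distr) (auto simp: case_prod_unfold)
  moreover have "(\<lambda>(x, y). F (Complex x y)) \<in> borel_measurable (lborel \<Otimes>\<^sub>M lborel)"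
    by measurable
  ultimately show ?A ?B
    using lborel_pair.nn_integral_snd[of "\<lambda>(x, y). F (Complex x y)"]
      lborel.nn_integral_fst[of "\<lambda>(x, y). F (Complex x y)" lborel]
    by simp_all
qed

text \<open>On each horizontal line the shear is a translation.\<close>

lemma nn_integral_shear_Re:
  fixes F :: "complex \<Rightarrow> ennreal"
  assumes [measurable]: "F \<in> borel_measurable borel"
  shows "(\<integral>\<^sup>+z. F (Complex (Re z + c * Im z) (Im z)) \<partial>lborel) = (\<integral>\<^sup>+z. F z \<partial>lborel)"
proof -
  have "(\<integral>\<^sup>+x. F (Complex x y) \<partial>lborel) = (\<integral>\<^sup>+x. F (Complex (x + c * y) y) \<partial>lborel)" for y
    using nn_integral_real_affine[of "\<lambda>x. F (Complex x y)" 1 "c * y"] by (simp add: add.commute)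
  then show ?thesis
    by (simp add: nn_integral_complex_Re_first)
qed

lemma nn_integral_shear_Im:
  fixes F :: "complex \<Rightarrow> ennreal"
  assumes [measurable]: "F \<in> borel_measurable borel"
  shows "(\<integral>\<^sup>+z. F (Complex (Re z) (Im z + c * Re z)) \<partial>lborel) = (\<integral>\<^sup>+z. F z \<partial>lborel)"
proof -
  have "(\<integral>\<^sup>+y. F (Complex x y) \<partial>lborel) = (\<integral>\<^sup>+y. F (Complex x (y + c * x)) \<partial>lborel)" for x
    using nn_integral_real_affine[of "\<lambda>y. F (Complex x y)" 1 "c * x"] by (simp add: add.commute)
  then show ?thesis
    by (simp add: nn_integral_complex_Im_first)
qed

text \<open>Away from \<open>u = -1\<close>, a rotation is a product of three shears.\<close>

lemma nn_integral_rotate: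
  fixes F :: "complex \<Rightarrow> ennreal"
  assumes F [measurable]: "F \<in> borel_measurable borel" and u: "cmod u = 1"
  shows "(\<integral>\<^sup>+z. F (u * z) \<partial>lborel) = (\<integral>\<^sup>+z. F z \<partial>lborel)"
proof -
  have *: "(\<integral>\<^sup>+z. F (u * z) \<partial>lborel) = (\<integral>\<^sup>+z. F z \<partial>lborel)"
    if F [measurable]: "F \<in> borel_measurable borel" and u: "cmod u = 1" "u \<noteq> -1"
    for F :: "complex \<Rightarrow> ennreal" and u
  proof -
    define c s where "c = Re u" and "s = Im u"
    have cs: "c\<^sup>2 + s\<^sup>2 = 1" using u(1) by (simp add: c_def s_def cmod_def)
    have c1: "1 + c \<noteq> 0"
    proof
      assume "1 + c = 0"
      then have "c = -1" by simp
      with cs have "s = 0" by simp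
      with \<open>c = -1\<close> u(2) show False by (simp add: c_def s_def complex_eq_iff)
    qed
    \<comment> \<open>For \<open>u = cis t\<close> this is minus the tangent of t/2; the shears with
      parameters \<open>a\<close>, \<open>s\<close>, \<open>a\<close> compose to the rotation by t.
      It is undefined exactly at \<open>u = -1\<close>, which is handled as the square of the
      rotation by \<open>\<i>\<close>.\<close>
    define a where "a = - s / (1 + c)"
    have a1: "1 + a * s = c" and a2: "a * (1 + c) = - s"
      using c1 cs by (auto simp: a_def field_simps power2_eq_square)
    define G where "G z = F (Complex (Re z + a * Im z) (Im z))" for z
    define H where "H z = G (Complex (Re z) (Im z + s * Re z))" for z
    have [measurable]: "G \<in> borel_measurable borel" "H \<in> borel_measurable borel"
      unfolding G_def H_def by measurable
    have eq: "F (u * z) = H (Complex (Re z + a * Im z) (Im z))" for z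
    proof -
      let ?x = "Re z" and ?y = "Im z"
      have y: "?y + s * (?x + a * ?y) = s * ?x + c * ?y"
        by (simp flip: a1 add: algebra_simps)
      have "?x + a * ?y + a * (s * ?x + c * ?y) = (1 + a * s) * ?x + (a * (1 + c)) * ?y"
        by (simp add: algebra_simps)
      also have "\<dots> = c * ?x - s * ?y" by (simp only: a1 a2)
      finally have x: "?x + a * ?y + a * (s * ?x + c * ?y) = c * ?x - s * ?y" .
      have "u * z = Complex (c * ?x - s * ?y) (s * ?x + c * ?y)"
        by (simp add: complex_eq_iff c_def s_def)
      then show ?thesis by (simp add: H_def G_def x y)
    qed
    have "(\<integral>\<^sup>+z. F (u * z) \<partial>lborel) = (\<integral>\<^sup>+z. H z \<partial>lborel)"
      unfolding eq by (rule nn_integral_shear_Re) measurable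
    also have "\<dots> = (\<integral>\<^sup>+z. G z \<partial>lborel)"
      unfolding H_def by (rule nn_integral_shear_Im) measurable
    also have "\<dots> = (\<integral>\<^sup>+z. F z \<partial>lborel)"
      unfolding G_def by (rule nn_integral_shear_Re) measurable
    finally show ?thesis .
  qed
  show ?thesis
  proof (cases "u = -1")
    case True
    have "(\<integral>\<^sup>+z. F (- z) \<partial>lborel) = (\<integral>\<^sup>+z. F (\<i> * (\<i> * z)) \<partial>lborel)" by simp
    also have "\<dots> = (\<integral>\<^sup>+z. F (\<i> * z) \<partial>lborel)"
      by (rule *[of "\<lambda>z. F (\<i> * z)"]) (auto simp: complex_eq_iff)
    also have "\<dots> = (\<integral>\<^sup>+z. F z \<partial>lborel)"
      by (rule *) (auto simp: complex_eq_iff)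
    finally show ?thesis using True by simp
  qed (use * u F in auto)
qed

section \<open>Parseval and the Littlewood--Paley inequality\<close>

lemma has_integral_cis_int:
  "((\<lambda>t. cis (2 * pi * of_int k * t)) has_integral (if k = 0 then 1 else 0)) {0..1}"
proof (cases "k = 0")
  case False
  define c where "c = 2 * pi * of_int k"
  have c: "c \<noteq> 0" using False by (simp add: c_def)
  have "((\<lambda>t. cis (c * t)) has_integral
      (cis (c * 1) / (\<i> * of_real c) - cis (c * 0) / (\<i> * of_real c))) {0..1}"
  proof (rule fundamental_theorem_of_calculus)
    fix t :: real assume "t \<in> {0..1}"
    have "((\<lambda>z. exp (z * (\<i> * of_real c)) / (\<i> * of_real c)) has_field_derivative
        exp (of_real t * (\<i> * of_real c))) (at (of_real t))"
      using c by (auto intro!: derivative_eq_intros)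
    then have "((\<lambda>t. exp (of_real t * (\<i> * of_real c)) / (\<i> * of_real c)) has_vector_derivative
        exp (of_real t * (\<i> * of_real c))) (at t within {0..1})"
      by (rule has_vector_derivative_real_field)
    then show "((\<lambda>t. cis (c * t) / (\<i> * of_real c)) has_vector_derivative cis (c * t))
        (at t within {0..1})"
      by (simp add: cis_conv_exp mult_ac)
  qed simp
  moreover have "cis c = 1"
    unfolding c_def using cis_multiple_2pi[of "of_int k"] by simp
  ultimately show ?thesis using False by (simp add: c_def)
qed (use has_integral_const_real[of "1::complex" 0 1] in simp)

lemma has_integral_norm_trig_poly:
  fixes e :: "nat \<Rightarrow> complex"
  shows "((\<lambda>t. (cmod (\<Sum>n<N. e n * cis (2 * pi * t) ^ n))\<^sup>2) has_integral
          (\<Sum>n<N. (cmod (e n))\<^sup>2)) {0..1}"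
proof -
  let ?P = "\<lambda>t. \<Sum>n<N. e n * cis (2 * pi * t) ^ n"
  have eq: "of_real ((cmod (?P t))\<^sup>2) =
      (\<Sum>n<N. \<Sum>m<N. (e n * cnj (e m)) * cis (2 * pi * of_int (int n - int m) * t))" for t
  proof -
    have *: "cis (2 * pi * t) ^ n * cnj (cis (2 * pi * t) ^ m)
        = cis (2 * pi * of_int (int n - int m) * t)" for n m
      by (simp add: cis_cnj Complex.DeMoivre cis_mult algebra_simps)
    have "of_real ((cmod (?P t))\<^sup>2) = ?P t * cnj (?P t)"
      by (rule complex_norm_square)
    also have "\<dots> = (\<Sum>n<N. \<Sum>m<N. (e n * cnj (e m)) * (cis (2 * pi * t) ^ n * cnj (cis (2 * pi * t) ^ m)))"
      by (simp add: sum_product mult_ac)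
    finally show ?thesis unfolding * .
  qed
  have "((\<lambda>t. of_real ((cmod (?P t))\<^sup>2)) has_integral
      (\<Sum>n<N. \<Sum>m<N. (e n * cnj (e m)) * (if int n - int m = 0 then 1 else 0))) {0..1}"
    unfolding eq by (intro has_integral_sum has_integral_mult_right has_integral_cis_int) auto
  also have "(\<Sum>n<N. \<Sum>m<N. (e n * cnj (e m)) * (if int n - int m = 0 then 1 else 0))
      = (\<Sum>n<N. e n * cnj (e n))"
    by (intro sum.cong refl) (simp add: if_distrib cong: if_cong)
  also have "\<dots> = of_real (\<Sum>n<N. (cmod (e n))\<^sup>2)"
    by (simp only: of_real_sum complex_norm_square)
  finally have "((\<lambda>t. complex_of_real ((cmod (?P t))\<^sup>2)) has_integral of_real (\<Sum>n<N. (cmod (e n))\<^sup>2)) {0..1}" .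
  from has_integral_Re[OF this] show ?thesis by simp
qed

text \<open>Absolute summability makes the trigonometric partial sums converge uniformly, hence also
  their squared moduli, so the finite Parseval identity passes to the limit under the
  integral.\<close>

lemma nn_integral_circle_Parseval:
  fixes e :: "nat \<Rightarrow> complex"
  assumes e: "summable (\<lambda>n. cmod (e n))"
  shows "summable (\<lambda>n. (cmod (e n))\<^sup>2)"
    and "(\<integral>\<^sup>+t\<in>{0..1}. ennreal ((cmod (\<Sum>n. e n * cis (2 * pi * t) ^ n))\<^sup>2) \<partial>lborel)
          = ennreal (\<Sum>n. (cmod (e n))\<^sup>2)"
proof -
  let ?P = "\<lambda>N t. \<Sum>n<N. e n * cis (2 * pi * t) ^ n"
  let ?H = "\<lambda>t. \<Sum>n. e n * cis (2 * pi * t) ^ n"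
  have "e \<longlonglongrightarrow> 0" using e summable_LIMSEQ_zero tendsto_norm_zero_iff by blast
  then have "eventually (\<lambda>n. cmod (e n) < 1) sequentially"
    using order_tendstoD(2)[OF tendsto_norm_zero] by (metis zero_less_one)
  then have "eventually (\<lambda>n. norm ((cmod (e n))\<^sup>2) \<le> cmod (e n)) sequentially"
    by eventually_elim (simp add: power2_eq_square mult_left_le)
  then show sq: "summable (\<lambda>n. (cmod (e n))\<^sup>2)"
    by (rule summable_comparison_test_ev) (rule e)
  have u: "uniform_limit {0..1} ?P ?H sequentially"
    by (rule Weierstrass_m_test[OF _ e]) (simp add: norm_mult norm_power)
  have cP: "continuous_on {0..1} (?P N)" for N
    by (intro continuous_intros)
  have cH: "continuous_on {0..1} ?H"
    by (rule uniform_limit_theorem[OF _ u]) (auto intro!: always_eventually cP)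
  have bH: "bounded ((\<lambda>t. cmod (?H t)) ` {0..1})"
    by (intro compact_imp_bounded compact_continuous_image continuous_intros cH) auto
  have un: "uniform_limit {0..1} (\<lambda>N t. cmod (?P N t)) (\<lambda>t. cmod (?H t)) sequentially"
    using u by (rule uniform_limit_intros)
  have u2: "uniform_limit (cbox 0 1) (\<lambda>N t. (cmod (?P N t))\<^sup>2) (\<lambda>t. (cmod (?H t))\<^sup>2) sequentially"
    unfolding power2_eq_square using uniform_lim_mult[OF un un bH bH] by simp
  have "continuous_on (cbox 0 1) (\<lambda>t. (cmod (?P N t))\<^sup>2)" for N
    using cP by (auto intro!: continuous_intros)
  from uniform_limit_integral_cbox[OF u2 this] obtain I J where
    I: "\<And>N. ((\<lambda>t. (cmod (?P N t))\<^sup>2) has_integral I N) {0..1}"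
    and J: "((\<lambda>t. (cmod (?H t))\<^sup>2) has_integral J) {0..1}" and lim: "I \<longlonglongrightarrow> J"
    by auto
  have "I = (\<lambda>N. \<Sum>n<N. (cmod (e n))\<^sup>2)"
    using has_integral_unique[OF I has_integral_norm_trig_poly] by blast
  then have "(\<lambda>n. (cmod (e n))\<^sup>2) sums J" using lim by (simp add: sums_def)
  then have "J = (\<Sum>n. (cmod (e n))\<^sup>2)" by (simp add: sums_iff)
  then show "(\<integral>\<^sup>+t\<in>{0..1}. ennreal ((cmod (?H t))\<^sup>2) \<partial>lborel) = ennreal (\<Sum>n. (cmod (e n))\<^sup>2)"
    using nn_integral_has_integral_lebesgue'[OF _ J] by simp
qed

lemma nn_integral_circle_power_series:
  fixes c :: "nat \<Rightarrow> complex"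
  assumes s: "\<And>w. cmod w < r \<Longrightarrow> (\<lambda>n. c n * w ^ n) sums h w" and z: "cmod z < r"
  shows "(\<integral>\<^sup>+t\<in>{0..1}. ennreal ((cmod (h (cis (2 * pi * t) * z)))\<^sup>2) \<partial>lborel)
          = (\<Sum>n. ennreal ((cmod (c n))\<^sup>2 * (cmod z) ^ (2 * n)))"
proof -
  \<comment> \<open>Convergence at a strictly larger radius gives the absolute convergence at
    \<open>z\<close> that Parseval asks for.\<close>
  obtain x where x: "cmod z < x" "x < r" using z dense by blast
  have "summable (\<lambda>n. c n * of_real x ^ n)"
    using s[of "of_real x"] x by (auto simp: sums_iff norm_of_real) (smt (verit) norm_ge_zero)+
  then have sum: "summable (\<lambda>n. cmod (c n * z ^ n))"
    by (rule powser_insidea) (use x in auto)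
  have h: "h (cis (2 * pi * t) * z) = (\<Sum>n. (c n * z ^ n) * cis (2 * pi * t) ^ n)" for t
    using s[of "cis (2 * pi * t) * z"] z
    by (simp add: sums_iff norm_mult power_mult_distrib mult_ac)
  have eq: "(cmod (c n * z ^ n))\<^sup>2 = (cmod (c n))\<^sup>2 * (cmod z) ^ (2 * n)" for n
    by (simp add: norm_mult norm_power power_mult_distrib power_mult mult.commute flip: power_mult)
  have sm: "summable (\<lambda>n. (cmod (c n))\<^sup>2 * (cmod z) ^ (2 * n))"
    using nn_integral_circle_Parseval(1)[OF sum] by (simp only: eq)
  show "(\<integral>\<^sup>+t\<in>{0..1}. ennreal ((cmod (h (cis (2 * pi * t) * z)))\<^sup>2) \<partial>lborel)
          = (\<Sum>n. ennreal ((cmod (c n))\<^sup>2 * (cmod z) ^ (2 * n)))"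
    unfolding h nn_integral_circle_Parseval(2)[OF sum] eq
    by (rule suminf_ennreal2[symmetric]) (use sm in auto)
qed

text \<open>Rotation invariance averaged over all angles by Tonelli. It stands in for polar
  coordinates: the inner integral depends on the modulus of \<open>z\<close> alone.\<close>

lemma nn_integral_rotation_mean:
  fixes F :: "complex \<Rightarrow> ennreal"
  assumes F [measurable]: "F \<in> borel_measurable borel"
  shows "(\<integral>\<^sup>+z. F z \<partial>lborel) = (\<integral>\<^sup>+z. (\<integral>\<^sup>+t\<in>{0..1}. F (cis (2 * pi * t) * z) \<partial>lborel) \<partial>lborel)"
proof -
  have [measurable]: "cis \<in> borel_measurable borel"
    by (intro borel_measurable_continuous_onI continuous_intros)
  have m: "(\<lambda>(z, t). F (cis (2 * pi * t) * z) * indicator {0..1} t) \<in> borel_measurable (lborel \<Otimes>\<^sub>M lborel)"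
    by measurable
  have "(\<integral>\<^sup>+z. (\<integral>\<^sup>+t\<in>{0..1}. F (cis (2 * pi * t) * z) \<partial>lborel) \<partial>lborel)
      = (\<integral>\<^sup>+t. \<integral>\<^sup>+z. F (cis (2 * pi * t) * z) * indicator {0..1} t \<partial>lborel \<partial>lborel)"
    using lborel_pair.Fubini'[OF m] by simp
  also have "\<dots> = (\<integral>\<^sup>+t. (\<integral>\<^sup>+z. F z \<partial>lborel) * indicator {0..1::real} t \<partial>lborel)"
    by (simp add: nn_integral_multc nn_integral_rotate)
  also have "\<dots> = (\<integral>\<^sup>+z. F z \<partial>lborel)"
    by (simp add: nn_integral_cmult)
  finally show ?thesis ..
qed

text \<open>A radial weight is constant on circles, so monomials of different degree stay
  orthogonal: Parseval on each circle, followed by exchanging sum and integral.\<close>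

lemma nn_integral_radial_power_series:
  fixes c :: "nat \<Rightarrow> complex" and w :: "real \<Rightarrow> ennreal"
  assumes s: "\<And>z. cmod z < r \<Longrightarrow> (\<lambda>n. c n * z ^ n) sums h z"
    and h: "continuous_on (ball 0 r) h" and w [measurable]: "w \<in> borel_measurable borel"
  shows "(\<integral>\<^sup>+z\<in>ball 0 r. ennreal ((cmod (h z))\<^sup>2) * w (cmod z) \<partial>lborel)
    = (\<Sum>n. ennreal ((cmod (c n))\<^sup>2) * (\<integral>\<^sup>+z\<in>ball 0 r. ennreal (cmod z ^ (2 * n)) * w (cmod z) \<partial>lborel))"
proof -
  have [measurable]: "ball 0 r \<in> sets (borel :: complex measure)" by simp
  have [measurable]: "(\<lambda>z. indicator (ball 0 r) z *\<^sub>R h z) \<in> borel_measurable borel"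
    using h by (intro borel_measurable_continuous_on_indicator) auto
  \<comment> \<open>Nothing is known about \<open>h\<close> outside the ball; cutting it off there
    yields a Borel function on the whole plane, as the rotation mean requires.\<close>
  define F where "F z = ennreal ((cmod (indicator (ball 0 r) z *\<^sub>R h z))\<^sup>2) * w (cmod z)" for z
  have [measurable]: "F \<in> borel_measurable borel" unfolding F_def by measurable
  have "(\<integral>\<^sup>+z\<in>ball 0 r. ennreal ((cmod (h z))\<^sup>2) * w (cmod z) \<partial>lborel) = (\<integral>\<^sup>+z. F z \<partial>lborel)"
    by (intro nn_integral_cong) (auto simp: F_def indicator_def)
  also have "\<dots> = (\<integral>\<^sup>+z. (\<integral>\<^sup>+t\<in>{0..1}. F (cis (2 * pi * t) * z) \<partial>lborel) \<partial>lborel)"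
    by (rule nn_integral_rotation_mean) measurable
  also have "\<dots> = (\<integral>\<^sup>+z. (\<Sum>n. ennreal ((cmod (c n))\<^sup>2) *
      (ennreal (cmod z ^ (2 * n)) * w (cmod z) * indicator (ball 0 r) z)) \<partial>lborel)"
  proof (rule nn_integral_cong)
    fix z :: complex
    show "(\<integral>\<^sup>+t\<in>{0..1}. F (cis (2 * pi * t) * z) \<partial>lborel) = (\<Sum>n. ennreal ((cmod (c n))\<^sup>2) *
      (ennreal (cmod z ^ (2 * n)) * w (cmod z) * indicator (ball 0 r) z))"
    proof (cases "cmod z < r")
      case True
      have mm: "(\<lambda>t. indicator {0..1} t * ennreal ((cmod (h (cis (2 * pi * t) * z)))\<^sup>2)) \<in> borel_measurable lborel"
      proof -
        have "continuous_on {0..1} (\<lambda>t. (cmod (h (cis (2 * pi * t) * z)))\<^sup>2)"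
          by (intro continuous_intros continuous_on_compose2[OF h])
             (use True in \<open>auto simp: norm_mult\<close>)
        then have "(\<lambda>t. indicator {0..1} t *\<^sub>R ((cmod (h (cis (2 * pi * t) * z)))\<^sup>2)) \<in> borel_measurable borel"
          by (intro borel_measurable_continuous_on_indicator) auto
        then have "(\<lambda>t. ennreal (indicator {0..1} t *\<^sub>R ((cmod (h (cis (2 * pi * t) * z)))\<^sup>2))) \<in> borel_measurable borel"
          by measurable
        also have "(\<lambda>t. ennreal (indicator {0..1} t *\<^sub>R ((cmod (h (cis (2 * pi * t) * z)))\<^sup>2)))
            = (\<lambda>t. indicator {0..1} t * ennreal ((cmod (h (cis (2 * pi * t) * z)))\<^sup>2))"
          by (auto simp: fun_eq_iff indicator_def)
        finally show ?thesis by simp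
      qed
      have "(\<integral>\<^sup>+t\<in>{0..1}. F (cis (2 * pi * t) * z) \<partial>lborel)
         = (\<integral>\<^sup>+t. (indicator {0..1} t * ennreal ((cmod (h (cis (2 * pi * t) * z)))\<^sup>2)) * w (cmod z) \<partial>lborel)"
        using True by (intro nn_integral_cong) (auto simp: F_def norm_mult indicator_def)
      also have "\<dots> = (\<integral>\<^sup>+t\<in>{0..1}. ennreal ((cmod (h (cis (2 * pi * t) * z)))\<^sup>2) \<partial>lborel) * w (cmod z)"
        by (subst nn_integral_multc[OF mm]) (simp add: mult.commute)
      also have "\<dots> = (\<Sum>n. ennreal ((cmod (c n))\<^sup>2 * (cmod z) ^ (2 * n)) * w (cmod z))"
        by (simp add: nn_integral_circle_power_series[OF s True])
      finally show ?thesis using True by (simp add: ennreal_mult mult.assoc)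
    qed (simp add: F_def norm_mult)
  qed
  also have "\<dots> = (\<Sum>n. ennreal ((cmod (c n))\<^sup>2) *
      (\<integral>\<^sup>+z\<in>ball 0 r. ennreal (cmod z ^ (2 * n)) * w (cmod z) \<partial>lborel))"
    by (subst nn_integral_suminf) (auto intro!: suminf_cong nn_integral_cmult)
  finally show ?thesis .
qed

section \<open>Radial area integrals and the Littlewood-Paley inequality\<close>

text \<open>The annulus between the radii sqrt x and 1 has area pi (1 - x), so the squared modulus
  is uniformly distributed. Measures on the line that are finite on the half-lines
  \<open>{x<..}\<close> are determined by their values there.\<close>

lemma distr_norm_square_disc:
  "distr (density lborel (indicator disc)) borel (\<lambda>z. (cmod z)\<^sup>2)
    = density lborel (\<lambda>s. ennreal pi * indicator {0..1} s)" (is "?L = ?R")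
proof (rule measure_eqI_lessThan)
  fix x :: real
  have [measurable]: "disc \<in> sets borel" by simp
  have L: "emeasure ?L {x<..} = emeasure lborel {z. x < (cmod z)\<^sup>2 \<and> z \<in> disc}"
  proof -
    have "emeasure ?L {x<..} = (\<integral>\<^sup>+z. indicator disc z * indicator {z. x < (cmod z)\<^sup>2} z \<partial>lborel)"
      by (simp add: emeasure_distr emeasure_density vimage_def)
    also have "\<dots> = (\<integral>\<^sup>+z. indicator {z. x < (cmod z)\<^sup>2 \<and> z \<in> disc} z \<partial>lborel)"
      by (intro nn_integral_cong) (auto simp: indicator_def)
    finally show ?thesis by simp
  qed
  have R: "emeasure ?R {x<..} = ennreal pi * emeasure lborel ({0..1} \<inter> {x<..})"
  proof -
    have "emeasure ?R {x<..} = (\<integral>\<^sup>+s. ennreal pi * indicator ({0..1} \<inter> {x<..}) s \<partial>lborel)"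
      by (simp add: emeasure_density mult.assoc indicator_inter_arith)
    then show ?thesis by (simp add: nn_integral_cmult)
  qed
  have area: "emeasure lborel disc = ennreal pi"
    using emeasure_ball[of 1 "0 :: complex"] by (simp add: unit_ball_vol_2)
  show "emeasure ?L {x<..} < \<infinity>"
  proof -
    have "emeasure ?L {x<..} \<le> emeasure lborel disc"
      unfolding L by (rule emeasure_mono) auto
    then show ?thesis by (simp add: area le_less_trans)
  qed
  consider "x < 0" | "0 \<le> x" "x \<le> 1" | "x > 1" by linarith
  then show "emeasure ?L {x<..} = emeasure ?R {x<..}"
  proof cases
    case 1
    have "{z. x < (cmod z)\<^sup>2 \<and> z \<in> disc} = disc" using 1 by (auto intro: less_le_trans)
    moreover have "{0..1} \<inter> {x<..} = {0..1}" using 1 by auto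
    ultimately show ?thesis unfolding L R by (simp add: area)
  next
    case 2
    have iff: "x < (cmod z)\<^sup>2 \<longleftrightarrow> sqrt x < cmod z" for z
      using real_sqrt_less_iff[of x "(cmod z)\<^sup>2"] by simp
    have "{z. x < (cmod z)\<^sup>2 \<and> z \<in> disc} = disc - cball 0 (sqrt x)"
      unfolding iff by auto
    moreover have "emeasure lborel (disc - cball 0 (sqrt x)) = ennreal (pi * (1 - x))"
    \<comment> \<open>At \<open>x = 1\<close> the closed ball is no longer contained in the open
      disc, so subtracting measures is not possible there.\<close>
    proof (cases "x = 1")
      case True
      have "disc - cball 0 (sqrt x) = {}" using True by auto
      then show ?thesis unfolding \<open>disc - cball 0 (sqrt x) = {}\<close> by (simp add: True)
    next
      case False
      have "emeasure lborel (disc - cball 0 (sqrt x)) = emeasure lborel disc - emeasure lborel (cball (0::complex) (sqrt x))"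
        by (rule emeasure_Diff) (use 2 False in \<open>auto simp: emeasure_cball subset_eq intro: le_less_trans\<close>)
      also have "\<dots> = ennreal (pi - pi * x)"
        using 2 by (simp add: area emeasure_cball unit_ball_vol_2 ennreal_minus)
      finally show ?thesis by (simp add: algebra_simps)
    qed
    moreover have "{0..1} \<inter> {x<..} = {x<..1}" using 2 by auto
    ultimately show ?thesis unfolding L R using 2 by (simp add: ennreal_mult)
  next
    case 3
    have e1: "{z. x < (cmod z)\<^sup>2 \<and> z \<in> disc} = {}"
      using 3 by auto (smt (verit) norm_ge_zero power_le_one)
    have e2: "{0..1} \<inter> {x<..} = {}" using 3 by auto
    show ?thesis unfolding L R e1 e2 by simp
  qed
qed simp_all

lemma nn_integral_disc_norm_square:
  fixes f :: "real \<Rightarrow> ennreal"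
  assumes [measurable]: "f \<in> borel_measurable borel"
  shows "(\<integral>\<^sup>+z\<in>disc. f ((cmod z)\<^sup>2) \<partial>lborel) = ennreal pi * (\<integral>\<^sup>+s\<in>{0..1}. f s \<partial>lborel)"
proof -
  have [measurable]: "disc \<in> sets borel" by simp
  have "(\<integral>\<^sup>+z\<in>disc. f ((cmod z)\<^sup>2) \<partial>lborel)
      = (\<integral>\<^sup>+s. f s \<partial>distr (density lborel (indicator disc)) borel (\<lambda>z. (cmod z)\<^sup>2))"
    by (simp add: nn_integral_distr nn_integral_density mult.commute)
  also have "\<dots> = ennreal pi * (\<integral>\<^sup>+s\<in>{0..1}. f s \<partial>lborel)"
    unfolding distr_norm_square_disc
    by (simp add: nn_integral_density mult.assoc nn_integral_cmult) (simp add: mult.commute)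
  finally show ?thesis .
qed

text \<open>With s the squared modulus this is pi times the Beta integral B(n + 1, 2).\<close>

lemma nn_integral_disc_moment:
  "(\<integral>\<^sup>+z\<in>disc. ennreal (cmod z ^ (2 * n)) * ennreal (1 - (cmod z)\<^sup>2) \<partial>lborel)
    = ennreal (pi / ((real n + 1) * (real n + 2)))"
proof -
  have "(\<integral>\<^sup>+z\<in>disc. ennreal (cmod z ^ (2 * n)) * ennreal (1 - (cmod z)\<^sup>2) \<partial>lborel)
      = ennreal pi * (\<integral>\<^sup>+s\<in>{0..1}. ennreal (s ^ n) * ennreal (1 - s) \<partial>lborel)"
    unfolding power_mult by (rule nn_integral_disc_norm_square) measurable
  also have "(\<integral>\<^sup>+s\<in>{0..1}. ennreal (s ^ n) * ennreal (1 - s) \<partial>lborel)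
      = (\<integral>\<^sup>+s. ennreal (s ^ n * (1 - s)) * indicator {0..1} s \<partial>lborel)"
    by (intro nn_integral_cong) (auto simp: indicator_def ennreal_mult)
  also have "\<dots> = ennreal (1 / ((real n + 1) * (real n + 2)))"
  proof (rule nn_integral_has_integral_lebesgue')
    let ?F = "\<lambda>s::real. s ^ (n + 1) / (n + 1) - s ^ (n + 2) / (n + 2)"
    have "((\<lambda>s. s ^ n * (1 - s)) has_integral (?F 1 - ?F 0)) {0..1}"
    proof (rule fundamental_theorem_of_calculus)
      fix s :: real
      have "(?F has_real_derivative (real (n + 1) * s ^ n) / real (n + 1) - (real (n + 2) * s ^ (n + 1)) / real (n + 2)) (at s within {0..1})"
        by (rule derivative_eq_intros refl | simp)+
      also have "(real (n + 1) * s ^ n) / real (n + 1) - (real (n + 2) * s ^ (n + 1)) / real (n + 2) = s ^ n * (1 - s)"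
        by (subst (1 2) nonzero_mult_div_cancel_left) (auto simp: algebra_simps simp del: of_nat_add)
      finally show "(?F has_vector_derivative s ^ n * (1 - s)) (at s within {0..1})"
        by (simp add: has_real_derivative_iff_has_vector_derivative)
    qed simp
    then show "((\<lambda>s. s ^ n * (1 - s)) has_integral (1 / ((real n + 1) * (real n + 2)))) {0..1}"
      by (simp add: field_simps)
  qed auto
  finally show ?thesis by (simp add: ennreal_mult'[symmetric])
qed

text \<open>Differentiation multiplies the squared coefficient of index n + 1 by (n + 1)^2, and the
  moment of the weight divides it by (n + 1)(n + 2). Up to the factor pi the integral is therefore
  at most the sum of the squared coefficients, which the circle means control.\<close>

lemma Littlewood_Paley_le:
  assumes g: "g holomorphic_on disc"
    and M: "\<And>z. z \<in> disc \<Longrightarrow>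
        (\<integral>\<^sup>+t\<in>{0..1}. ennreal ((cmod (g (cis (2 * pi * t) * z)))\<^sup>2) \<partial>lborel) \<le> ennreal M"
    and M0: "0 \<le> M"
  shows "(\<integral>\<^sup>+z\<in>disc. ennreal ((cmod (deriv g z))\<^sup>2) * ennreal (1 - (cmod z)\<^sup>2) \<partial>lborel)
    \<le> ennreal (pi * M)"
proof -
  define c where "c n = (deriv ^^ n) g 0 / fact n" for n
  have g_sums: "(\<lambda>n. c n * z ^ n) sums g z" if "cmod z < 1" for z
    using holomorphic_power_series[OF g, of z] that by (simp add: c_def)
  have dg: "deriv g holomorphic_on disc"
    using g by (intro holomorphic_deriv) auto
  have "(deriv ^^ n) (deriv g) 0 / fact n = of_nat (Suc n) * c (Suc n)" for n
    by (simp add: c_def funpow_swap1 field_simps del: of_nat_Suc)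
  then have dg_sums: "(\<lambda>n. (of_nat (Suc n) * c (Suc n)) * z ^ n) sums deriv g z" if "cmod z < 1" for z
    using holomorphic_power_series[OF dg, of z] that by simp
  \<comment> \<open>Boundary values of \<open>g\<close> are avoided: for fixed \<open>N\<close> the
    bound holds on every circle of radius \<open>r < 1\<close> and survives \<open>r\<close> tending
    to 1.\<close>
  have partial: "(\<Sum>n<N. (cmod (c n))\<^sup>2) \<le> M" for N
  proof (rule tendsto_upperbound)
    have "((\<lambda>r. \<Sum>n<N. (cmod (c n))\<^sup>2 * r ^ (2 * n)) \<longlongrightarrow>
        (\<Sum>n<N. (cmod (c n))\<^sup>2 * 1 ^ (2 * n))) (at_left 1)"
      by (intro tendsto_sum tendsto_mult tendsto_power tendsto_const tendsto_ident_at)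
    then show "((\<lambda>r. \<Sum>n<N. (cmod (c n))\<^sup>2 * r ^ (2 * n)) \<longlongrightarrow> (\<Sum>n<N. (cmod (c n))\<^sup>2)) (at_left 1)"
      by (simp only: power_one mult_1_right)
    have "\<forall>\<^sub>F r in at_left (1::real). r \<in> {0<..<1}"
      by (rule eventually_at_leftI) auto
    then show "\<forall>\<^sub>F r in at_left 1. (\<Sum>n<N. (cmod (c n))\<^sup>2 * r ^ (2 * n)) \<le> M"
    proof eventually_elim
      case (elim r)
      have r: "cmod (of_real r) < 1" and r': "cmod (of_real r) = r" using elim by auto
      note ps = nn_integral_circle_power_series[OF g_sums r]
      have "ennreal (\<Sum>n<N. (cmod (c n))\<^sup>2 * r ^ (2 * n)) = (\<Sum>n<N. ennreal ((cmod (c n))\<^sup>2 * r ^ (2 * n)))"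
        using elim by (intro sum_ennreal[symmetric]) auto
      also have "\<dots> \<le> (\<Sum>n. ennreal ((cmod (c n))\<^sup>2 * r ^ (2 * n)))"
        by (intro sum_le_suminf) auto
      also have "\<dots> = (\<integral>\<^sup>+t\<in>{0..1}. ennreal ((cmod (g (cis (2 * pi * t) * of_real r)))\<^sup>2) \<partial>lborel)"
        using ps by (simp only: r')
      also have "\<dots> \<le> ennreal M"
        using r by (intro M) (simp only: mem_ball_0)
      finally show ?case using M0 by (simp only: ennreal_le_iff)
    qed
  qed simp
  have "(\<integral>\<^sup>+z\<in>disc. ennreal ((cmod (deriv g z))\<^sup>2) * ennreal (1 - (cmod z)\<^sup>2) \<partial>lborel)
      = (\<Sum>n. ennreal ((cmod (of_nat (Suc n) * c (Suc n)))\<^sup>2) * ennreal (pi / ((real n + 1) * (real n + 2))))"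
    unfolding nn_integral_disc_moment[symmetric]
    by (rule nn_integral_radial_power_series)
       (use dg_sums dg in \<open>auto intro: holomorphic_on_imp_continuous_on\<close>)
  also have "\<dots> \<le> (\<Sum>n. ennreal (pi * (cmod (c (Suc n)))\<^sup>2))"
  proof (intro suminf_le allI)
    fix n
    have "(x * C)\<^sup>2 * (pi / (x * y)) = x / y * (pi * C\<^sup>2)" if "x > 0" "y > 0" for x y C :: real
      using that by (simp add: field_simps power2_eq_square)
    from this[of "real n + 1" "real n + 2" "cmod (c (Suc n))"]
    have "(cmod (of_nat (Suc n) * c (Suc n)))\<^sup>2 * (pi / ((real n + 1) * (real n + 2)))
        = ((real n + 1) / (real n + 2)) * (pi * (cmod (c (Suc n)))\<^sup>2)"
      by (simp add: norm_mult del: of_nat_Suc) (simp add: add.commute)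
    also have "\<dots> \<le> 1 * (pi * (cmod (c (Suc n)))\<^sup>2)"
      by (rule mult_right_mono) auto
    also have "\<dots> = pi * (cmod (c (Suc n)))\<^sup>2" by simp
    finally have le: "(cmod (of_nat (Suc n) * c (Suc n)))\<^sup>2 * (pi / ((real n + 1) * (real n + 2)))
        \<le> pi * (cmod (c (Suc n)))\<^sup>2" .
    have "ennreal ((cmod (of_nat (Suc n) * c (Suc n)))\<^sup>2) * ennreal (pi / ((real n + 1) * (real n + 2)))
        = ennreal ((cmod (of_nat (Suc n) * c (Suc n)))\<^sup>2 * (pi / ((real n + 1) * (real n + 2))))"
      by (rule ennreal_mult[symmetric]) auto
    also have "\<dots> \<le> ennreal (pi * (cmod (c (Suc n)))\<^sup>2)" by (rule ennreal_leI[OF le])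
    finally show "ennreal ((cmod (of_nat (Suc n) * c (Suc n)))\<^sup>2) * ennreal (pi / ((real n + 1) * (real n + 2)))
        \<le> ennreal (pi * (cmod (c (Suc n)))\<^sup>2)" .
  qed auto
  also have "\<dots> \<le> ennreal (pi * M)"
  proof (rule suminf_le_const)
    fix N
    have "(\<Sum>n<N. pi * (cmod (c (Suc n)))\<^sup>2) \<le> pi * (\<Sum>n<Suc N. (cmod (c n))\<^sup>2)"
      unfolding sum.lessThan_Suc_shift sum_distrib_left[symmetric] by (intro mult_left_mono) auto
    also have "\<dots> \<le> pi * M" by (intro mult_left_mono partial) auto
    finally show "(\<Sum>n<N. ennreal (pi * (cmod (c (Suc n)))\<^sup>2)) \<le> ennreal (pi * M)"
      by (simp add: sum_ennreal ennreal_leI)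
  qed auto
  finally show ?thesis .
qed

section \<open>Bounded functions and BMOA\<close>

lemma borel_measurable_weighted_square:
  assumes h: "continuous_on disc h"
  shows "(\<lambda>z. ennreal ((cmod (h z))\<^sup>2) * ennreal (1 - (cmod z)\<^sup>2) * indicator disc z)
    \<in> borel_measurable lborel"
proof -
  have [measurable]: "(\<lambda>z. indicator disc z *\<^sub>R h z) \<in> borel_measurable borel"
    using h by (intro borel_measurable_continuous_on_indicator) auto
  have [measurable]: "disc \<in> sets borel" by simp
  have "(\<lambda>z. ennreal ((cmod (indicator disc z *\<^sub>R h z))\<^sup>2) * ennreal (1 - (cmod z)\<^sup>2) * indicator disc z)
      \<in> borel_measurable lborel"
    by measurable
  also have "(\<lambda>z. ennreal ((cmod (indicator disc z *\<^sub>R h z))\<^sup>2) * ennreal (1 - (cmod z)\<^sup>2) * indicator disc z)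
     = (\<lambda>z. ennreal ((cmod (h z))\<^sup>2) * ennreal (1 - (cmod z)\<^sup>2) * indicator disc z)"
    by (auto simp: fun_eq_iff indicator_def)
  finally show ?thesis .
qed

lemma cnj_mult_ne_1: "cmod a < 1 \<Longrightarrow> cmod z \<le> 1 \<Longrightarrow> cnj a * z \<noteq> 1"
  by (metis complex_mod_cnj mult_left_le norm_ge_zero norm_mult norm_one order.strict_trans1 order_less_irrefl)

text \<open>The kernel is a geometric series; Parseval sums the squares of its coefficients,
  uniformly in the radius of the circle.\<close>

lemma nn_integral_circle_Szego_kernel:
  assumes a: "a \<in> disc" and z: "z \<in> disc"
  shows "(\<integral>\<^sup>+t\<in>{0..1}. ennreal ((cmod (1 / (1 - cnj a * (cis (2 * pi * t) * z))))\<^sup>2) \<partial>lborel)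
    \<le> ennreal (1 / (1 - (cmod a)\<^sup>2))"
proof -
  have a1: "(cmod a)\<^sup>2 < 1" using a by (simp add: abs_square_less_1)
  have s: "(\<lambda>n. (cnj a) ^ n * w ^ n) sums (1 / (1 - cnj a * w))" if "cmod w < 1" for w
  proof -
    have "cmod (cnj a * w) < 1" using norm_mult_less[of "cnj a" 1 w 1] a that by simp
    from geometric_sums[OF this] show ?thesis by (simp add: power_mult_distrib)
  qed
  have "(\<integral>\<^sup>+t\<in>{0..1}. ennreal ((cmod (1 / (1 - cnj a * (cis (2 * pi * t) * z))))\<^sup>2) \<partial>lborel)
     = (\<Sum>n. ennreal ((cmod ((cnj a) ^ n))\<^sup>2 * (cmod z) ^ (2 * n)))"
    by (rule nn_integral_circle_power_series[where h = "\<lambda>w. 1 / (1 - cnj a * w)"]) (use s z in auto)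
  also have "\<dots> \<le> (\<Sum>n. ennreal (((cmod a)\<^sup>2) ^ n))"
  proof (intro suminf_le allI ennreal_leI)
    fix n
    have "(cmod ((cnj a) ^ n))\<^sup>2 * (cmod z) ^ (2 * n) = ((cmod a)\<^sup>2) ^ n * (cmod z) ^ (2 * n)"
      by (simp add: norm_power mult.commute flip: power_mult)
    also have "\<dots> \<le> ((cmod a)\<^sup>2) ^ n * 1"
      using z by (intro mult_left_mono power_le_one) auto
    finally show "(cmod ((cnj a) ^ n))\<^sup>2 * (cmod z) ^ (2 * n) \<le> ((cmod a)\<^sup>2) ^ n" by simp
  qed auto
  also have "\<dots> = ennreal (\<Sum>n. ((cmod a)\<^sup>2) ^ n)"
    using a1 by (intro suminf_ennreal2 summable_geometric) auto
  also have "(\<Sum>n. ((cmod a)\<^sup>2) ^ n) = 1 / (1 - (cmod a)\<^sup>2)"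
    using a1 by (intro suminf_geometric) auto
  finally show ?thesis .
qed

text \<open>With \<open>u\<close> the Szego kernel, \<open>f' u = (f u)' - f u'\<close>, and both derivatives on the right are
  controlled by the Littlewood--Paley inequality.\<close>

lemma nn_integral_disc_deriv_bounded:
  assumes f: "f holomorphic_on disc" and M: "\<And>z. z \<in> disc \<Longrightarrow> cmod (f z) \<le> M" and a: "a \<in> disc"
  shows "(\<integral>\<^sup>+z\<in>disc. ennreal ((cmod (deriv f z / (1 - cnj a * z)))\<^sup>2) * ennreal (1 - (cmod z)\<^sup>2) \<partial>lborel)
    \<le> ennreal (4 * pi * M\<^sup>2 / (1 - (cmod a)\<^sup>2))"
proof -
  have a1: "(cmod a)\<^sup>2 < 1" using a by (simp add: abs_square_less_1)
  define u where "u z = 1 / (1 - cnj a * z)" for z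
  define g where "g z = f z * u z" for z
  have u: "u holomorphic_on disc"
    unfolding u_def using a cnj_mult_ne_1[of a] by (intro holomorphic_intros) auto
  have g: "g holomorphic_on disc"
    unfolding g_def by (intro holomorphic_intros f u)
  have c: "continuous_on disc (deriv u)" "continuous_on disc (deriv g)"
    using u g by (auto intro!: holomorphic_on_imp_continuous_on holomorphic_deriv)
  have LPu: "(\<integral>\<^sup>+z\<in>disc. ennreal ((cmod (deriv u z))\<^sup>2) * ennreal (1 - (cmod z)\<^sup>2) \<partial>lborel)
      \<le> ennreal (pi * (1 / (1 - (cmod a)\<^sup>2)))"
    by (rule Littlewood_Paley_le[OF u])
       (use nn_integral_circle_Szego_kernel[OF a] a1 in \<open>auto simp: u_def\<close>)
  have LPg: "(\<integral>\<^sup>+z\<in>disc. ennreal ((cmod (deriv g z))\<^sup>2) * ennreal (1 - (cmod z)\<^sup>2) \<partial>lborel)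
      \<le> ennreal (pi * (M\<^sup>2 * (1 / (1 - (cmod a)\<^sup>2))))"
  proof (rule Littlewood_Paley_le[OF g])
    fix z :: complex assume z: "z \<in> disc"
    have meas: "(\<lambda>t. ennreal ((cmod (u (cis (2 * pi * t) * z)))\<^sup>2) * indicator {0..1} t) \<in> borel_measurable lborel"
    proof -
      have [measurable]: "cis \<in> borel_measurable borel"
        by (intro borel_measurable_continuous_onI continuous_intros)
      show ?thesis unfolding u_def by measurable
    qed
    have "(\<integral>\<^sup>+t\<in>{0..1}. ennreal ((cmod (g (cis (2 * pi * t) * z)))\<^sup>2) \<partial>lborel)
       \<le> (\<integral>\<^sup>+t. ennreal (M\<^sup>2) * (ennreal ((cmod (u (cis (2 * pi * t) * z)))\<^sup>2) * indicator {0..1} t) \<partial>lborel)"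
    proof (rule nn_integral_mono)
      fix t :: real
      have "cmod (f (cis (2 * pi * t) * z)) \<le> M" using z by (intro M) (simp add: norm_mult)
      then have "(cmod (g (cis (2 * pi * t) * z)))\<^sup>2 \<le> M\<^sup>2 * (cmod (u (cis (2 * pi * t) * z)))\<^sup>2"
        unfolding g_def norm_mult power_mult_distrib by (intro mult_right_mono power_mono) auto
      then show "ennreal ((cmod (g (cis (2 * pi * t) * z)))\<^sup>2) * indicator {0..1} t
          \<le> ennreal (M\<^sup>2) * (ennreal ((cmod (u (cis (2 * pi * t) * z)))\<^sup>2) * indicator {0..1} t)"
        by (auto simp: indicator_def ennreal_leI simp flip: ennreal_mult)
    qed
    also have "\<dots> = ennreal (M\<^sup>2) * (\<integral>\<^sup>+t\<in>{0..1}. ennreal ((cmod (u (cis (2 * pi * t) * z)))\<^sup>2) \<partial>lborel)"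
      by (rule nn_integral_cmult[OF meas])
    also have "\<dots> \<le> ennreal (M\<^sup>2) * ennreal (1 / (1 - (cmod a)\<^sup>2))"
      unfolding u_def by (intro mult_left_mono nn_integral_circle_Szego_kernel[OF a z]) auto
    finally show "(\<integral>\<^sup>+t\<in>{0..1}. ennreal ((cmod (g (cis (2 * pi * t) * z)))\<^sup>2) \<partial>lborel)
       \<le> ennreal (M\<^sup>2 * (1 / (1 - (cmod a)\<^sup>2)))"
      by (simp add: ennreal_mult'[symmetric])
  qed (use a1 in auto)
  let ?G = "\<lambda>h z. ennreal ((cmod (h z))\<^sup>2) * ennreal (1 - (cmod z)\<^sup>2) * indicator disc z"
  have "(\<integral>\<^sup>+z\<in>disc. ennreal ((cmod (deriv f z / (1 - cnj a * z)))\<^sup>2) * ennreal (1 - (cmod z)\<^sup>2) \<partial>lborel)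
      \<le> (\<integral>\<^sup>+z. 2 * ?G (deriv g) z + ennreal (2 * M\<^sup>2) * ?G (deriv u) z \<partial>lborel)"
  proof (rule nn_integral_mono)
    fix z :: complex
    show "ennreal ((cmod (deriv f z / (1 - cnj a * z)))\<^sup>2) * ennreal (1 - (cmod z)\<^sup>2) * indicator disc z
        \<le> 2 * ?G (deriv g) z + ennreal (2 * M\<^sup>2) * ?G (deriv u) z"
    proof (cases "z \<in> disc")
      case True
      have "deriv g z = deriv f z * u z + f z * deriv u z"
        unfolding g_def using holomorphic_on_imp_differentiable_at[OF f _ True]
          holomorphic_on_imp_differentiable_at[OF u _ True] by (simp add: mult.commute)
      then have "deriv f z / (1 - cnj a * z) = deriv g z - f z * deriv u z"
        by (simp add: u_def)
      then have "cmod (deriv f z / (1 - cnj a * z)) \<le> cmod (deriv g z) + cmod (f z) * cmod (deriv u z)"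
        by (metis norm_mult norm_triangle_ineq4)
      also have "\<dots> \<le> cmod (deriv g z) + M * cmod (deriv u z)"
        using M[OF True] by (intro add_left_mono mult_right_mono) auto
      finally have "(cmod (deriv f z / (1 - cnj a * z)))\<^sup>2 \<le> (cmod (deriv g z) + M * cmod (deriv u z))\<^sup>2"
        by (intro power_mono) auto
      also have "\<dots> \<le> 2 * (cmod (deriv g z))\<^sup>2 + 2 * M\<^sup>2 * (cmod (deriv u z))\<^sup>2"
        using sum_squares_bound[of "cmod (deriv g z)" "M * cmod (deriv u z)"]
        by (simp add: power2_sum power_mult_distrib)
      finally have "(cmod (deriv f z / (1 - cnj a * z)))\<^sup>2 * (1 - (cmod z)\<^sup>2)
          \<le> (2 * (cmod (deriv g z))\<^sup>2 + 2 * M\<^sup>2 * (cmod (deriv u z))\<^sup>2) * (1 - (cmod z)\<^sup>2)"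
        using True by (intro mult_right_mono) (auto simp: power_le_one)
      then have "ennreal ((cmod (deriv f z / (1 - cnj a * z)))\<^sup>2 * (1 - (cmod z)\<^sup>2))
          \<le> ennreal (2 * ((cmod (deriv g z))\<^sup>2 * (1 - (cmod z)\<^sup>2)) + 2 * M\<^sup>2 * ((cmod (deriv u z))\<^sup>2 * (1 - (cmod z)\<^sup>2)))"
        by (intro ennreal_leI) (simp add: algebra_simps)
      also have "\<dots> = 2 * ennreal ((cmod (deriv g z))\<^sup>2 * (1 - (cmod z)\<^sup>2))
          + ennreal (2 * M\<^sup>2) * ennreal ((cmod (deriv u z))\<^sup>2 * (1 - (cmod z)\<^sup>2))"
        using True by (subst ennreal_plus) (auto simp: power_le_one ennreal_mult simp del: ennreal_plus)
      finally show ?thesis using True by (simp add: ennreal_mult power_le_one)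
    qed simp
  qed
  also have "\<dots> = 2 * (\<integral>\<^sup>+z. ?G (deriv g) z \<partial>lborel) + ennreal (2 * M\<^sup>2) * (\<integral>\<^sup>+z. ?G (deriv u) z \<partial>lborel)"
    using borel_measurable_weighted_square[OF c(1)] borel_measurable_weighted_square[OF c(2)]
    by (simp add: nn_integral_add nn_integral_cmult del: measurable_lborel1 measurable_lborel2)
  also have "\<dots> \<le> ennreal 2 * ennreal (pi * (M\<^sup>2 * (1 / (1 - (cmod a)\<^sup>2))))
      + ennreal (2 * M\<^sup>2) * ennreal (pi * (1 / (1 - (cmod a)\<^sup>2)))"
    using LPu LPg by (intro add_mono mult_mono) auto
  also have "\<dots> = ennreal (2 * (pi * (M\<^sup>2 * (1 / (1 - (cmod a)\<^sup>2))))
      + (2 * M\<^sup>2) * (pi * (1 / (1 - (cmod a)\<^sup>2))))"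
    using a1 by (simp only: ennreal_mult[symmetric] ennreal_plus[symmetric] mult_nonneg_nonneg zero_le_power2 zero_le_numeral
        pi_ge_zero zero_le_divide_1_iff diff_ge_0_iff_ge less_imp_le)
  also have "2 * (pi * (M\<^sup>2 * (1 / (1 - (cmod a)\<^sup>2)))) + (2 * M\<^sup>2) * (pi * (1 / (1 - (cmod a)\<^sup>2)))
      = 4 * pi * M\<^sup>2 / (1 - (cmod a)\<^sup>2)" by simp
  finally show ?thesis .
qed

text \<open>The kernel bound is applied at the point \<open>q\<close> on the central ray of the box
  with 1 - |q| = L/(2 pi). Throughout the box |1 - cnj q z| is at most \<open>L\<close>, so
  inserting the kernel costs a factor L^2. The denominator 1 - |q|^2 \<ge> L/(2 pi) gives one factor
  \<open>L\<close> back and the normalization of the mean cancels the other, leaving a bound uniform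
  in the arc.\<close>

lemma box_mean_bounded:
  assumes f: "f holomorphic_on disc" and M: "\<And>z. z \<in> disc \<Longrightarrow> cmod (f z) \<le> M"
    and ab: "(a, b) \<in> arcs"
  shows "box_mean f a b \<le> ennreal (8 * pi * M\<^sup>2)"
proof -
  define L where "L = b - a"
  define r where "r = 1 - L / (2 * pi)"
  define q where "q = rcis r ((a + b) / 2)"
  have L: "0 < L" "L \<le> 2 * pi" using ab by (auto simp: L_def arcs_def)
  then have r: "0 \<le> r" "r < 1" by (auto simp: r_def field_simps)
  then have q: "q \<in> disc" and nq: "cmod q = r" by (auto simp: q_def)
  have kernel: "z \<in> disc" "cmod (1 - cnj q * z) \<le> L" if "z \<in> carleson_box a b" for z
  proof -
    from that obtain s t where z: "z = rcis s t" and s: "r < s" "s < 1" and t: "a \<le> t" "t \<le> b"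
      by (auto simp: carleson_box_def r_def L_def)
    show "z \<in> disc" using s r by (simp add: z)
    define \<psi> where "\<psi> = t - (a + b) / 2"
    have \<psi>: "\<bar>\<psi>\<bar> \<le> L / 2" using t by (simp add: \<psi>_def L_def abs_le_iff field_simps)
    have "cnj q * z = of_real (r * s) * cis \<psi>"
      by (simp add: q_def z rcis_def \<psi>_def cis_cnj cis_mult mult_ac)
    then have "1 - cnj q * z = of_real (1 - r * s) + of_real (r * s) * (1 - cis \<psi>)"
      by (simp add: algebra_simps)
    then have "cmod (1 - cnj q * z) \<le> cmod (of_real (1 - r * s)) + cmod (of_real (r * s) * (1 - cis \<psi>))"
      by (metis norm_triangle_ineq)
    also have "\<dots> = \<bar>1 - r * s\<bar> + \<bar>r * s\<bar> * cmod (1 - cis \<psi>)"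
      by (simp add: norm_mult del: of_real_mult of_real_diff)
    also have "\<dots> \<le> (1 - r * s) + 1 * \<bar>\<psi>\<bar>"
    proof (intro add_mono mult_mono)
      have rs: "0 \<le> r * s" "r * s \<le> 1" using r s by (auto intro: mult_le_one)
      then show "\<bar>1 - r * s\<bar> \<le> 1 - r * s" "\<bar>r * s\<bar> \<le> 1" by auto
      have "cmod (cis \<psi> - 1) \<le> \<bar>\<psi>\<bar>"
        using dist_exp_i_1[of \<psi>] abs_sin_x_le_abs_x[of "\<psi> / 2"] by (simp add: cis_conv_exp)
      then show "cmod (1 - cis \<psi>) \<le> \<bar>\<psi>\<bar>" by (simp add: norm_minus_commute)
    qed auto
    also have "\<dots> \<le> (1 - r) + (1 - r) + L / 2"
    proof -
      have "(1 - r) * (1 - s) \<le> 1 - r" using r s by (simp add: mult_left_le)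
      moreover have "0 \<le> (1 - r) * (1 - s)" using r s by simp
      ultimately have "1 - r * s \<le> (1 - r) + (1 - s)" by (simp add: algebra_simps)
      then show ?thesis using s \<psi> by simp
    qed
    also have "\<dots> = L / pi + L / 2" by (simp add: r_def field_simps)
    also have "\<dots> \<le> L" using L pi_ge_two by (simp add: field_simps)
    finally show "cmod (1 - cnj q * z) \<le> L" .
  qed
  have meas: "(\<lambda>z. ennreal ((cmod (deriv f z / (1 - cnj q * z)))\<^sup>2) * ennreal (1 - (cmod z)\<^sup>2) * indicator disc z)
    \<in> borel_measurable lborel"
  proof (intro borel_measurable_weighted_square holomorphic_on_imp_continuous_on holomorphic_intros)
    show "1 - cnj q * z \<noteq> 0" if "z \<in> disc" for z
      using cnj_mult_ne_1[of q z] q that by auto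
  qed (use f in auto)
  have "(\<integral>\<^sup>+z\<in>carleson_box a b. ennreal ((cmod (deriv f z))\<^sup>2 * (1 - (cmod z)\<^sup>2)) \<partial>lborel)
     \<le> (\<integral>\<^sup>+z. ennreal (L\<^sup>2) * (ennreal ((cmod (deriv f z / (1 - cnj q * z)))\<^sup>2)
          * ennreal (1 - (cmod z)\<^sup>2) * indicator disc z) \<partial>lborel)"
  proof (rule nn_integral_mono)
    fix z :: complex
    show "ennreal ((cmod (deriv f z))\<^sup>2 * (1 - (cmod z)\<^sup>2)) * indicator (carleson_box a b) z
        \<le> ennreal (L\<^sup>2) * (ennreal ((cmod (deriv f z / (1 - cnj q * z)))\<^sup>2)
          * ennreal (1 - (cmod z)\<^sup>2) * indicator disc z)"
    proof (cases "z \<in> carleson_box a b")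
      case True
      note k = kernel[OF True]
      have pos: "0 < cmod (1 - cnj q * z)" using cnj_mult_ne_1[of q z] q k(1) by auto
      have "(cmod (deriv f z))\<^sup>2 = (cmod (1 - cnj q * z))\<^sup>2 * (cmod (deriv f z / (1 - cnj q * z)))\<^sup>2"
        using pos by (simp add: norm_divide power_divide)
      also have "\<dots> \<le> L\<^sup>2 * (cmod (deriv f z / (1 - cnj q * z)))\<^sup>2"
        using k(2) by (intro mult_right_mono power_mono) auto
      finally have "(cmod (deriv f z))\<^sup>2 * (1 - (cmod z)\<^sup>2)
          \<le> L\<^sup>2 * (cmod (deriv f z / (1 - cnj q * z)))\<^sup>2 * (1 - (cmod z)\<^sup>2)"
        using k(1) by (intro mult_right_mono) (auto simp: power_le_one)
      then show ?thesis using True k(1)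
        by (simp add: mult.assoc ennreal_leI power_le_one flip: ennreal_mult)
    qed simp
  qed
  also have "\<dots> = ennreal (L\<^sup>2) * (\<integral>\<^sup>+z\<in>disc. ennreal ((cmod (deriv f z / (1 - cnj q * z)))\<^sup>2)
          * ennreal (1 - (cmod z)\<^sup>2) \<partial>lborel)"
    by (rule nn_integral_cmult[OF meas])
  also have "\<dots> \<le> ennreal (L\<^sup>2) * ennreal (4 * pi * M\<^sup>2 / (1 - (cmod q)\<^sup>2))"
    by (intro mult_left_mono nn_integral_disc_deriv_bounded f M q) auto
  also have "\<dots> \<le> ennreal (L\<^sup>2) * ennreal (4 * pi * M\<^sup>2 / (L / (2 * pi)))"
  proof (intro mult_left_mono ennreal_leI divide_left_mono)
    have "r\<^sup>2 \<le> r" using r by (simp add: power2_eq_square mult_left_le)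
    then show "L / (2 * pi) \<le> 1 - (cmod q)\<^sup>2" by (simp add: nq r_def)
    then show "0 < (1 - (cmod q)\<^sup>2) * (L / (2 * pi))"
      using L less_le_trans[of 0 "L / (2 * pi)" "1 - (cmod q)\<^sup>2"] by (intro mult_pos_pos) auto
  qed auto
  finally have "box_mean f a b \<le> ennreal (1 / L) * (ennreal (1 / pi) *
      (ennreal (L\<^sup>2) * ennreal (4 * pi * M\<^sup>2 / (L / (2 * pi)))))"
    unfolding box_mean_def L_def[symmetric] by (intro mult_left_mono) auto
  also have "\<dots> = ennreal (1 / L * (1 / pi * (L\<^sup>2 * (4 * pi * M\<^sup>2 / (L / (2 * pi))))))"
    using L by (simp only: ennreal_mult[symmetric] mult_nonneg_nonneg divide_nonneg_nonneg zero_le_power2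
        zero_le_numeral pi_ge_zero zero_le_one less_imp_le)
  also have "1 / L * (1 / pi * (L\<^sup>2 * (4 * pi * M\<^sup>2 / (L / (2 * pi))))) = 8 * pi * M\<^sup>2"
    using L by (simp add: field_simps power2_eq_square)
  finally show ?thesis .
qed

lemma H_infty_subset_BMOA: "H_infty \<subseteq> BMOA"
proof
  fix f assume f: "f \<in> H_infty"
  then obtain M where "\<forall>x\<in>f ` disc. cmod x \<le> M"
    by (auto simp: H_infty_def bounded_iff)
  then have M: "\<And>z. z \<in> disc \<Longrightarrow> cmod (f z) \<le> M" by blast
  have hol: "f holomorphic_on disc" using f by (simp add: H_infty_def H_disc_def)
  have "(SUP (a, b) \<in> arcs. box_mean f a b) \<le> ennreal (8 * pi * M\<^sup>2)"
    by (rule SUP_least) (use box_mean_bounded[OF hol M] in auto)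
  then show "f \<in> BMOA"
    using f by (simp add: BMOA_def H_infty_def le_less_trans)
qed

section \<open>BMOA and the Bloch space\<close>

text \<open>In the orthogonal expansion of \<open>h\<close> around \<open>z\<close> all terms are
  nonnegative; only the constant one is kept.\<close>

lemma area_mean_value_le:
  assumes h: "h holomorphic_on ball z r" and r: "0 < r"
  shows "ennreal (pi * r\<^sup>2 * (cmod (h z))\<^sup>2) \<le> (\<integral>\<^sup>+w\<in>ball z r. ennreal ((cmod (h w))\<^sup>2) \<partial>lborel)"
proof -
  have [measurable]: "(\<lambda>w. indicator (ball z r) w *\<^sub>R h w) \<in> borel_measurable borel"
    using h by (intro borel_measurable_continuous_on_indicator holomorphic_on_imp_continuous_on) auto
  define F where "F w = ennreal ((cmod (indicator (ball z r) w *\<^sub>R h w))\<^sup>2)" for w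
  have [measurable]: "F \<in> borel_measurable borel" unfolding F_def by measurable
  define h' where "h' w = h (z + w)" for w
  define c where "c n = (deriv ^^ n) h z / fact n" for n
  have sums: "(\<lambda>n. c n * w ^ n) sums h' w" if "cmod w < r" for w
    using holomorphic_power_series[OF h, of "z + w"] that by (simp add: c_def h'_def dist_norm)
  have cont: "continuous_on (ball 0 r) h'"
    unfolding h'_def
    by (rule continuous_on_compose2[OF holomorphic_on_imp_continuous_on[OF h]])
       (auto intro!: continuous_intros simp: dist_norm)
  have area: "emeasure lborel (ball (0::complex) r) = ennreal (pi * r\<^sup>2)"
    using emeasure_ball[of r "0 :: complex"] r by (simp add: unit_ball_vol_2)
  have "ennreal (pi * r\<^sup>2 * (cmod (h z))\<^sup>2) = ennreal ((cmod (c 0))\<^sup>2) * ennreal (pi * r\<^sup>2)"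
    by (subst ennreal_mult[symmetric]) (auto simp: c_def mult_ac)
  also have "\<dots> = ennreal ((cmod (c 0))\<^sup>2) * (\<integral>\<^sup>+w\<in>ball 0 r. ennreal (cmod w ^ (2 * 0)) * 1 \<partial>lborel)"
    by (simp add: area)
  also have "\<dots> \<le> (\<Sum>n. ennreal ((cmod (c n))\<^sup>2) * (\<integral>\<^sup>+w\<in>ball 0 r. ennreal (cmod w ^ (2 * n)) * 1 \<partial>lborel))"
    using sum_le_suminf[of "\<lambda>n. ennreal ((cmod (c n))\<^sup>2) * (\<integral>\<^sup>+w\<in>ball 0 r. ennreal (cmod w ^ (2 * n)) * 1 \<partial>lborel)" "{0}"]
    by simp
  also have "\<dots> = (\<integral>\<^sup>+w\<in>ball 0 r. ennreal ((cmod (h' w))\<^sup>2) * 1 \<partial>lborel)"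
    by (rule nn_integral_radial_power_series[symmetric, OF sums cont]) auto
  also have "\<dots> = (\<integral>\<^sup>+w. F (z + w) \<partial>lborel)"
    by (intro nn_integral_cong) (auto simp: F_def h'_def indicator_def dist_norm)
  also have "\<dots> = (\<integral>\<^sup>+w. F w \<partial>distr lborel borel ((+) z))"
    by (subst nn_integral_distr) auto
  also have "\<dots> = (\<integral>\<^sup>+w\<in>ball z r. ennreal ((cmod (h w))\<^sup>2) \<partial>lborel)"
    unfolding lborel_distr_plus by (intro nn_integral_cong) (auto simp: F_def indicator_def)
  finally show ?thesis .
qed

text \<open>The depth of a box of length 3 pi d is 3d/2, more than the 5d/4 needed to reach below
  the ball, and its angular half-width 3 pi d/2 exceeds the at most 3d/2 by which arguments vary on
  the ball. The minimum with 2 pi caps the arc at the full circle; that box omits the origin, hence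
  the removal of 0.\<close>

lemma ball_subset_carleson_box:
  assumes z: "cmod z < 1" and d: "d = 1 - cmod z" and L: "L = min (2 * pi) (3 * pi * d)"
  obtains t where "ball z (d / 4) - {0} \<subseteq> carleson_box (t - L / 2) (t + L / 2)"
proof -
  have d0: "0 < d" using z d by simp
  define t where "t = Arg z"
  have zt: "z = of_real (cmod z) * cis t"
    by (cases "z = 0") (auto simp: t_def cis_Arg sgn_eq)
  have "w \<in> carleson_box (t - L / 2) (t + L / 2)" if w: "w \<in> ball z (d / 4) - {0}" for w
  proof -
    have wz: "cmod (w - z) < d / 4" and w0: "w \<noteq> 0"
      using w by (auto simp: dist_norm norm_minus_commute)
    have w1: "cmod w < 1" and wd: "1 - 3 * d / 2 < cmod w"
      using norm_triangle_ineq2[of w z] norm_triangle_ineq2[of z w] wz d d0 norm_minus_commute[of w z]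
      by linarith+
    obtain \<psi> where \<psi>: "w = rcis (cmod w) (t + \<psi>)" "\<bar>\<psi>\<bar> \<le> L / 2"
    \<comment> \<open>Below this threshold 3 pi d < 2 pi; from it on the box is the whole punctured
      disc and any choice of argument will do.\<close>
    proof (cases "d < 2 / 3")
      case True
      \<comment> \<open>The angle between \<open>w\<close> and \<open>z\<close> is the imaginary
        part of \<open>Ln (w / z)\<close>. Here |z| > 1/3 forces |v| < 3d/4 < 1/2, and |Ln (1 + v)|
        \<le> 2 |v| bounds that angle by 3d/2.\<close>
      define v where "v = w / z - 1"
      have z3: "1 / 3 < cmod z" using True d by simp
      then have z0: "z \<noteq> 0" by auto
      have "cmod v = cmod (w - z) / cmod z"
        using z0 by (simp add: v_def norm_divide[symmetric] diff_divide_distrib)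
      also have "\<dots> < 3 * d / 4"
      proof -
        have "cmod (w - z) < d / 4" by (fact wz)
        also have "d / 4 \<le> 3 * d / 4 * cmod z" using z3 d0 by (simp add: field_simps)
        finally show ?thesis using z0 by (simp add: field_simps)
      qed
      finally have v: "cmod v < 3 * d / 4" .
      then have v2: "cmod v < 1 / 2" using True by simp
      define \<psi> where "\<psi> = Im (Ln (1 + v))"
      have "1 + v \<noteq> 0" using w0 z0 by (simp add: v_def)
      then have "1 + v = exp (Ln (1 + v))" and "exp (Re (Ln (1 + v))) = cmod (1 + v)"
        by simp_all
      then have "1 + v = of_real (cmod (1 + v)) * cis \<psi>"
        unfolding \<psi>_def by (metis exp_eq_polar)
      moreover have "w = z * (1 + v)" using z0 by (simp add: v_def)
      ultimately have "w = of_real (cmod z * cmod (1 + v)) * (cis t * cis \<psi>)"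
        using zt by (metis (no_types, lifting) mult.assoc mult.left_commute of_real_mult)
      moreover have "cmod z * cmod (1 + v) = cmod w"
        using \<open>w = z * (1 + v)\<close> by (simp add: norm_mult)
      ultimately have "w = rcis (cmod w) (t + \<psi>)" by (simp add: rcis_def cis_mult)
      moreover have "\<bar>\<psi>\<bar> \<le> cmod (Ln (1 + v))" unfolding \<psi>_def by (rule abs_Im_le_cmod)
      with norm_Ln_le[OF v2] v have "\<bar>\<psi>\<bar> \<le> 3 * d / 2" by simp
      moreover have "3 * d / 2 \<le> L / 2"
        using True d0 pi_ge_two mult_right_mono[of 1 pi "3 * d"] by (simp add: L)
      ultimately show ?thesis using that by force
    next
      case False
      define u where "u = w * cis (- t)"
      have "u = of_real (cmod u) * cis (Arg u)"
        using w0 by (simp add: cis_Arg sgn_eq u_def)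
      moreover have "cmod u = cmod w" by (simp add: u_def norm_mult)
      moreover have "w = u * cis t" by (simp add: u_def cis_mult mult.assoc)
      ultimately have "w = rcis (cmod w) (t + Arg u)"
        by (metis add.commute cis_mult mult.assoc rcis_def)
      moreover have "\<bar>Arg u\<bar> \<le> L / 2"
        using Arg_bounded[of u] False by (simp add: L abs_le_iff)
      ultimately show ?thesis using that by blast
    qed
    have "1 - L / (2 * pi) < cmod w"
    proof (cases "d < 2 / 3")
      case True then show ?thesis using wd by (simp add: L min_def field_simps)
    next
      case False then show ?thesis using w0 by (simp add: L min_def)
    qed
    moreover have "t + \<psi> \<in> {t - L / 2..t + L / 2}" using \<psi>(2) by (auto simp: abs_le_iff)
    ultimately show ?thesis
      unfolding carleson_box_def using w1 \<psi>(1) by fastforce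
  qed
  then show ?thesis using that by blast
qed

text \<open>The mean value inequality for f' on the ball of radius d/4, where 1 - |w|^2 \<ge> 3d/4,
  bounds the box mean below by |f'(z)|^2 d^2 / (64 pi). Since (1 - |z|^2)^2 \<le> 4 d^2 and pi < 4,
  the constant 32^2 = 4 * 4 * 64 suffices.\<close>

lemma Bloch_le_box_mean:
  assumes f: "f holomorphic_on disc" and z: "z \<in> disc"
  obtains a b where "(a, b) \<in> arcs"
    "ennreal ((cmod (deriv f z) * (1 - (cmod z)\<^sup>2) / 32)\<^sup>2) \<le> box_mean f a b"
proof -
  define d where "d = 1 - cmod z"
  define L where "L = min (2 * pi) (3 * pi * d)"
  have d: "0 < d" "d \<le> 1" using z by (auto simp: d_def)
  have L: "0 < L" "L \<le> 2 * pi" "L \<le> 3 * pi * d" using d by (auto simp: L_def)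
  obtain t where t: "ball z (d / 4) - {0} \<subseteq> carleson_box (t - L / 2) (t + L / 2)"
    using ball_subset_carleson_box[OF _ d_def L_def] z by auto
  have sub: "ball z (d / 4) \<subseteq> disc"
  proof
    fix w assume "w \<in> ball z (d / 4)"
    then show "w \<in> disc" using norm_triangle_ineq2[of w z] d by (simp add: d_def dist_norm norm_minus_commute)
  qed
  let ?D = "(cmod (deriv f z))\<^sup>2"
  have dd: "(1 - (cmod z)\<^sup>2)\<^sup>2 \<le> 4 * d\<^sup>2"
  proof -
    have "1 - (cmod z)\<^sup>2 = d * (1 + cmod z)" by (simp add: d_def power2_eq_square algebra_simps)
    also have "\<dots> \<le> d * 2" using z d by (intro mult_left_mono) auto
    finally have "(1 - (cmod z)\<^sup>2)\<^sup>2 \<le> (d * 2)\<^sup>2" using z by (intro power_mono) (auto simp: power_le_one)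
    then show ?thesis by (simp add: power_mult_distrib)
  qed
  have "(cmod (deriv f z) * (1 - (cmod z)\<^sup>2) / 32)\<^sup>2 = ?D * (1 - (cmod z)\<^sup>2)\<^sup>2 / 1024"
    by (simp add: power_mult_distrib power_divide)
  also have "\<dots> \<le> ?D * (4 * d\<^sup>2) / 1024"
    using dd by (intro divide_right_mono mult_left_mono) auto
  also have "\<dots> \<le> ?D * d\<^sup>2 / (64 * pi)"
    using pi_less_4 by (simp add: field_simps) (intro mult_right_mono, auto)
  also have "\<dots> = (1 / (3 * pi * d)) * ((1 / pi) * (3 * d / 4 * (pi * (d / 4)\<^sup>2 * ?D)))"
    using d by (simp add: field_simps power2_eq_square)
  also have "\<dots> \<le> (1 / L) * ((1 / pi) * (3 * d / 4 * (pi * (d / 4)\<^sup>2 * ?D)))"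
    using L d by (intro mult_right_mono divide_left_mono mult_pos_pos) auto
  finally have "ennreal ((cmod (deriv f z) * (1 - (cmod z)\<^sup>2) / 32)\<^sup>2)
      \<le> ennreal ((1 / L) * ((1 / pi) * (3 * d / 4 * (pi * (d / 4)\<^sup>2 * ?D))))"
    by (rule ennreal_leI)
  also have "\<dots> = ennreal (1 / L) * (ennreal (1 / pi) * (ennreal (3 * d / 4) * ennreal (pi * (d / 4)\<^sup>2 * ?D)))"
    using L d by (simp only: ennreal_mult mult_nonneg_nonneg divide_nonneg_nonneg zero_le_power2
        zero_le_numeral pi_ge_zero zero_le_one less_imp_le)
  also have "ennreal (3 * d / 4) * ennreal (pi * (d / 4)\<^sup>2 * ?D)
      \<le> ennreal (3 * d / 4) * (\<integral>\<^sup>+w\<in>ball z (d / 4). ennreal ((cmod (deriv f w))\<^sup>2) \<partial>lborel)"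
    using f sub d
    by (intro mult_left_mono area_mean_value_le holomorphic_on_subset[OF holomorphic_deriv]) auto
  also have "\<dots> = (\<integral>\<^sup>+w. ennreal (3 * d / 4) * (ennreal ((cmod (deriv f w))\<^sup>2) * indicator (ball z (d / 4)) w) \<partial>lborel)"
  proof (rule nn_integral_cmult[symmetric])
    have [measurable]: "(\<lambda>w. indicator (ball z (d / 4)) w *\<^sub>R deriv f w) \<in> borel_measurable borel"
      using f sub by (intro borel_measurable_continuous_on_indicator holomorphic_on_imp_continuous_on
          holomorphic_on_subset[OF holomorphic_deriv]) auto
    have "(\<lambda>w. ennreal ((cmod (indicator (ball z (d / 4)) w *\<^sub>R deriv f w))\<^sup>2)) \<in> borel_measurable lborel"
      by measurable
    also have "(\<lambda>w. ennreal ((cmod (indicator (ball z (d / 4)) w *\<^sub>R deriv f w))\<^sup>2))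
        = (\<lambda>w. ennreal ((cmod (deriv f w))\<^sup>2) * indicator (ball z (d / 4)) w)"
      by (auto simp: fun_eq_iff indicator_def)
    finally show "(\<lambda>w. ennreal ((cmod (deriv f w))\<^sup>2) * indicator (ball z (d / 4)) w) \<in> borel_measurable lborel" .
  qed
  also have "\<dots> \<le> (\<integral>\<^sup>+w\<in>carleson_box (t - L / 2) (t + L / 2).
      ennreal ((cmod (deriv f w))\<^sup>2 * (1 - (cmod w)\<^sup>2)) \<partial>lborel)"
  proof (rule nn_integral_mono_AE)
    \<comment> \<open>The ball may contain the origin, which the box may lack; a single point has
      measure zero.\<close>
    have "AE w in lborel. w \<noteq> (0 :: complex)" by (rule AE_lborel_singleton)
    then show "AE w in lborel. ennreal (3 * d / 4) * (ennreal ((cmod (deriv f w))\<^sup>2) * indicator (ball z (d / 4)) w)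
      \<le> ennreal ((cmod (deriv f w))\<^sup>2 * (1 - (cmod w)\<^sup>2)) * indicator (carleson_box (t - L / 2) (t + L / 2)) w"
    proof (eventually_elim)
      case (elim w)
      show ?case
      proof (cases "w \<in> ball z (d / 4)")
        case True
        then have box: "w \<in> carleson_box (t - L / 2) (t + L / 2)" using t elim by blast
        have "cmod w \<le> 1 - 3 * d / 4"
        proof -
          have "cmod (w - z) < d / 4" using True by (simp add: dist_norm norm_minus_commute)
          moreover have "cmod z = 1 - d" by (simp add: d_def)
          moreover have "cmod w \<le> cmod z + cmod (w - z)" by (metis add.commute diff_add_cancel norm_triangle_ineq)
          ultimately show ?thesis by linarith
        qed
        moreover have "(cmod w)\<^sup>2 \<le> cmod w"
          using sub True by (auto simp: power2_eq_square intro!: mult_left_le)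
        ultimately have "3 * d / 4 \<le> 1 - (cmod w)\<^sup>2" by linarith
        then have "(3 * d / 4) * (cmod (deriv f w))\<^sup>2 \<le> (1 - (cmod w)\<^sup>2) * (cmod (deriv f w))\<^sup>2"
          by (rule mult_right_mono) auto
        then show ?thesis using True box d
          by (simp flip: ennreal_mult add: ennreal_leI mult.commute)
      qed simp
    qed
  qed
  finally have "ennreal ((cmod (deriv f z) * (1 - (cmod z)\<^sup>2) / 32)\<^sup>2) \<le> box_mean f (t - L / 2) (t + L / 2)"
    unfolding box_mean_def by (simp add: mult_left_mono)
  moreover have "(t - L / 2, t + L / 2) \<in> arcs" using L by (simp add: arcs_def)
  ultimately show ?thesis by (rule that[rotated])
qed

lemma Bloch_le_bmoa_norm:
  assumes f: "f \<in> BMOA" and z: "z \<in> disc"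
  shows "cmod (deriv f z) * (1 - (cmod z)\<^sup>2) \<le> 32 * bmoa_norm f"
proof -
  let ?S = "SUP (a, b) \<in> arcs. box_mean f a b"
  have fin: "?S < \<infinity>" using f by (simp add: BMOA_def)
  have le: "sqrt (enn2real (box_mean f a b)) \<le> sqrt (enn2real ?S)" if "(a, b) \<in> arcs" for a b
  proof -
    have "box_mean f a b \<le> ?S" using SUP_upper[OF that, of "\<lambda>(a, b). box_mean f a b"] by simp
    then show ?thesis using fin by (intro real_sqrt_le_mono enn2real_mono) auto
  qed
  \<comment> \<open>The supremum in \<open>bmoa_norm\<close> is taken in the reals and dominates its
    terms only over a bounded set. Finiteness of the \<open>ennreal\<close> supremum gives the bound
    and also keeps \<open>enn2real\<close> from sending an infinite mean to 0.\<close>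
  have bdd: "bdd_above ((\<lambda>(a, b). sqrt (enn2real (box_mean f a b))) ` arcs)"
    using le by (intro bdd_aboveI2[where M = "sqrt (enn2real ?S)"]) auto
  have hol: "f holomorphic_on disc" using f by (simp add: BMOA_def H_disc_def)
  obtain a b where ab: "(a, b) \<in> arcs"
    and b: "ennreal ((cmod (deriv f z) * (1 - (cmod z)\<^sup>2) / 32)\<^sup>2) \<le> box_mean f a b"
    by (rule Bloch_le_box_mean[OF hol z])
  have "box_mean f a b < \<infinity>"
    using SUP_upper[OF ab, of "\<lambda>(a, b). box_mean f a b"] fin by (simp add: le_less_trans)
  from enn2real_mono[OF b] this have "(cmod (deriv f z) * (1 - (cmod z)\<^sup>2) / 32)\<^sup>2 \<le> enn2real (box_mean f a b)"
    by simp
  then have "cmod (deriv f z) * (1 - (cmod z)\<^sup>2) / 32 \<le> sqrt (enn2real (box_mean f a b))"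
    by (rule real_le_rsqrt)
  also have "\<dots> \<le> (SUP (a, b) \<in> arcs. sqrt (enn2real (box_mean f a b)))"
    using cSUP_upper[OF ab bdd] by simp
  also have "\<dots> \<le> bmoa_norm f" by (simp add: bmoa_norm_def)
  finally show ?thesis by simp
qed

section \<open>Banach spaces continuously included in the Bloch space\<close>

lemma linear_subspace_diff:
  assumes "linear_subspace X" "f \<in> X" "g \<in> X"
  shows "(\<lambda>z. f z - g z) \<in> X"
proof -
  have scale: "\<And>c f. f \<in> X \<Longrightarrow> (\<lambda>z. c * f z) \<in> X"
    and add: "\<And>f g. f \<in> X \<Longrightarrow> g \<in> X \<Longrightarrow> (\<lambda>z. f z + g z) \<in> X"
    using assms(1) by (auto simp: linear_subspace_def)
  show ?thesis using add[OF assms(2) scale[OF assms(3), of "-1"]] by simp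
qed

text \<open>The uniform boundedness principle, by the gliding hump argument of Sokal, which does not use
  the Baire category theorem.\<close>

lemma uniform_boundedness:
  fixes p :: "'i \<Rightarrow> (complex \<Rightarrow> complex) \<Rightarrow> real"
  assumes X: "linear_subspace X" and N: "norm_on X N" and compl: "complete_norm X N"
    and add: "\<And>i f g. i \<in> A \<Longrightarrow> f \<in> X \<Longrightarrow> g \<in> X \<Longrightarrow> p i (\<lambda>z. f z + g z) \<le> p i f + p i g"
    and scale: "\<And>i c f. i \<in> A \<Longrightarrow> f \<in> X \<Longrightarrow> p i (\<lambda>z. c * f z) = cmod c * p i f"
    and cont: "\<And>i. i \<in> A \<Longrightarrow> \<exists>K. \<forall>f\<in>X. p i f \<le> K * N f"
    and pointwise: "\<And>f. f \<in> X \<Longrightarrow> \<exists>B. \<forall>i\<in>A. p i f \<le> B"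
  shows "\<exists>C. \<forall>i\<in>A. \<forall>f\<in>X. p i f \<le> C * N f"
proof (rule ccontr)
  assume not: "\<nexists>C. \<forall>i\<in>A. \<forall>f\<in>X. p i f \<le> C * N f"
  have X0: "(\<lambda>z. 0) \<in> X" and Xadd: "\<And>f g. f \<in> X \<Longrightarrow> g \<in> X \<Longrightarrow> (\<lambda>z. f z + g z) \<in> X"
    and Xscale: "\<And>c f. f \<in> X \<Longrightarrow> (\<lambda>z. c * f z) \<in> X"
    and Xdiff: "\<And>f g. f \<in> X \<Longrightarrow> g \<in> X \<Longrightarrow> (\<lambda>z. f z - g z) \<in> X"
    using X linear_subspace_diff[OF X] by (auto simp: linear_subspace_def)
  have N0: "\<And>f. f \<in> X \<Longrightarrow> 0 \<le> N f" and Neq: "\<And>f. f \<in> X \<Longrightarrow> N f = 0 \<longleftrightarrow> f = (\<lambda>z. 0)"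
    and Nscale: "\<And>c f. f \<in> X \<Longrightarrow> N (\<lambda>z. c * f z) = cmod c * N f"
    and Nadd: "\<And>f g. f \<in> X \<Longrightarrow> g \<in> X \<Longrightarrow> N (\<lambda>z. f z + g z) \<le> N f + N g"
    using N by (auto simp: norm_on_def)
  have Nminus: "N (\<lambda>z. f z - g z) = N (\<lambda>z. g z - f z)" if "f \<in> X" "g \<in> X" for f g
    using Nscale[of "\<lambda>z. g z - f z" "-1"] Xdiff[OF that(2,1)] by simp
  have Ntri: "N (\<lambda>z. f z - h z) \<le> N (\<lambda>z. f z - g z) + N (\<lambda>z. g z - h z)"
    if "f \<in> X" "g \<in> X" "h \<in> X" for f g h
    using Nadd[of "\<lambda>z. f z - g z" "\<lambda>z. g z - h z"] Xdiff that by simp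
  have pzero: "p i (\<lambda>z. 0) = 0" if "i \<in> A" for i
    using scale[OF that X0, of 0] by simp
  have p0: "0 \<le> p i f" if "i \<in> A" "f \<in> X" for i f
    using add[OF that(1,2) Xscale[OF that(2), of "-1"]] scale[OF that, of "-1"] pzero[OF that(1)] by simp
  define K where "K i = (SUP f\<in>{f \<in> X. N f \<le> 1}. p i f)" for i
  have bdd: "bdd_above (p i ` {f \<in> X. N f \<le> 1})" if i: "i \<in> A" for i
  proof -
    obtain C where C: "\<And>f. f \<in> X \<Longrightarrow> p i f \<le> C * N f" using cont[OF i] by blast
    show ?thesis
    proof (rule bdd_aboveI2)
      fix f assume f: "f \<in> {f \<in> X. N f \<le> 1}"
      have "p i f \<le> C * N f" using C f by simp
      also have "\<dots> \<le> \<bar>C\<bar> * 1" using f N0[of f] by (intro mult_mono) auto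
      finally show "p i f \<le> \<bar>C\<bar>" by simp
    qed
  qed
  have ne: "{f \<in> X. N f \<le> 1} \<noteq> {}" using X0 Neq[OF X0] by auto
  have pK: "p i f \<le> K i * N f" if i: "i \<in> A" and f: "f \<in> X" for i f
  proof (cases "N f = 0")
    case True
    then have "f = (\<lambda>z. 0)" using Neq f by simp
    then show ?thesis using pzero[OF i] True by simp
  next
    case False
    then have pos: "N f > 0" using N0[OF f] by simp
    let ?g = "\<lambda>z. complex_of_real (1 / N f) * f z"
    have "N ?g = 1" using Nscale[OF f, of "of_real (1 / N f)"] pos by (simp add: norm_divide)
    with Xscale[OF f, of "of_real (1 / N f)"] have "p i ?g \<le> K i" unfolding K_def using bdd[OF i] by (intro cSUP_upper) auto
    then have "N f * p i ?g \<le> N f * K i" using pos by (intro mult_left_mono) auto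
    moreover have "N f * p i ?g = p i f"
      using scale[OF i f, of "of_real (1 / N f)"] pos by (simp add: norm_divide)
    ultimately show ?thesis by (simp add: mult.commute)
  qed
  have "\<exists>i\<in>A. 4 ^ n < K i" for n :: nat
  proof (rule ccontr)
    assume "\<not> (\<exists>i\<in>A. 4 ^ n < K i)"
    then have "p i f \<le> 4 ^ n * N f" if "i \<in> A" "f \<in> X" for i f
      using pK[OF that] mult_right_mono[of "K i" "4 ^ n" "N f"] N0[OF that(2)] that by fastforce
    with not show False by blast
  qed
  then obtain i where i: "\<And>n. i n \<in> A" and Ki: "\<And>n. 4 ^ n < K (i n)" by metis
  have Kpos: "0 < K (i n)" for n using Ki[of n] by (rule less_trans[rotated]) simp
  have "\<exists>g\<in>X. N g \<le> (1 / 3) ^ n \<and> 2 / 3 * K (i n) * (1 / 3) ^ n \<le> p (i n) g" for n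
  proof -
    have "2 / 3 * K (i n) < K (i n)" using Kpos[of n] by simp
    then obtain f where f: "f \<in> X" "N f \<le> 1" "2 / 3 * K (i n) < p (i n) f"
      unfolding K_def using less_cSUP_iff[OF ne bdd[OF i]] by auto
    let ?g = "\<lambda>z. complex_of_real ((1 / 3) ^ n) * f z"
    have c: "cmod (complex_of_real ((1 / 3) ^ n)) = (1 / 3) ^ n"
      unfolding norm_of_real by simp
    have "N ?g = (1 / 3) ^ n * N f" "p (i n) ?g = (1 / 3) ^ n * p (i n) f"
      unfolding Nscale[OF f(1)] scale[OF i f(1)] c by auto
    then have "N ?g \<le> (1 / 3) ^ n \<and> 2 / 3 * K (i n) * (1 / 3) ^ n \<le> p (i n) ?g"
      using f mult_left_mono[of "N f" 1 "(1 / 3) ^ n"]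
        mult_right_mono[of "2 / 3 * K (i n)" "p (i n) f" "(1 / 3) ^ n"]
      by (simp add: mult.commute)
    then show ?thesis using Xscale[OF f(1)] by blast
  qed
  then obtain g where gX: "\<And>n. g n \<in> X" and gN: "\<And>n. N (g n) \<le> (1 / 3) ^ n"
    and gp: "\<And>n. 2 / 3 * K (i n) * (1 / 3) ^ n \<le> p (i n) (g n)" by metis
  \<comment> \<open>The sign of each increment is chosen so that \<open>p (i n)\<close> does not
    fall below \<open>p (i n) (g n)\<close>. One of the two signs works, as 2 p(g) \<le> p(x + g) +
    p(x - g).\<close>
  define x where "x = rec_nat (\<lambda>z. 0) (\<lambda>n f. if p (i n) (g n) \<le> p (i n) (\<lambda>z. f z + g n z)
      then (\<lambda>z. f z + g n z) else (\<lambda>z. f z - g n z))"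
  have x0: "x 0 = (\<lambda>z. 0)" and xS: "x (Suc n) = (if p (i n) (g n) \<le> p (i n) (\<lambda>z. x n z + g n z)
      then (\<lambda>z. x n z + g n z) else (\<lambda>z. x n z - g n z))" for n
    by (simp_all add: x_def)
  have xX: "x n \<in> X" for n
    by (induction n) (auto simp: x0 xS X0 Xadd Xdiff gX)
  have step: "N (\<lambda>z. x (Suc n) z - x n z) \<le> (1 / 3) ^ n" for n
  proof -
    have "N (\<lambda>z. - g n z) = N (g n)" using Nscale[OF gX[of n], of "-1"] by simp
    then show ?thesis using gN[of n] by (simp add: xS)
  qed
  have big: "p (i n) (g n) \<le> p (i n) (x (Suc n))" for n
  proof (cases "p (i n) (g n) \<le> p (i n) (\<lambda>z. x n z + g n z)")
    case False
    have "2 * p (i n) (g n) = p (i n) (\<lambda>z. 2 * g n z)" using scale[OF i[of n] gX[of n], of 2] by simp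
    also have "(\<lambda>z. 2 * g n z) = (\<lambda>z. (x n z + g n z) + (-1) * (x n z - g n z))" by auto
    also have "p (i n) \<dots> \<le> p (i n) (\<lambda>z. x n z + g n z) + p (i n) (\<lambda>z. (-1) * (x n z - g n z))"
      by (intro add i Xadd Xscale Xdiff xX gX)
    also have "p (i n) (\<lambda>z. (-1) * (x n z - g n z)) = p (i n) (\<lambda>z. x n z - g n z)"
      using scale[OF i[of n] Xdiff[OF xX[of n] gX[of n]], of "-1"] by simp
    finally show ?thesis using False by (simp add: xS)
  qed (simp add: xS)
  have cau: "N (\<lambda>z. x (n + m) z - x n z) \<le> 3 / 2 * (1 - (1 / 3) ^ m) * (1 / 3) ^ n" for n m
  proof (induction m)
    case 0
    then show ?case using Neq[OF X0] by simp
  next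
    case (Suc m)
    have "N (\<lambda>z. x (n + Suc m) z - x n z)
        \<le> N (\<lambda>z. x (n + Suc m) z - x (n + m) z) + N (\<lambda>z. x (n + m) z - x n z)"
      by (intro Ntri xX)
    also have "\<dots> \<le> (1 / 3) ^ (n + m) + 3 / 2 * (1 - (1 / 3) ^ m) * (1 / 3) ^ n"
      using step[of "n + m"] Suc by (intro add_mono) auto
    also have "\<dots> = 3 / 2 * (1 - (1 / 3) ^ Suc m) * (1 / 3) ^ n"
      by (simp add: power_add algebra_simps)
    finally show ?case .
  qed
  have cau': "N (\<lambda>z. x m z - x n z) \<le> 3 / 2 * (1 / 3) ^ n" if "n \<le> m" for m n
  proof -
    have "N (\<lambda>z. x m z - x n z) \<le> 3 / 2 * (1 - (1 / 3) ^ (m - n)) * (1 / 3) ^ n"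
      using cau[of n "m - n"] that by simp
    also have "\<dots> \<le> 3 / 2 * 1 * (1 / 3) ^ n" by (intro mult_right_mono mult_left_mono) auto
    finally show ?thesis by simp
  qed
  have cauchy: "\<exists>M. \<forall>m\<ge>M. \<forall>n\<ge>M. N (\<lambda>z. x m z - x n z) < e" if e: "e > 0" for e
  proof -
    obtain M where M: "(1 / 3 :: real) ^ M < e / 3"
      using real_arch_pow_inv[of "e / 3" "1 / 3"] e by auto
    show ?thesis
    proof (intro exI allI impI)
      fix m n assume "M \<le> m" "M \<le> n"
      then have "N (\<lambda>z. x m z - x n z) \<le> 3 / 2 * (1 / 3) ^ M + 3 / 2 * (1 / 3) ^ M"
        using Ntri[OF xX xX xX, of m n M] cau'[of M m] cau'[of M n] Nminus[OF xX xX, of M n] by simp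
      then show "N (\<lambda>z. x m z - x n z) < e" using M by simp
    qed
  qed
  from compl have "(\<forall>n. x n \<in> X) \<longrightarrow>
      (\<forall>e>0. \<exists>M. \<forall>m\<ge>M. \<forall>n\<ge>M. N (\<lambda>z. x m z - x n z) < e) \<longrightarrow> (\<exists>f\<in>X. norm_converges N x f)"
    unfolding complete_norm_def by (rule spec)
  with xX cauchy obtain y where y: "y \<in> X" and lim: "norm_converges N x y"
    by auto
  have ydist: "N (\<lambda>z. y z - x n z) \<le> 3 / 2 * (1 / 3) ^ n" for n
  proof (rule tendsto_lowerbound)
    show "(\<lambda>m. N (\<lambda>z. x m z - y z) + 3 / 2 * (1 / 3) ^ n) \<longlonglongrightarrow> 3 / 2 * (1 / 3) ^ n"
      using tendsto_add[OF lim[unfolded norm_converges_def] tendsto_const] by simp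
    show "\<forall>\<^sub>F m in sequentially. N (\<lambda>z. y z - x n z) \<le> N (\<lambda>z. x m z - y z) + 3 / 2 * (1 / 3) ^ n"
      using eventually_ge_at_top[of n]
    proof eventually_elim
      case (elim m)
      show ?case
        using Ntri[OF y xX[of m] xX[of n]] cau'[OF elim] Nminus[OF y xX[of m]] by linarith
    qed
  qed simp
  obtain B where B: "\<And>j. j \<in> A \<Longrightarrow> p j y \<le> B" using pointwise[OF y] by blast
  \<comment> \<open>The increments after \<open>x (Suc n)\<close> have total norm at most half of
    (1/3)^n and so cost at most K/2 times that, while \<open>g n\<close> contributes at least 2K/3
    times it. The difference 1/6 and K > 4^n give growth like (4/3)^n.\<close>
  have lower: "(4 / 3) ^ n / 6 \<le> B" for n
  proof -
    have "2 / 3 * K (i n) * (1 / 3) ^ n \<le> p (i n) (x (Suc n))" using gp big order_trans by blast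
    also have "x (Suc n) = (\<lambda>z. y z + (-1) * (y z - x (Suc n) z))" by simp
    also have "p (i n) \<dots> \<le> p (i n) y + p (i n) (\<lambda>z. (-1) * (y z - x (Suc n) z))"
      by (intro add i Xscale Xdiff xX y)
    also have "p (i n) (\<lambda>z. (-1) * (y z - x (Suc n) z)) = p (i n) (\<lambda>z. y z - x (Suc n) z)"
      using scale[OF i[of n] Xdiff[OF y xX[of "Suc n"]], of "-1"] by simp
    also have "\<dots> \<le> K (i n) * N (\<lambda>z. y z - x (Suc n) z)" by (intro pK i Xdiff y xX)
    also have "\<dots> \<le> K (i n) * (3 / 2 * (1 / 3) ^ Suc n)"
      using Kpos[of n] ydist[of "Suc n"] by (intro mult_left_mono) auto
    finally have "2 / 3 * K (i n) * (1 / 3) ^ n \<le> B + K (i n) * (3 / 2 * (1 / 3) ^ Suc n)"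
      using B[OF i, of n] by linarith
    then have "K (i n) * (1 / 3) ^ n / 6 \<le> B" by (simp add: algebra_simps)
    moreover have "4 ^ n * (1 / 3) ^ n \<le> K (i n) * (1 / 3) ^ n"
      using Ki[of n] by (intro mult_right_mono) auto
    moreover have "(4 / 3 :: real) ^ n = 4 ^ n * (1 / 3) ^ n" by (simp add: power_mult_distrib[symmetric])
    ultimately show ?thesis by linarith
  qed
  obtain n where "6 * B < (4 / 3 :: real) ^ n"
    using real_arch_pow[of "4 / 3" "6 * B"] by auto
  with lower[of n] show False by linarith
qed

text \<open>Continuity of evaluation is given through sequences. A violating sequence, normalized to
  have value 1 at \<open>w\<close>, would tend to 0 in norm.\<close>

lemma evaluation_bounded:
  assumes X: "banach_space_analytic X N" and w: "w \<in> disc"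
  shows "\<exists>K. \<forall>f\<in>X. cmod (f w) \<le> K * N f"
proof (rule ccontr)
  have lin: "linear_subspace X" and N: "norm_on X N" using X by (auto simp: banach_space_analytic_def)
  assume "\<nexists>K. \<forall>f\<in>X. cmod (f w) \<le> K * N f"
  then have "\<exists>f\<in>X. real (Suc n) * N f < cmod (f w)" for n
    by (meson not_le)
  then obtain f where f: "\<And>n. f n \<in> X" and big: "\<And>n. real (Suc n) * N (f n) < cmod (f n w)" by metis
  have pos: "0 < cmod (f n w)" for n
  proof -
    have "0 \<le> N (f n)" using N f by (auto simp: norm_on_def)
    then have "0 \<le> real (Suc n) * N (f n)" by simp
    then show ?thesis using big[of n] by linarith
  qed
  define g where "g n = (\<lambda>z. (1 / f n w) * f n z)" for n
  have gX: "g n \<in> X" for n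
    using lin f unfolding g_def linear_subspace_def by blast
  have "N (g n) = cmod (1 / f n w) * N (f n)" for n
    using N f unfolding g_def norm_on_def by blast
  then have "N (g n) = N (f n) / cmod (f n w)" for n
    by (simp add: norm_divide)
  then have le: "N (g n) \<le> 1 / real (Suc n)" for n
    using big[of n] pos[of n] by (simp add: field_simps del: of_nat_Suc)
  have "(\<lambda>n. N (g n)) \<longlonglongrightarrow> 0"
  proof (rule tendsto_sandwich[OF _ _ tendsto_const])
    show "(\<lambda>n. 1 / real (Suc n)) \<longlonglongrightarrow> 0" by real_asymp
    show "\<forall>\<^sub>F n in sequentially. 0 \<le> N (g n)" using N gX by (auto simp: norm_on_def)
  qed (use le in auto)
  then have "norm_converges N g (\<lambda>z. 0)" by (simp add: norm_converges_def)
  moreover have "(\<lambda>z. 0) \<in> X" using lin by (auto simp: linear_subspace_def)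
  ultimately have "(\<lambda>n. g n w) \<longlonglongrightarrow> 0"
    using X w gX unfolding banach_space_analytic_def by blast
  moreover have "g n w = 1" for n using pos[of n] by (simp add: g_def)
  ultimately show False by (simp add: LIMSEQ_const_iff)
qed

text \<open>Difference quotients are bounded functionals that converge for every \<open>f\<close>,
  so by uniform boundedness one constant serves all of them and hence their limit.\<close>

lemma deriv_evaluation_bounded:
  assumes X: "banach_space_analytic X N" and z: "z \<in> disc"
  shows "\<exists>K. \<forall>f\<in>X. cmod (deriv f z) \<le> K * N f"
proof -
  have lin: "linear_subspace X" and N: "norm_on X N" and compl: "complete_norm X N"
    and hol: "\<And>f. f \<in> X \<Longrightarrow> f holomorphic_on disc"
    using X by (auto simp: banach_space_analytic_def H_disc_def)
  \<comment> \<open>With \<open>n + 1\<close> in place of \<open>n + 2\<close> the increment for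
    \<open>n = 0\<close> could reach the unit circle.\<close>
  define h where "h n = complex_of_real ((1 - cmod z) / (n + 2))" for n :: nat
  have h0: "h n \<noteq> 0" for n
  proof -
    have "(1 - cmod z) / (n + 2) \<noteq> 0" using z by simp
    then show ?thesis unfolding h_def of_real_eq_0_iff .
  qed
  have zh: "z + h n \<in> disc" for n
  proof -
    have "cmod (h n) = (1 - cmod z) / (n + 2)"
      unfolding h_def norm_of_real using z by simp
    also have "\<dots> < 1 - cmod z"
      using z mult_strict_left_mono[of 1 "real n + 2" "1 - cmod z"] by (simp add: divide_less_eq)
    finally show ?thesis using norm_triangle_ineq[of z "h n"] by simp
  qed
  have hlim: "h \<longlonglongrightarrow> 0"
  proof -
    have "(\<lambda>n. (1 - cmod z) / (real n + 2)) \<longlonglongrightarrow> 0" by real_asymp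
    then have "(\<lambda>n. complex_of_real ((1 - cmod z) / (real n + 2))) \<longlonglongrightarrow> of_real 0" by (rule tendsto_of_real)
    then show ?thesis by (simp add: h_def[abs_def] add.commute)
  qed
  define p where "p n f = cmod ((f (z + h n) - f z) / h n)" for n f
  have lim: "(\<lambda>n. p n f) \<longlonglongrightarrow> cmod (deriv f z)" if f: "f \<in> X" for f
  proof -
    have "((\<lambda>h. (f (z + h) - f z) / h) \<longlongrightarrow> deriv f z) (at 0)"
      using holomorphic_derivI[OF hol[OF f] open_ball z, of UNIV] unfolding DERIV_def .
    then have "(\<lambda>n. (f (z + h n) - f z) / h n) \<longlonglongrightarrow> deriv f z"
      by (rule filterlim_compose) (use hlim h0 in \<open>auto simp: filterlim_at\<close>)
    then show ?thesis unfolding p_def by (rule tendsto_norm)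
  qed
  have "\<exists>C. \<forall>n\<in>UNIV. \<forall>f\<in>X. p n f \<le> C * N f"
  proof (rule uniform_boundedness[OF lin N compl])
    fix n f g
    have "((f (z + h n) + g (z + h n)) - (f z + g z)) / h n
        = (f (z + h n) - f z) / h n + (g (z + h n) - g z) / h n"
      by (simp add: add_divide_distrib diff_divide_distrib)
    then show "p n (\<lambda>z. f z + g z) \<le> p n f + p n g"
      unfolding p_def by (metis norm_triangle_ineq)
  next
    fix n c f
    have "(c * f (z + h n) - c * f z) / h n = c * ((f (z + h n) - f z) / h n)"
      by (simp add: right_diff_distrib)
    then show "p n (\<lambda>z. c * f z) = cmod c * p n f"
      unfolding p_def by (metis norm_mult)
  next
    fix n
    obtain K1 where K1: "\<And>f. f \<in> X \<Longrightarrow> cmod (f (z + h n)) \<le> K1 * N f"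
      using evaluation_bounded[OF X zh] by blast
    obtain K2 where K2: "\<And>f. f \<in> X \<Longrightarrow> cmod (f z) \<le> K2 * N f"
      using evaluation_bounded[OF X z] by blast
    have "p n f \<le> ((K1 + K2) / cmod (h n)) * N f" if "f \<in> X" for f
    proof -
      have "p n f \<le> (cmod (f (z + h n)) + cmod (f z)) / cmod (h n)"
        unfolding p_def norm_divide by (intro divide_right_mono norm_triangle_ineq4) auto
      also have "\<dots> \<le> (K1 * N f + K2 * N f) / cmod (h n)"
        using K1 K2 that by (intro divide_right_mono add_mono) auto
      finally show ?thesis by (simp add: algebra_simps add_divide_distrib)
    qed
    then show "\<exists>K. \<forall>f\<in>X. p n f \<le> K * N f" by blast
  next
    fix f assume "f \<in> X"
    then have "Bseq (\<lambda>n. p n f)" using lim convergent_imp_Bseq convergentI by blast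
    then obtain B where "\<And>n. norm (p n f) \<le> B" by (auto simp: Bseq_def)
    then have "\<And>n. p n f \<le> B" by (metis abs_ge_self order_trans real_norm_def)
    then show "\<exists>B. \<forall>n\<in>UNIV. p n f \<le> B" by blast
  qed
  then obtain C where C: "\<And>n f. f \<in> X \<Longrightarrow> p n f \<le> C * N f" by blast
  have "cmod (deriv f z) \<le> C * N f" if "f \<in> X" for f
    using lim[OF that] by (rule tendsto_upperbound) (use C[OF that] in auto)
  then show ?thesis by blast
qed

text \<open>The closed graph theorem for the inclusion of \<open>X\<close> into the Bloch space.\<close>

lemma Bloch_le_norm:
  assumes X: "banach_space_analytic X N" and sub: "X \<subseteq> Bloch"
  obtains C where "\<And>f z. f \<in> X \<Longrightarrow> z \<in> disc \<Longrightarrow> cmod (deriv f z) * (1 - (cmod z)\<^sup>2) \<le> C * N f"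
proof -
  have lin: "linear_subspace X" and N: "norm_on X N" and compl: "complete_norm X N"
    and hol: "\<And>f. f \<in> X \<Longrightarrow> f holomorphic_on disc"
    using X by (auto simp: banach_space_analytic_def H_disc_def)
  have diff: "f field_differentiable at z" if "f \<in> X" "z \<in> disc" for f z
    using holomorphic_on_imp_differentiable_at[OF hol[OF that(1)] open_ball that(2)] .
  have w0: "0 \<le> 1 - (cmod z)\<^sup>2" if "z \<in> disc" for z using that by (simp add: power_le_one)
  \<comment> \<open>The index set is the disc: each density is a bounded seminorm by the previous
    lemma, and the inclusion in \<open>Bloch\<close> is precisely boundedness of the family at every
    \<open>f\<close>.\<close>
  have "\<exists>C. \<forall>z\<in>disc. \<forall>f\<in>X. cmod (deriv f z) * (1 - (cmod z)\<^sup>2) \<le> C * N f"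
  proof (rule uniform_boundedness[OF lin N compl])
    fix z f g assume z: "z \<in> disc" and fg: "f \<in> X" "g \<in> X"
    have "deriv (\<lambda>z. f z + g z) z = deriv f z + deriv g z"
      using diff fg z by simp
    then show "cmod (deriv (\<lambda>z. f z + g z) z) * (1 - (cmod z)\<^sup>2)
        \<le> cmod (deriv f z) * (1 - (cmod z)\<^sup>2) + cmod (deriv g z) * (1 - (cmod z)\<^sup>2)"
      using w0[OF z] by (simp add: mult_right_mono norm_triangle_ineq flip: distrib_right)
  next
    fix z c f assume z: "z \<in> disc" and f: "f \<in> X"
    have "deriv (\<lambda>z. c * f z) z = c * deriv f z" using diff[OF f z] by simp
    then show "cmod (deriv (\<lambda>z. c * f z) z) * (1 - (cmod z)\<^sup>2) = cmod c * (cmod (deriv f z) * (1 - (cmod z)\<^sup>2))"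
      by (simp add: norm_mult)
  next
    fix z assume z: "z \<in> disc"
    obtain K where K: "\<And>f. f \<in> X \<Longrightarrow> cmod (deriv f z) \<le> K * N f"
      using deriv_evaluation_bounded[OF X z] by blast
    have "cmod (deriv f z) * (1 - (cmod z)\<^sup>2) \<le> (K * (1 - (cmod z)\<^sup>2)) * N f" if "f \<in> X" for f
      using mult_right_mono[OF K[OF that] w0[OF z]] by (simp add: mult_ac)
    then show "\<exists>K. \<forall>f\<in>X. cmod (deriv f z) * (1 - (cmod z)\<^sup>2) \<le> K * N f" by blast
  next
    fix f assume "f \<in> X"
    then show "\<exists>B. \<forall>z\<in>disc. cmod (deriv f z) * (1 - (cmod z)\<^sup>2) \<le> B"
      using sub by (force simp: Bloch_def bdd_above_def)
  qed
  then show ?thesis using that by blast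
qed

section \<open>Boundary behaviour of self-maps of the disc\<close>

text \<open>Finitely many exceptional points are removed by multiplying with linear factors, after which
  the maximum principle applies.\<close>

lemma infinite_nonvanishing_boundary_points:
  assumes h: "h holomorphic_on disc" and bdd: "\<And>z. z \<in> disc \<Longrightarrow> cmod (h z) \<le> M"
    and nz: "z0 \<in> disc" "h z0 \<noteq> 0"
  shows "infinite {\<zeta> \<in> sphere 0 1. \<not> (h \<longlongrightarrow> 0) (at \<zeta> within disc)}" (is "infinite ?E")
proof
  assume fin: "finite ?E"
  define Q where "Q z = (\<Prod>p\<in>?E. z - p)" for z
  define g where "g z = (if z \<in> disc then h z * Q z else 0)" for z
  have Qc: "continuous_on UNIV Q" unfolding Q_def by (intro continuous_intros)
  have Qlim: "(Q \<longlongrightarrow> Q \<zeta>) (at \<zeta> within S)" for \<zeta> S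
    using Qc unfolding continuous_on_def by (metis UNIV_I subset_UNIV tendsto_within_subset)
  have ghol: "g holomorphic_on disc"
  proof -
    have "(\<lambda>z. h z * Q z) holomorphic_on disc"
      unfolding Q_def by (intro holomorphic_intros h)
    then show ?thesis by (rule holomorphic_transform) (simp add: g_def)
  qed
  have lim_in: "((\<lambda>z. h z * Q z) \<longlongrightarrow> 0) (at \<zeta> within disc)" if \<zeta>: "\<zeta> \<in> sphere 0 1" for \<zeta>
  proof (cases "\<zeta> \<in> ?E")
    case False
    then have "(h \<longlongrightarrow> 0) (at \<zeta> within disc)" using \<zeta> by blast
    from tendsto_mult[OF this Qlim] show ?thesis by simp
  next
    case True
    then have "Q \<zeta> = 0" unfolding Q_def using fin by (intro prod_zero) auto
    then have Q0: "(Q \<longlongrightarrow> 0) (at \<zeta> within disc)" using Qlim by metis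
    show ?thesis
    proof (rule Lim_null_comparison)
      show "((\<lambda>z. M * cmod (Q z)) \<longlongrightarrow> 0) (at \<zeta> within disc)"
        using tendsto_mult[OF tendsto_const tendsto_norm[OF Q0], of M] by simp
      show "\<forall>\<^sub>F z in at \<zeta> within disc. cmod (h z * Q z) \<le> M * cmod (Q z)"
        unfolding eventually_at_filter
        by (intro always_eventually) (auto simp: norm_mult intro!: mult_right_mono bdd)
    qed
  qed
  have cont: "continuous_on (cball 0 1) g"
    unfolding continuous_on_def
  proof
    fix \<zeta> :: complex assume \<zeta>: "\<zeta> \<in> cball 0 1"
    show "(g \<longlongrightarrow> g \<zeta>) (at \<zeta> within cball 0 1)"
    proof (cases "\<zeta> \<in> disc")
      case True
      have "isCont g \<zeta>"
        using holomorphic_on_imp_continuous_on[OF ghol] True by (simp add: continuous_on_eq_continuous_at)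
      then show ?thesis unfolding isCont_def by (rule tendsto_within_subset) simp
    next
      case False
      then have s: "\<zeta> \<in> sphere 0 1" using \<zeta> by auto
      have "(g \<longlongrightarrow> 0) (at \<zeta> within disc)"
        by (rule Lim_transform_within[OF lim_in[OF s] zero_less_one]) (auto simp: g_def)
      moreover have "(g \<longlongrightarrow> 0) (at \<zeta> within sphere 0 1)"
        by (rule Lim_transform_within[OF tendsto_const zero_less_one]) (auto simp: g_def)
      ultimately have "(g \<longlongrightarrow> 0) (at \<zeta> within disc \<union> sphere 0 1)" by (rule Lim_Un)
      moreover have "disc \<union> sphere 0 1 = cball (0::complex) 1" by auto
      ultimately show ?thesis using False by (simp add: g_def)
    qed
  qed
  have "cmod (g z0) \<le> 0"
  proof (rule maximum_modulus_frontier[of g "cball 0 1"])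
    show "g holomorphic_on interior (cball 0 1)" using ghol by simp
    show "continuous_on (closure (cball 0 1)) g" using cont by simp
    show "cmod (g z) \<le> 0" if "z \<in> frontier (cball 0 1)" for z
      using that by (simp add: g_def)
  qed (use nz in auto)
  moreover have "Q z0 \<noteq> 0" unfolding Q_def using fin nz by (auto simp: prod_zero_iff)
  ultimately show False using nz by (simp add: g_def)
qed

section \<open>The Schwarz-Pick lemma and estimates for the Bloch gap\<close>

text \<open>Moebius maps on both sides move \<open>a\<close> and \<open>\<psi> a\<close> to the
  origin, where the Schwarz lemma bounds the derivative; the chain rule translates back.\<close>

lemma Schwarz_Pick:
  assumes hol: "\<psi> holomorphic_on disc" and self: "\<psi> ` disc \<subseteq> disc" and a: "a \<in> disc"
  shows "cmod (deriv \<psi> a) * (1 - (cmod a)\<^sup>2) \<le> 1 - (cmod (\<psi> a))\<^sup>2"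
proof -
  have Mderiv: "(Moebius_function 0 w has_field_derivative (1 - cnj w * w) / (1 - cnj w * z)\<^sup>2) (at z)"
    if "cmod w < 1" "cmod z < 1" for w z
  proof -
    have "1 - cnj w * z \<noteq> 0"
      using that norm_mult_less[of "cnj w" 1 z 1] by auto
    then have "((\<lambda>z. (z - w) / (1 - cnj w * z)) has_field_derivative
        (1 * (1 - cnj w * z) - (z - w) * (- cnj w)) / ((1 - cnj w * z) * (1 - cnj w * z))) (at z)"
      by (auto intro!: derivative_eq_intros)
    also have "1 * (1 - cnj w * z) - (z - w) * (- cnj w) = 1 - cnj w * w"
      by (simp add: algebra_simps)
    finally show ?thesis
      unfolding Moebius_function_simple[abs_def] power2_eq_square .
  qed
  define b where "b = \<psi> a"
  have a1: "cmod a < 1" and b1: "cmod b < 1" using a self by (simp_all add: b_def image_subset_iff)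
  have sq: "(cmod a)\<^sup>2 < 1" "(cmod b)\<^sup>2 < 1" using a1 b1 by (simp_all add: abs_square_less_1)
  define g where "g = Moebius_function 0 b \<circ> (\<psi> \<circ> Moebius_function 0 (- a))"
  have Ma: "Moebius_function 0 (- a) holomorphic_on disc" "Moebius_function 0 (- a) ` disc \<subseteq> disc"
    using a1 by (auto intro!: Moebius_function_holomorphic Moebius_function_norm_lt_1)
  have Mb: "Moebius_function 0 b holomorphic_on disc" "Moebius_function 0 b ` disc \<subseteq> disc"
    using b1 by (auto intro!: Moebius_function_holomorphic Moebius_function_norm_lt_1)
  have M0: "Moebius_function 0 (- a) 0 = a" by (simp add: Moebius_function_of_zero)
  have ghol: "g holomorphic_on disc"
    unfolding g_def
    by (intro holomorphic_on_compose_gen[OF _ Mb(1)] holomorphic_on_compose_gen[OF Ma(1) hol])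
       (use Ma(2) self in auto)
  have g1: "cmod (g z) < 1" if "cmod z < 1" for z
    using that Ma(2) Mb(2) self by (auto simp: g_def image_subset_iff)
  have g0: "g 0 = 0" by (simp add: g_def M0 b_def Moebius_function_eq_zero)
  have d\<psi>: "(\<psi> has_field_derivative deriv \<psi> a) (at (Moebius_function 0 (- a) 0))"
    unfolding M0 by (rule holomorphic_derivI[OF hol open_ball a])
  have db: "(Moebius_function 0 b has_field_derivative (1 - cnj b * b) / (1 - cnj b * b)\<^sup>2)
      (at ((\<psi> \<circ> Moebius_function 0 (- a)) 0))"
    using Mderiv[OF b1 b1] by (simp add: M0 flip: b_def)
  have da: "(Moebius_function 0 (- a) has_field_derivative
      (1 - cnj (- a) * (- a)) / (1 - cnj (- a) * 0)\<^sup>2) (at 0)"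
    using a1 by (intro Mderiv) auto
  have "(g has_field_derivative (1 - cnj b * b) / (1 - cnj b * b)\<^sup>2 *
      (deriv \<psi> a * ((1 - cnj (- a) * (- a)) / (1 - cnj (- a) * 0)\<^sup>2))) (at 0)"
    unfolding g_def by (rule DERIV_chain[OF db DERIV_chain[OF d\<psi> da]])
  then have "deriv g 0 = (1 - cnj b * b) / (1 - cnj b * b)\<^sup>2 * (deriv \<psi> a * (1 - cnj a * a))"
    by (auto dest: DERIV_imp_deriv)
  also have "cnj b * b = of_real ((cmod b)\<^sup>2)"
    by (simp add: complex_norm_square mult.commute del: of_real_power)
  also have "cnj a * a = of_real ((cmod a)\<^sup>2)"
    by (simp add: complex_norm_square mult.commute del: of_real_power)
  finally have "deriv g 0 = of_real ((1 - (cmod b)\<^sup>2) / (1 - (cmod b)\<^sup>2)\<^sup>2) * (deriv \<psi> a * of_real (1 - (cmod a)\<^sup>2))"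
    by simp
  then have "cmod (deriv g 0) = (1 - (cmod b)\<^sup>2) / (1 - (cmod b)\<^sup>2)\<^sup>2 * (cmod (deriv \<psi> a) * (1 - (cmod a)\<^sup>2))"
    using sq by (simp only: norm_mult norm_of_real) simp
  also have "\<dots> = cmod (deriv \<psi> a) * (1 - (cmod a)\<^sup>2) / (1 - (cmod b)\<^sup>2)"
    unfolding power2_eq_square[of "1 - (cmod b)\<^sup>2"] using sq by simp
  finally have "cmod (deriv \<psi> a) * (1 - (cmod a)\<^sup>2) / (1 - (cmod b)\<^sup>2) \<le> 1"
    using Schwarz_Lemma(2)[OF ghol g0 g1, of 0] by simp
  then show ?thesis
    using sq by (simp add: b_def divide_le_eq)
qed

text \<open>The Bloch density at \<open>a\<close> of \<open>f \<circ> \<psi> - f\<close>, see \<open>deriv_comp_diff\<close>.\<close>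

definition bloch_gap :: "(complex \<Rightarrow> complex) \<Rightarrow> (complex \<Rightarrow> complex) \<Rightarrow> complex \<Rightarrow> real" where
  "bloch_gap \<psi> f a = cmod (deriv f (\<psi> a) * deriv \<psi> a - deriv f a) * (1 - (cmod a)\<^sup>2)"

text \<open>By Schwarz-Pick the Bloch density of the composition at \<open>a\<close> is at most that
  of \<open>f\<close> at \<open>\<psi> a\<close>. The upper bound serves for the later summands of
  the hump, the lower one for a single bump.\<close>

lemma bloch_gap_le:
  assumes hol: "\<psi> holomorphic_on disc" and self: "\<psi> ` disc \<subseteq> disc" and a: "a \<in> disc"
  shows "bloch_gap \<psi> f a
    \<le> cmod (deriv f (\<psi> a)) * (1 - (cmod (\<psi> a))\<^sup>2) + cmod (deriv f a) * (1 - (cmod a)\<^sup>2)"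
    and "cmod (deriv f a) * (1 - (cmod a)\<^sup>2) - cmod (deriv f (\<psi> a)) * (1 - (cmod (\<psi> a))\<^sup>2)
      \<le> bloch_gap \<psi> f a"
proof -
  have w: "0 \<le> 1 - (cmod a)\<^sup>2" using a by (simp add: power_le_one)
  have *: "cmod (deriv f (\<psi> a) * deriv \<psi> a) * (1 - (cmod a)\<^sup>2) \<le> cmod (deriv f (\<psi> a)) * (1 - (cmod (\<psi> a))\<^sup>2)"
    using mult_left_mono[OF Schwarz_Pick[OF assms], of "cmod (deriv f (\<psi> a))"]
    by (simp add: norm_mult mult.assoc)
  have "bloch_gap \<psi> f a \<le> (cmod (deriv f (\<psi> a) * deriv \<psi> a) + cmod (deriv f a)) * (1 - (cmod a)\<^sup>2)"
    unfolding bloch_gap_def by (intro mult_right_mono w norm_triangle_ineq4)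
  then show "bloch_gap \<psi> f a
    \<le> cmod (deriv f (\<psi> a)) * (1 - (cmod (\<psi> a))\<^sup>2) + cmod (deriv f a) * (1 - (cmod a)\<^sup>2)"
    using * by (simp add: distrib_right)
  have "(cmod (deriv f a) - cmod (deriv f (\<psi> a) * deriv \<psi> a)) * (1 - (cmod a)\<^sup>2) \<le> bloch_gap \<psi> f a"
    unfolding bloch_gap_def using norm_triangle_ineq3[of "deriv f (\<psi> a) * deriv \<psi> a" "deriv f a"]
    by (intro mult_right_mono w) auto
  then show "cmod (deriv f a) * (1 - (cmod a)\<^sup>2) - cmod (deriv f (\<psi> a)) * (1 - (cmod (\<psi> a))\<^sup>2)
      \<le> bloch_gap \<psi> f a"
    using * by (simp add: left_diff_distrib)
qed

text \<open>The gap at \<open>a\<close> is a seminorm of \<open>f\<close>; this is its reverse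
  triangle inequality.\<close>

lemma bloch_gap_add_ge:
  assumes self: "\<psi> ` disc \<subseteq> disc" and a: "a \<in> disc"
    and f: "f holomorphic_on disc" and g: "g holomorphic_on disc"
  shows "bloch_gap \<psi> g a - bloch_gap \<psi> f a \<le> bloch_gap \<psi> (\<lambda>z. f z + g z) a"
proof -
  have w: "0 \<le> 1 - (cmod a)\<^sup>2" using a by (simp add: power_le_one)
  have d: "deriv (\<lambda>z. f z + g z) z = deriv f z + deriv g z" if "z \<in> disc" for z
    using holomorphic_on_imp_differentiable_at[OF f open_ball that]
      holomorphic_on_imp_differentiable_at[OF g open_ball that] by simp
  have \<psi>a: "\<psi> a \<in> disc" using self a by blast
  let ?F = "deriv f (\<psi> a) * deriv \<psi> a - deriv f a" and ?G = "deriv g (\<psi> a) * deriv \<psi> a - deriv g a"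
  have "cmod ?G - cmod ?F \<le> cmod (?F + ?G)"
    using norm_triangle_ineq4[of "?F + ?G" ?F] by simp
  also have "?F + ?G = deriv (\<lambda>z. f z + g z) (\<psi> a) * deriv \<psi> a - deriv (\<lambda>z. f z + g z) a"
    unfolding d[OF a] d[OF \<psi>a] by (simp add: algebra_simps)
  finally show ?thesis
    unfolding bloch_gap_def left_diff_distrib[symmetric] by (intro mult_right_mono w)
qed

lemma deriv_comp_diff:
  assumes hol: "\<psi> holomorphic_on disc" and self: "\<psi> ` disc \<subseteq> disc" and a: "a \<in> disc"
    and f: "f holomorphic_on disc"
  shows "deriv (\<lambda>z. (if z \<in> disc then f (\<psi> z) else 0) - f z) a = deriv f (\<psi> a) * deriv \<psi> a - deriv f a"
proof (rule DERIV_imp_deriv)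
  have "\<psi> a \<in> disc" using self a by blast
  then have "((\<lambda>z. f (\<psi> z)) has_field_derivative deriv f (\<psi> a) * deriv \<psi> a) (at a)"
    by (intro DERIV_chain2[of f] holomorphic_derivI[OF f] holomorphic_derivI[OF hol] a) auto
  then have "((\<lambda>z. f (\<psi> z) - f z) has_field_derivative deriv f (\<psi> a) * deriv \<psi> a - deriv f a) (at a)"
    by (intro DERIV_diff holomorphic_derivI[OF f] a) auto
  then show "((\<lambda>z. (if z \<in> disc then f (\<psi> z) else 0) - f z) has_field_derivative
      deriv f (\<psi> a) * deriv \<psi> a - deriv f a) (at a)"
    by (rule has_field_derivative_transform_within_open[OF _ open_ball a]) auto
qed

text \<open>Cauchy's estimate on the ball of radius r = (1 - |w|)/2, combined with 1 - |w|^2 \<le>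
  4r. The radius (1 + |w|)/2 of the disc on which \<open>F\<close> must be small reappears as an
  invariant of the gliding hump.\<close>

lemma Bloch_density_le_sup:
  assumes F: "F holomorphic_on disc" and w: "w \<in> disc"
    and B: "\<And>z. cmod z \<le> (1 + cmod w) / 2 \<Longrightarrow> cmod (F z) \<le> B"
  shows "cmod (deriv F w) * (1 - (cmod w)\<^sup>2) \<le> 4 * B"
proof -
  define r where "r = (1 - cmod w) / 2"
  have r: "0 < r" using w by (simp add: r_def)
  have ball: "cmod z \<le> (1 + cmod w) / 2" if "z \<in> cball w r" for z
  proof -
    have "cmod (z - w) \<le> r" using that by (simp add: dist_norm norm_minus_commute)
    then show ?thesis using norm_triangle_ineq2[of z w] unfolding r_def by argo
  qed
  have sub: "cball w r \<subseteq> disc"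
  proof
    fix z assume "z \<in> cball w r"
    from ball[OF this] show "z \<in> disc" using w by simp
  qed
  have "cmod ((deriv ^^ 1) F w) \<le> fact 1 * B / r ^ 1"
  proof (rule Cauchy_inequality)
    show "F holomorphic_on ball w r" using F sub ball_subset_cball holomorphic_on_subset by blast
    show "continuous_on (cball w r) F"
      using F sub holomorphic_on_imp_continuous_on holomorphic_on_subset by blast
    show "cmod (F x) \<le> B" if "cmod (w - x) = r" for x
      using that by (intro B ball) (simp add: dist_norm)
  qed (use r in auto)
  then have d: "cmod (deriv F w) \<le> B / r" by simp
  have "cmod (F w) \<le> B" using B[of w] w by simp
  then have B0: "0 \<le> B" by (meson norm_ge_zero order_trans)
  have "1 - (cmod w)\<^sup>2 = (1 - cmod w) * (1 + cmod w)" by (simp add: power2_eq_square algebra_simps)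
  also have "\<dots> \<le> (1 - cmod w) * 2" using w by (intro mult_left_mono) auto
  also have "\<dots> = 4 * r" by (simp add: r_def)
  finally have "cmod (deriv F w) * (1 - (cmod w)\<^sup>2) \<le> B / r * (4 * r)"
    using w B0 r by (intro mult_mono d) (auto simp: power_le_one)
  then show ?thesis using r by simp
qed

text \<open>The value at \<open>a\<close> of the Bloch density of \<open>bump a\<close> is \<open>cmod a\<close>, so it stays away from \<open>0\<close> as \<open>a\<close>
  tends to the circle, while \<open>bump a\<close> itself tends to \<open>0\<close> off any neighbourhood of the limit point.\<close>

definition bump :: "complex \<Rightarrow> complex \<Rightarrow> complex" where
  "bump a z = (if z \<in> disc then of_real (1 - (cmod a)\<^sup>2) / (1 - cnj a * z) else 0)"

lemma bump_holomorphic: "a \<in> disc \<Longrightarrow> bump a holomorphic_on disc"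
proof -
  assume a: "a \<in> disc"
  have "(\<lambda>z. of_real (1 - (cmod a)\<^sup>2) / (1 - cnj a * z)) holomorphic_on disc"
    using a cnj_mult_ne_1[of a] by (intro holomorphic_intros) auto
  then show ?thesis by (rule holomorphic_transform) (simp add: bump_def)
qed

lemma bump_bounded:
  assumes a: "a \<in> disc"
  shows "cmod (bump a z) \<le> 2"
proof (cases "z \<in> disc")
  case True
  have "1 - cmod a \<le> 1 - cmod (cnj a * z)"
    using True by (simp add: norm_mult mult_left_le)
  also have "\<dots> \<le> cmod (1 - cnj a * z)" using norm_triangle_ineq2[of 1 "cnj a * z"] by simp
  finally have le: "1 - cmod a \<le> cmod (1 - cnj a * z)" .
  have sq: "1 - (cmod a)\<^sup>2 = (1 - cmod a) * (1 + cmod a)" by (simp add: power2_eq_square algebra_simps)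
  have "cmod (bump a z) = (1 - (cmod a)\<^sup>2) / cmod (1 - cnj a * z)"
    using a True by (simp add: bump_def norm_divide power_le_one del: of_real_diff of_real_power)
  also have "\<dots> \<le> (1 - (cmod a)\<^sup>2) / (1 - cmod a)"
    using a le by (intro divide_left_mono) (auto simp: power_le_one intro!: mult_pos_pos)
  also have "\<dots> = 1 + cmod a" using a by (simp add: sq)
  finally show ?thesis using a by simp
qed (simp add: bump_def)

lemma bump_in_H_infty:
  assumes "a \<in> disc"
  shows "bump a \<in> H_infty"
proof -
  have "bounded (bump a ` disc)"
    unfolding bounded_iff using bump_bounded[OF assms] by blast
  then show ?thesis
    using bump_holomorphic[OF assms] by (simp add: H_infty_def H_disc_def bump_def)
qed

text \<open>Divided by the left side, this says that the squared pseudohyperbolic distance of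
  \<open>a\<close> and \<open>w\<close> and the quotient (1 - |a|^2)(1 - |w|^2) / |1 - cnj a w|^2
  add up to 1.\<close>

lemma one_minus_cmod_cnj_mult:
  "(cmod (1 - cnj a * w))\<^sup>2 = (cmod (w - a))\<^sup>2 + (1 - (cmod a)\<^sup>2) * (1 - (cmod w)\<^sup>2)"
  by (simp add: cmod_power2) (simp add: power2_eq_square algebra_simps)

text \<open>The factor after \<open>cmod a\<close> is 1 minus the squared pseudohyperbolic distance,
  so the density is negligible at points hyperbolically far from \<open>a\<close>.\<close>

lemma bump_Bloch_density:
  assumes a: "a \<in> disc" and w: "w \<in> disc"
  shows "cmod (deriv (bump a) w) * (1 - (cmod w)\<^sup>2)
    = cmod a * ((1 - (cmod a)\<^sup>2) * (1 - (cmod w)\<^sup>2) / (cmod (1 - cnj a * w))\<^sup>2)"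
proof -
  have ne: "1 - cnj a * w \<noteq> 0" using cnj_mult_ne_1[of a w] a w by simp
  have "((\<lambda>z. of_real (1 - (cmod a)\<^sup>2) / (1 - cnj a * z)) has_field_derivative
      of_real (1 - (cmod a)\<^sup>2) * cnj a / (1 - cnj a * w)\<^sup>2) (at w)"
    using ne by (auto intro!: derivative_eq_intros simp: power2_eq_square)
  then have "(bump a has_field_derivative of_real (1 - (cmod a)\<^sup>2) * cnj a / (1 - cnj a * w)\<^sup>2) (at w)"
    by (rule has_field_derivative_transform_within_open[OF _ open_ball w]) (auto simp: bump_def)
  then have "deriv (bump a) w = of_real (1 - (cmod a)\<^sup>2) * cnj a / (1 - cnj a * w)\<^sup>2"
    by (rule DERIV_imp_deriv)
  moreover have "0 \<le> 1 - (cmod a)\<^sup>2" using a by (simp add: power_le_one)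
  ultimately have "cmod (deriv (bump a) w) = (1 - (cmod a)\<^sup>2) * cmod a / (cmod (1 - cnj a * w))\<^sup>2"
    by (simp only: norm_divide norm_mult norm_power norm_of_real complex_mod_cnj abs_of_nonneg)
  then show ?thesis by simp
qed

text \<open>Failure of the limit provides points \<open>a\<close> arbitrarily close to
  \<open>\<zeta>\<close> that \<open>\<psi>\<close> moves by a fixed Euclidean distance. As 1 -
  |a|^2 tends to 0, such a displacement becomes large in the hyperbolic sense.\<close>

lemma bump_near_boundary:
  assumes hol: "\<psi> holomorphic_on disc" and self: "\<psi> ` disc \<subseteq> disc"
    and \<zeta>: "cmod \<zeta> = 1" and nlim: "\<not> ((\<lambda>z. \<psi> z - z) \<longlongrightarrow> 0) (at \<zeta> within disc)"
    and s: "0 < s" and e: "0 < e"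
  obtains a where "a \<in> disc" "\<And>z. z \<in> disc \<Longrightarrow> s \<le> cmod (z - \<zeta>) \<Longrightarrow> cmod (bump a z) \<le> e"
    "1 / 2 \<le> bloch_gap \<psi> (bump a) a"
proof -
  obtain \<eta> where \<eta>: "0 < \<eta>" and near: "\<And>d. 0 < d \<Longrightarrow> \<exists>a\<in>disc. cmod (a - \<zeta>) < d \<and> \<eta> \<le> cmod (\<psi> a - a)"
  proof -
    obtain \<eta> where "0 < \<eta>"
      and n: "\<forall>d>0. \<exists>x\<in>disc. 0 < dist x \<zeta> \<and> dist x \<zeta> < d \<and> \<not> dist (\<psi> x - x) 0 < \<eta>"
      using nlim unfolding Lim_within by meson
    have "\<exists>a\<in>disc. cmod (a - \<zeta>) < d \<and> \<eta> \<le> cmod (\<psi> a - a)" if d: "0 < d" for d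
    proof -
      obtain x where "x \<in> disc" "dist x \<zeta> < d" "\<not> dist (\<psi> x - x) 0 < \<eta>" using n d by blast
      then show ?thesis by (intro bexI[of _ x]) (auto simp: dist_norm)
    qed
    with \<open>0 < \<eta>\<close> show ?thesis by (rule that)
  qed
  \<comment> \<open>The bound s/2 keeps the denominator of the bump above s/2 away from
    \<open>\<zeta>\<close>, and then e s/4 makes the bump at most \<open>e\<close> there. The bound
    1/4 makes the density at \<open>a\<close> at least 3/4, and \<eta>^2/8 makes the density at
    \<open>\<psi> a\<close> at most 1/4; the difference is 1/2.\<close>
  define d where "d = min (min (s / 2) (e * s / 4)) (min (1 / 4) (\<eta>\<^sup>2 / 8))"
  have d: "0 < d" "d \<le> s / 2" "d \<le> e * s / 4" "d \<le> 1 / 4" "d \<le> \<eta>\<^sup>2 / 8"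
    using s e \<eta> by (auto simp: d_def)
  obtain a where a: "a \<in> disc" and ad: "cmod (a - \<zeta>) < d" and far: "\<eta> \<le> cmod (\<psi> a - a)"
    using near[OF d(1)] by blast
  have a1: "1 - cmod a < d"
    using ad norm_triangle_ineq2[of \<zeta> a] \<zeta> by (simp add: norm_minus_commute)
  have sq: "1 - (cmod a)\<^sup>2 \<le> 2 * d"
  proof -
    have "1 - (cmod a)\<^sup>2 = (1 - cmod a) * (1 + cmod a)" by (simp add: power2_eq_square algebra_simps)
    also have "\<dots> \<le> d * 2" using a a1 by (intro mult_mono) auto
    finally show ?thesis by simp
  qed
  have sq0: "0 < 1 - (cmod a)\<^sup>2" using a by (simp add: abs_square_less_1)
  show ?thesis
  proof
    fix z :: complex assume z: "z \<in> disc" and zs: "s \<le> cmod (z - \<zeta>)"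
    have "cnj \<zeta> * \<zeta> = 1" using \<zeta> complex_norm_square[of \<zeta>] by (simp add: mult.commute)
    then have "cmod (1 - cnj \<zeta> * z) = cmod (cnj \<zeta> * (\<zeta> - z))" by (simp add: algebra_simps)
    then have "s \<le> cmod (1 - cnj \<zeta> * z)" using zs \<zeta> by (simp add: norm_mult norm_minus_commute)
    also have "1 - cnj \<zeta> * z = (1 - cnj a * z) + cnj (a - \<zeta>) * z" by (simp add: algebra_simps)
    also have "cmod \<dots> \<le> cmod (1 - cnj a * z) + cmod (a - \<zeta>) * cmod z"
      by (metis complex_mod_cnj norm_mult norm_triangle_ineq)
    also have "\<dots> \<le> cmod (1 - cnj a * z) + d * 1"
      using ad z d(1) by (intro add_left_mono mult_mono) auto
    finally have "s / 2 \<le> cmod (1 - cnj a * z)" using d(2) by simp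
    moreover have "cmod (bump a z) = (1 - (cmod a)\<^sup>2) / cmod (1 - cnj a * z)"
      using z sq0 by (simp add: bump_def norm_divide del: of_real_diff of_real_power)
    ultimately have "cmod (bump a z) \<le> (2 * d) / (s / 2)"
      using sq sq0 s d by (simp only:) (intro frac_le, auto)
    also have "\<dots> \<le> e" using d(3) s by (simp add: field_simps)
    finally show "cmod (bump a z) \<le> e" .
  next
    let ?w = "\<psi> a"
    have w: "?w \<in> disc" using self a by blast
    have at_a: "cmod (deriv (bump a) a) * (1 - (cmod a)\<^sup>2) = cmod a"
    proof -
      have "(cmod (1 - cnj a * a))\<^sup>2 = (1 - (cmod a)\<^sup>2) * (1 - (cmod a)\<^sup>2)"
        by (simp add: one_minus_cmod_cnj_mult)
      then show ?thesis using sq0 by (simp add: bump_Bloch_density[OF a a])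
    qed
    have "cmod (deriv (bump a) ?w) * (1 - (cmod ?w)\<^sup>2)
        = cmod a * ((1 - (cmod a)\<^sup>2) * (1 - (cmod ?w)\<^sup>2) / (cmod (1 - cnj a * ?w))\<^sup>2)"
      by (rule bump_Bloch_density[OF a w])
    also have "\<dots> \<le> 1 * (2 * d * 1 / \<eta>\<^sup>2)"
    proof (intro mult_mono frac_le)
      have "\<eta>\<^sup>2 \<le> (cmod (?w - a))\<^sup>2" using far \<eta> by (intro power_mono) auto
      also have "\<dots> \<le> (cmod (1 - cnj a * ?w))\<^sup>2"
        unfolding one_minus_cmod_cnj_mult using sq0 w by (simp add: power_le_one)
      finally show "\<eta>\<^sup>2 \<le> (cmod (1 - cnj a * ?w))\<^sup>2" .
    qed (use a w sq sq0 d \<eta> in \<open>auto simp: power_le_one intro!: divide_nonneg_nonneg mult_nonneg_nonneg\<close>)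
    also have "\<dots> \<le> 1 / 4" using d(5) \<eta> by (simp add: field_simps)
    finally show "1 / 2 \<le> bloch_gap \<psi> (bump a) a"
      using bloch_gap_le(2)[OF hol self a, of "bump a"] at_a a1 d(4) by simp
  qed (rule a)
qed

section \<open>The gliding hump\<close>

text \<open>Adding a bump near \<open>\<zeta> \<noteq> p\<close> to \<open>S\<close>. Each bump has norm at most 2, but only one of them is large at a
  given point: the invariant is that the partial sums are less than 1 near \<open>p\<close>, where all later bumps
  are placed.\<close>

lemma hump_step:
  assumes hol: "\<psi> holomorphic_on disc" and self: "\<psi> ` disc \<subseteq> disc"
    and \<zeta>: "cmod \<zeta> = 1" "\<zeta> \<noteq> p" "cmod (\<zeta> - p) < \<sigma> / 2"
    and nlim: "\<not> ((\<lambda>z. \<psi> z - z) \<longlongrightarrow> 0) (at \<zeta> within disc)"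
    and S: "S \<in> H_infty" and R: "R < 1" and n: "n0 < n"
    and S3: "\<And>z. z \<in> disc \<Longrightarrow> cmod (S z) \<le> 3 - 2 * (1 / 2) ^ n0"
    and S1: "\<And>z. z \<in> disc \<Longrightarrow> cmod (z - p) < \<sigma> \<Longrightarrow> cmod (S z) \<le> 1 - 2 * (1 / 2) ^ n0"
    and gap: "\<And>a. a \<in> disc \<Longrightarrow> bloch_gap \<psi> S a < 1 / 8"
  obtains a S' \<sigma>' where "a \<in> disc" "S' \<in> H_infty" "0 < \<sigma>'"
    "\<And>z. z \<in> disc \<Longrightarrow> cmod (S' z) \<le> 3 - 2 * (1 / 2) ^ n"
    "\<And>z. z \<in> disc \<Longrightarrow> cmod (z - p) < \<sigma>' \<Longrightarrow> cmod (S' z) \<le> 1 - 2 * (1 / 2) ^ n"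
    "3 / 8 \<le> bloch_gap \<psi> S' a"
    "\<And>z. cmod z \<le> R \<Longrightarrow> cmod (S' z - S z) \<le> (1 / 2) ^ n / 64"
proof -
  define \<rho> where "\<rho> = cmod (\<zeta> - p)"
  \<comment> \<open>The bump can be large only within \<open>s\<close> of \<open>\<zeta>\<close>.
    That region lies inside the \<sigma>-neighbourhood of \<open>p\<close>, where \<open>S\<close>
    is below 1, yet stays at least \<rho>/2 away from \<open>p\<close> and outside the disc of
    radius \<open>R\<close>.\<close>
  define s where "s = min (\<rho> / 2) (1 - R)"
  have \<rho>: "0 < \<rho>" "\<rho> < \<sigma> / 2" using \<zeta> by (auto simp: \<rho>_def)
  have s: "0 < s" "s \<le> \<rho> / 2" "s \<le> 1 - R" using \<rho> R by (auto simp: s_def min_def)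
  obtain a where a: "a \<in> disc"
    and small: "\<And>z. z \<in> disc \<Longrightarrow> s \<le> cmod (z - \<zeta>) \<Longrightarrow> cmod (bump a z) \<le> (1 / 2) ^ n / 64"
    and big: "1 / 2 \<le> bloch_gap \<psi> (bump a) a"
    using bump_near_boundary[OF hol self \<zeta>(1) nlim s(1), of "(1 / 2) ^ n / 64"] by auto
  define S' where "S' z = S z + bump a z" for z
  \<comment> \<open>The reserve 2 (1/2)^n in the invariants at least halves with every step, and
    what it loses pays for the small values of the new bump.\<close>
  have pow: "2 * (1 / 2 :: real) ^ n \<le> (1 / 2) ^ n0"
  proof -
    have "(1 / 2 :: real) ^ n \<le> (1 / 2) ^ Suc n0" using n by (intro power_decreasing) auto
    then show ?thesis by simp
  qed
  have pos: "0 < (1 / 2 :: real) ^ n" by simp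
  have far: "cmod (S' z) \<le> cmod (S z) + (1 / 2) ^ n / 64" if "z \<in> disc" "s \<le> cmod (z - \<zeta>)" for z
    using norm_triangle_ineq[of "S z" "bump a z"] small[OF that] by (simp add: S'_def)
  show ?thesis
  proof (rule that[of a S' "\<rho> / 2"])
    have "bounded (S' ` disc)"
      unfolding S'_def using S bump_in_H_infty[OF a] by (intro bounded_plus_comp) (auto simp: H_infty_def)
    then show "S' \<in> H_infty"
      using S bump_in_H_infty[OF a] unfolding H_infty_def H_disc_def S'_def
      by (auto intro!: holomorphic_intros)
  next
    fix z :: complex assume z: "z \<in> disc"
    show "cmod (S' z) \<le> 3 - 2 * (1 / 2) ^ n"
    proof (cases "s \<le> cmod (z - \<zeta>)")
      case True
      show ?thesis using far[OF z True] S3[OF z] pow pos by linarith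
    next
      case False
      have "cmod (z - p) \<le> cmod (z - \<zeta>) + \<rho>"
        using norm_triangle_ineq[of "z - \<zeta>" "\<zeta> - p"] by (simp add: \<rho>_def)
      then have "cmod (z - p) < \<sigma>" using False s \<rho> by linarith
      with z have "cmod (S z) \<le> 1 - 2 * (1 / 2) ^ n0" by (rule S1)
      moreover have "cmod (S' z) \<le> cmod (S z) + 2"
        using norm_triangle_ineq[of "S z" "bump a z"] bump_bounded[OF a, of z] by (simp add: S'_def)
      ultimately show ?thesis using pow pos by linarith
    qed
  next
    fix z :: complex assume z: "z \<in> disc" and zp: "cmod (z - p) < \<rho> / 2"
    have "\<rho> \<le> cmod (z - \<zeta>) + cmod (z - p)"
      using norm_triangle_ineq[of "\<zeta> - z" "z - p"] by (simp add: \<rho>_def norm_minus_commute)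
    then have "s \<le> cmod (z - \<zeta>)" using zp s by linarith
    from far[OF z this] have "cmod (S' z) \<le> cmod (S z) + (1 / 2) ^ n / 64" .
    moreover have "cmod (S z) \<le> 1 - 2 * (1 / 2) ^ n0" using z zp \<rho> by (intro S1) auto
    ultimately show "cmod (S' z) \<le> 1 - 2 * (1 / 2) ^ n" using pow pos by linarith
  next
    have "bloch_gap \<psi> (bump a) a - bloch_gap \<psi> S a \<le> bloch_gap \<psi> S' a"
      unfolding S'_def using S bump_holomorphic[OF a]
      by (intro bloch_gap_add_ge self a) (auto simp: H_infty_def H_disc_def)
    then show "3 / 8 \<le> bloch_gap \<psi> S' a" using big gap[OF a] by linarith
  next
    fix z :: complex assume zR: "cmod z \<le> R"
    have "1 \<le> cmod (z - \<zeta>) + cmod z"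
      using norm_triangle_ineq[of "\<zeta> - z" z] \<zeta> by (simp add: norm_minus_commute)
    then have "s \<le> cmod (z - \<zeta>)" using zR s by linarith
    then show "cmod (S' z - S z) \<le> (1 / 2) ^ n / 64"
      using small[of z] zR R by (simp add: S'_def)
  qed (use a \<rho> in auto)
qed

text \<open>The threshold 1/8 comes from the balance 1/2 - 1/8 - 1/8 = 1/4. The gap of a new bump is
  1/2, the earlier partial sum takes less than 1/8 by the assumption to be refuted, and the later
  bumps take at most 1/8.\<close>

lemma gliding_hump:
  fixes \<psi> :: "nat \<Rightarrow> complex \<Rightarrow> complex"
  assumes hol: "\<And>n. \<psi> n holomorphic_on disc" and self: "\<And>n. \<psi> n ` disc \<subseteq> disc"
    and \<zeta>: "\<And>n. cmod (\<zeta> n) = 1" "\<And>n. \<zeta> n \<noteq> p" and lim: "\<zeta> \<longlonglongrightarrow> p"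
    and nlim: "\<And>n. \<not> ((\<lambda>z. \<psi> n z - z) \<longlongrightarrow> 0) (at (\<zeta> n) within disc)"
  shows "\<exists>f\<in>H_infty. \<not> (\<forall>\<^sub>F n in sequentially. \<forall>a\<in>disc. bloch_gap (\<psi> n) f a < 1 / 8)"
proof (rule ccontr)
  assume "\<not> ?thesis"
  then have small: "\<forall>\<^sub>F n in sequentially. \<forall>a\<in>disc. bloch_gap (\<psi> n) f a < 1 / 8" if "f \<in> H_infty" for f
    using that by blast
  text \<open>In a state \<open>(S, \<sigma>, R, n, a)\<close>, \<open>S\<close> is the partial sum, \<open>n\<close> and \<open>a\<close> are the index and the centre of
    its last bump, and later bumps are small on \<open>cball 0 R\<close>.\<close>
  define good where "good = (\<lambda>(S, \<sigma>, R, n, a). S \<in> H_infty \<and> 0 < \<sigma> \<and> R < 1 \<and> a \<in> disc \<and>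
     (\<forall>z\<in>disc. cmod (S z) \<le> 3 - 2 * (1 / 2) ^ n) \<and>
     (\<forall>z\<in>disc. cmod (z - p) < \<sigma> \<longrightarrow> cmod (S z) \<le> 1 - 2 * (1 / 2) ^ n) \<and>
     3 / 8 \<le> bloch_gap (\<psi> n) S a \<and> (1 + cmod a) / 2 \<le> R \<and> (1 + cmod (\<psi> n a)) / 2 \<le> R \<and>
     1 - (1 / 2) ^ n \<le> R)"
  define nxt where "nxt = (\<lambda>(S, \<sigma> :: real, R, n, a :: complex) (S', \<sigma>' :: real, R', n', a' :: complex).
     n < n' \<and> R \<le> (R' :: real) \<and> (\<forall>z. cmod z \<le> R \<longrightarrow> cmod (S' z - S z) \<le> (1 / 2) ^ n' / 64))"
  have step: "\<exists>y. good y \<and> nxt (S, \<sigma>, R, n0, a0) y"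
    if S: "S \<in> H_infty" and \<sigma>: "0 < \<sigma>" and R: "R < 1"
      and S3: "\<And>z. z \<in> disc \<Longrightarrow> cmod (S z) \<le> 3 - 2 * (1 / 2) ^ n0"
      and S1: "\<And>z. z \<in> disc \<Longrightarrow> cmod (z - p) < \<sigma> \<Longrightarrow> cmod (S z) \<le> 1 - 2 * (1 / 2) ^ n0"
    for S \<sigma> R n0 a0
  proof -
    have "\<forall>\<^sub>F n in sequentially. dist (\<zeta> n) p < \<sigma> / 2"
      using lim \<sigma> by (intro tendstoD) auto
    with small[OF S] eventually_gt_at_top[of n0]
    have "\<forall>\<^sub>F n in sequentially. n0 < n \<and> dist (\<zeta> n) p < \<sigma> / 2 \<and> (\<forall>a\<in>disc. bloch_gap (\<psi> n) S a < 1 / 8)"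
      by eventually_elim simp
    from eventually_happens'[OF sequentially_bot this] obtain n where
      n: "n0 < n" "cmod (\<zeta> n - p) < \<sigma> / 2" "\<And>a. a \<in> disc \<Longrightarrow> bloch_gap (\<psi> n) S a < 1 / 8"
      by (auto simp: dist_norm)
    obtain a S' \<sigma>' where *: "a \<in> disc" "S' \<in> H_infty" "0 < \<sigma>'"
      "\<And>z. z \<in> disc \<Longrightarrow> cmod (S' z) \<le> 3 - 2 * (1 / 2) ^ n"
      "\<And>z. z \<in> disc \<Longrightarrow> cmod (z - p) < \<sigma>' \<Longrightarrow> cmod (S' z) \<le> 1 - 2 * (1 / 2) ^ n"
      "3 / 8 \<le> bloch_gap (\<psi> n) S' a"
      "\<And>z. cmod z \<le> R \<Longrightarrow> cmod (S' z - S z) \<le> (1 / 2) ^ n / 64"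
      using hump_step[OF hol self \<zeta> n(2) nlim S R n(1) S3 S1 n(3)] by blast
    \<comment> \<open>The last two entries leave room for the Cauchy estimates at \<open>a\<close>
      and \<open>\<psi> n a\<close>; the entry 1 - (1/2)^n makes the discs of radius
      \<open>R\<close> exhaust the unit disc.\<close>
    define R' where "R' = max (max R (1 - (1 / 2) ^ n)) (max ((1 + cmod a) / 2) ((1 + cmod (\<psi> n a)) / 2))"
    have "\<psi> n a \<in> disc" using self *(1) by blast
    then have "R' < 1" using *(1) R by (auto simp: R'_def)
    moreover have "R \<le> R'" "1 - (1 / 2) ^ n \<le> R'" "(1 + cmod a) / 2 \<le> R'" "(1 + cmod (\<psi> n a)) / 2 \<le> R'"
      unfolding R'_def by (auto simp only: le_max_iff_disj)
    ultimately have "good (S', \<sigma>', R', n, a)" "nxt (S, \<sigma>, R, n0, a0) (S', \<sigma>', R', n, a)"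
      using * n(1) unfolding good_def nxt_def by simp_all
    then show ?thesis by blast
  qed
  have zero: "(\<lambda>z. 0) \<in> H_infty"
    by (simp add: H_infty_def H_disc_def image_constant_conv)
  \<comment> \<open>The starting index is 1 because 1 - 2 (1/2)^1 = 0 is the first bound near
    \<open>p\<close> that the zero function meets; index 0 would demand a negative one.\<close>
  have "\<exists>y. good y \<and> nxt (\<lambda>z. 0, 1, 0, 1, 0) y"
    by (rule step[OF zero]) auto
  then have "\<exists>x. good x" by blast
  then have "\<exists>x. \<forall>j. good (x j) \<and> nxt (x j) (x (Suc j))"
  proof (rule dependent_nat_choice)
    fix x and j :: nat assume g: "good x"
    obtain S \<sigma> R n a where x: "x = (S, \<sigma>, R, n, a)" by (cases x)
    show "\<exists>y. good y \<and> nxt x y"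
      unfolding x by (rule step) (use g in \<open>auto simp: good_def x\<close>)
  qed
  then obtain x where gx: "\<And>j. good (x j)" and nx: "\<And>j. nxt (x j) (x (Suc j))" by blast
  define S R N A where "S j = fst (x j)" and "R j = fst (snd (snd (x j)))"
    and "N j = fst (snd (snd (snd (x j))))" and "A j = snd (snd (snd (snd (x j))))" for j
  have S: "S j \<in> H_infty" and R1: "R j < 1" and A: "A j \<in> disc"
    and S3: "\<And>z. z \<in> disc \<Longrightarrow> cmod (S j z) \<le> 3 - 2 * (1 / 2) ^ N j"
    and gap: "3 / 8 \<le> bloch_gap (\<psi> (N j)) (S j) (A j)"
    and RA: "(1 + cmod (A j)) / 2 \<le> R j" "(1 + cmod (\<psi> (N j) (A j))) / 2 \<le> R j"
    and RN: "1 - (1 / 2) ^ N j \<le> R j" for j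
    using gx[of j] by (auto simp: good_def S_def R_def N_def A_def split: prod.splits)
  have NS: "N j < N (Suc j)" and RS: "R j \<le> R (Suc j)"
    and SS: "\<And>z. cmod z \<le> R j \<Longrightarrow> cmod (S (Suc j) z - S j z) \<le> (1 / 2) ^ N (Suc j) / 64" for j
    using nx[of j] by (auto simp: nxt_def S_def R_def N_def split: prod.splits)
  have Nj: "j \<le> N j" for j
    using NS by (induction j) (auto intro: Suc_leI le_less_trans)
  have Rmono: "R i \<le> R j" if "i \<le> j" for i j
    using RS that by (rule lift_Suc_mono_le)
  \<comment> \<open>Since \<open>N\<close> increases strictly, each increment (1/2)^N(j + 1) is at
    most (1/2)^N(j) - (1/2)^N(j + 1), and the sum telescopes.\<close>
  have tail: "cmod (S (j + m) z - S j z) \<le> ((1 / 2) ^ N j - (1 / 2) ^ N (j + m)) / 64"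
    if z: "cmod z \<le> R j" for j m z
  proof (induction m)
    case (Suc m)
    have "cmod (S (j + Suc m) z - S j z) \<le> cmod (S (Suc (j + m)) z - S (j + m) z) + cmod (S (j + m) z - S j z)"
      using norm_triangle_ineq[of "S (Suc (j + m)) z - S (j + m) z" "S (j + m) z - S j z"] by simp
    moreover have "cmod (S (Suc (j + m)) z - S (j + m) z) \<le> (1 / 2) ^ N (Suc (j + m)) / 64"
      using z Rmono[of j "j + m"] by (intro SS) auto
    moreover have "(1 / 2 :: real) ^ N (Suc (j + m)) \<le> (1 / 2) ^ Suc (N (j + m))"
      using NS[of "j + m"] by (intro power_decreasing) auto
    ultimately show ?case using Suc by simp
  qed simp
  have tail': "cmod (S i z - S j z) \<le> (1 / 2) ^ j / 64" if "cmod z \<le> R j" "j \<le> i" for i j z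
  proof -
    have "cmod (S i z - S j z) \<le> ((1 / 2) ^ N j - (1 / 2) ^ N i) / 64"
      using tail[OF that(1), of "i - j"] that(2) by simp
    also have "\<dots> \<le> (1 / 2) ^ N j / 64" by simp
    also have "\<dots> \<le> (1 / 2) ^ j / 64"
      using Nj[of j] by (intro divide_right_mono power_decreasing) auto
    finally show ?thesis .
  qed
  have exh: "\<exists>j0. \<forall>j\<ge>j0. r \<le> R j" if r: "r < 1" for r
  proof -
    obtain j0 where j0: "(1 / 2 :: real) ^ j0 < 1 - r" using real_arch_pow_inv[of "1 - r" "1 / 2"] r by auto
    have "r \<le> R j" if "j0 \<le> j" for j
    proof -
      have "(1 / 2 :: real) ^ N j \<le> (1 / 2) ^ j0" using that Nj[of j] by (intro power_decreasing) auto
      then show ?thesis using j0 RN[of j] by linarith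
    qed
    then show ?thesis by blast
  qed
  have small_pow: "\<exists>j1. \<forall>j\<ge>j1. (1 / 2 :: real) ^ j / 64 < e" if e: "e > 0" for e
  proof -
    obtain j1 where j1: "(1 / 2 :: real) ^ j1 < e" using real_arch_pow_inv[of e "1 / 2"] e by auto
    have "(1 / 2 :: real) ^ j / 64 < e" if "j1 \<le> j" for j
    proof -
      have "(1 / 2 :: real) ^ j \<le> (1 / 2) ^ j1" using that by (intro power_decreasing) auto
      moreover have "0 < (1 / 2 :: real) ^ j" by simp
      ultimately show ?thesis using j1 by linarith
    qed
    then show ?thesis by blast
  qed
  have conv: "convergent (\<lambda>i. S i z)" for z
  proof (cases "z \<in> disc")
    case True
    obtain j0 where j0: "\<And>j. j0 \<le> j \<Longrightarrow> cmod z \<le> R j" using exh[of "cmod z"] True by auto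
    have "Cauchy (\<lambda>i. S i z)"
    proof (rule metric_CauchyI)
      fix e :: real assume e: "0 < e"
      obtain j1 where j1: "\<And>j. j1 \<le> j \<Longrightarrow> (1 / 2 :: real) ^ j / 64 < e / 2"
        using small_pow[of "e / 2"] e by auto
      define J where "J = max j0 j1"
      have "dist (S m z) (S n z) < e" if "J \<le> m" "J \<le> n" for m n
      proof -
        have "dist (S m z) (S J z) < e / 2" "dist (S n z) (S J z) < e / 2"
          using tail'[OF j0, of J m] tail'[OF j0, of J n] j1[of J] that
          by (auto simp: dist_norm J_def intro: le_less_trans)
        then show ?thesis by (rule dist_triangle_half_r[OF dist_commute_lessI dist_commute_lessI])
      qed
      then show "\<exists>M. \<forall>m\<ge>M. \<forall>n\<ge>M. dist (S m z) (S n z) < e" by blast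
    qed
    then show ?thesis by (rule Cauchy_convergent)
  next
    case False
    then have "S i z = 0" for i using S[of i] by (simp add: H_infty_def H_disc_def)
    then show ?thesis by (simp add: convergent_const)
  qed
  define f where "f z = lim (\<lambda>i. S i z)" for z
  have f: "(\<lambda>i. S i z) \<longlonglongrightarrow> f z" for z
    unfolding f_def using conv convergent_LIMSEQ_iff by blast
  have fS: "cmod (f z - S j z) \<le> (1 / 2) ^ j / 64" if "cmod z \<le> R j" for z j
  proof (rule tendsto_upperbound)
    show "(\<lambda>i. cmod (S i z - S j z)) \<longlonglongrightarrow> cmod (f z - S j z)"
      by (intro tendsto_intros f)
    show "\<forall>\<^sub>F i in sequentially. cmod (S i z - S j z) \<le> (1 / 2) ^ j / 64"
      using eventually_ge_at_top[of j] by eventually_elim (rule tail'[OF that])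
  qed simp
  have fhol: "f holomorphic_on disc"
  proof (rule holomorphic_uniform_sequence[OF open_ball])
    show "S j holomorphic_on disc" for j using S[of j] by (simp add: H_infty_def H_disc_def)
    fix w :: complex assume w: "w \<in> disc"
    define d where "d = (1 - cmod w) / 2"
    have bd: "cmod z \<le> cmod w + d" if "z \<in> cball w d" for z
      using that norm_triangle_ineq2[of z w] by (simp add: dist_norm norm_minus_commute)
    have d: "0 < d" "cmod w + d < 1" using w by (auto simp: d_def field_simps)
    obtain j0 where j0: "\<And>j. j0 \<le> j \<Longrightarrow> cmod w + d \<le> R j" using exh[OF d(2)] by auto
    have "uniform_limit (cball w d) S f sequentially"
    proof (rule uniform_limitI)
      fix e :: real assume e: "0 < e"
      obtain j1 where j1: "\<And>j. j1 \<le> j \<Longrightarrow> (1 / 2 :: real) ^ j / 64 < e" using small_pow[OF e] by auto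
      show "\<forall>\<^sub>F j in sequentially. \<forall>z\<in>cball w d. dist (S j z) (f z) < e"
        using eventually_ge_at_top[of "max j0 j1"]
      proof eventually_elim
        case (elim j)
        show ?case
        proof
          fix z assume "z \<in> cball w d"
          then have "cmod z \<le> R j" using bd j0[of j] elim by fastforce
          from fS[OF this] j1[of j] elim show "dist (S j z) (f z) < e"
            by (simp add: dist_norm norm_minus_commute)
        qed
      qed
    qed
    moreover have "cball w d \<subseteq> disc"
      using bd d(2) by fastforce
    ultimately show "\<exists>d. 0 < d \<and> cball w d \<subseteq> disc \<and> uniform_limit (cball w d) S f sequentially"
      using d by blast
  qed
  have fb: "cmod (f z) \<le> 3" if "z \<in> disc" for z
  proof (rule tendsto_upperbound)
    show "(\<lambda>i. cmod (S i z)) \<longlonglongrightarrow> cmod (f z)" by (intro tendsto_intros f)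
    have "cmod (S i z) \<le> 3" for i using S3[OF that, of i] zero_le_power[of "1 / 2 :: real" "N i"] by linarith
    then show "\<forall>\<^sub>F i in sequentially. cmod (S i z) \<le> 3" by simp
  qed simp
  have "f z = 0" if "z \<notin> disc" for z
  proof -
    have "S i z = 0" for i using S[of i] that by (simp add: H_infty_def H_disc_def)
    then show ?thesis using f[of z] by (simp add: LIMSEQ_const_iff)
  qed
  then have fH: "f \<in> H_infty"
    using fhol fb unfolding H_infty_def H_disc_def bounded_iff by blast
  have fgap: "1 / 4 \<le> bloch_gap (\<psi> (N j)) f (A j)" for j
  proof -
    have Shol: "S j holomorphic_on disc" using S[of j] by (simp add: H_infty_def H_disc_def)
    \<comment> \<open>This is minus the contribution of all later bumps. It is at most 1/64 in
      modulus on the disc of radius \<open>R j\<close>, so each of its two relevant densities is at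
      most 4/64 and its gap at most 1/8.\<close>
    define F where "F z = S j z - f z" for z
    have Fhol: "F holomorphic_on disc" unfolding F_def by (intro holomorphic_intros Shol fhol)
    have F: "cmod (F z) \<le> 1 / 64" if "cmod z \<le> R j" for z
    proof -
      have "(1 / 2 :: real) ^ j \<le> 1" by (intro power_le_one) auto
      then show ?thesis using fS[OF that] by (simp add: F_def norm_minus_commute)
    qed
    have wd: "\<psi> (N j) (A j) \<in> disc" using self A by blast
    have "cmod (deriv F (A j)) * (1 - (cmod (A j))\<^sup>2) \<le> 4 * (1 / 64)"
      using RA(1)[of j] by (intro Bloch_density_le_sup[OF Fhol A] F) auto
    moreover have "cmod (deriv F (\<psi> (N j) (A j))) * (1 - (cmod (\<psi> (N j) (A j)))\<^sup>2) \<le> 4 * (1 / 64)"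
      using RA(2)[of j] by (intro Bloch_density_le_sup[OF Fhol wd] F) auto
    ultimately have "bloch_gap (\<psi> (N j)) F (A j) \<le> 1 / 8"
      using bloch_gap_le(1)[OF hol self A, of "N j" F j] by simp
    moreover have "bloch_gap (\<psi> (N j)) (S j) (A j) - bloch_gap (\<psi> (N j)) (\<lambda>z. - F z) (A j)
        \<le> bloch_gap (\<psi> (N j)) (\<lambda>z. - F z + S j z) (A j)"
      by (intro bloch_gap_add_ge self A holomorphic_intros Fhol Shol)
    moreover have "(\<lambda>z. - F z + S j z) = f" by (simp add: F_def)
    moreover have "bloch_gap (\<psi> (N j)) (\<lambda>z. - F z) (A j) = bloch_gap (\<psi> (N j)) F (A j)"
    proof -
      have "deriv (\<lambda>z. - F z) z = - deriv F z" if "z \<in> disc" for z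
        using holomorphic_on_imp_differentiable_at[OF Fhol open_ball that] by simp
      then show ?thesis using A wd by (simp add: bloch_gap_def norm_minus_commute)
    qed
    ultimately show ?thesis using gap[of j] by simp
  qed
  \<comment> \<open>The indices in use are \<open>N j\<close>, and \<open>N j\<close> is at least
    \<open>j\<close>, so \<open>j = n1\<close> already meets the eventual bound.\<close>
  obtain n1 where n1: "\<And>n a. n1 \<le> n \<Longrightarrow> a \<in> disc \<Longrightarrow> bloch_gap (\<psi> n) f a < 1 / 8"
    using small[OF fH] unfolding eventually_sequentially by blast
  show False using n1[OF Nj A, of n1] fgap[of n1] by simp
qed

section \<open>Semigroups\<close>

text \<open>The map at time t0 is the (n + 1)-fold iterate of the map at time t0/(n + 1); if the
  latter were the identity, so would be the former.\<close>

lemma nontrivial_small_times: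
  assumes sg: "analytic_semigroup \<phi>" and t0: "0 < t0" "z0 \<in> disc" "\<phi> t0 z0 \<noteq> z0"
  shows "\<exists>z\<in>disc. \<phi> (t0 / real (Suc n)) z \<noteq> z"
proof (rule ccontr)
  assume "\<not> ?thesis"
  then have fix1: "\<phi> (t0 / real (Suc n)) z = z" if "z \<in> disc" for z using that by blast
  have "\<phi> (real k * (t0 / real (Suc n))) z = z" if "z \<in> disc" for k z
  proof (induction k)
    case 0
    then show ?case using sg that by (simp add: analytic_semigroup_def)
  next
    case (Suc k)
    have add: "\<And>s t z. 0 \<le> s \<Longrightarrow> 0 \<le> t \<Longrightarrow> z \<in> disc \<Longrightarrow> \<phi> (s + t) z = \<phi> s (\<phi> t z)"
      using sg by (simp add: analytic_semigroup_def)
    have "real (Suc k) * (t0 / real (Suc n)) = real k * (t0 / real (Suc n)) + t0 / real (Suc n)"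
      by (simp only: of_nat_Suc distrib_right mult_1_left add.commute)
    also have "\<phi> \<dots> z = z"
      using add[of "real k * (t0 / real (Suc n))" "t0 / real (Suc n)" z] t0 that fix1 Suc by simp
    finally show ?case .
  qed
  from this[OF t0(2), of "Suc n"] have "\<phi> t0 z0 = z0" by (simp del: of_nat_Suc)
  with t0(3) show False by simp
qed

text \<open>Compactness of the circle is used twice: each infinite set \<open>B n\<close> has a
  limit point \<open>q n\<close>, and a subsequence of these limit points converges to
  \<open>p\<close>. Points of \<open>B (r n)\<close> chosen close to \<open>q (r n)\<close> then
  converge to \<open>p\<close> as well.\<close>

lemma analytic_semigroup_gap:
  assumes sg: "analytic_semigroup \<phi>" and nontriv: "\<not> trivial_semigroup \<phi>"
  obtains f where "f \<in> H_infty"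
    "\<And>\<delta>. 0 < \<delta> \<Longrightarrow> \<exists>t a. 0 < t \<and> t < \<delta> \<and> a \<in> disc \<and> 1 / 8 \<le> bloch_gap (\<phi> t) f a"
proof -
  have hol: "\<phi> t holomorphic_on disc" and self: "\<phi> t ` disc \<subseteq> disc" if "0 \<le> t" for t
    using sg that by (auto simp: analytic_semigroup_def)
  obtain t0 z0 where t0: "0 \<le> t0" "z0 \<in> disc" "\<phi> t0 z0 \<noteq> z0"
    using nontriv by (auto simp: trivial_semigroup_def)
  moreover have "t0 \<noteq> 0" using t0 sg by (auto simp: analytic_semigroup_def)
  ultimately have t0': "0 < t0" by simp
  define T where "T n = t0 / real (Suc n)" for n
  have T: "0 < T n" for n using t0' by (simp add: T_def)
  have Tlim: "T \<longlonglongrightarrow> 0"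
    unfolding T_def by (rule LIMSEQ_Suc) (rule lim_const_over_n)
  define B where "B n = {\<zeta> \<in> sphere 0 1. \<not> ((\<lambda>z. \<phi> (T n) z - z) \<longlongrightarrow> 0) (at \<zeta> within disc)}" for n
  have "infinite (B n)" for n
  proof -
    obtain z where z: "z \<in> disc" "\<phi> (T n) z \<noteq> z"
      using nontrivial_small_times[OF sg t0' t0(2,3)] unfolding T_def by blast
    show ?thesis unfolding B_def
    proof (rule infinite_nonvanishing_boundary_points)
      show "(\<lambda>z. \<phi> (T n) z - z) holomorphic_on disc"
        using T[of n] by (intro holomorphic_intros hol) auto
      show "cmod (\<phi> (T n) w - w) \<le> 2" if "w \<in> disc" for w
      proof -
        have "\<phi> (T n) w \<in> disc" using self[of "T n"] T[of n] that by (simp add: image_subset_iff)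
        then show ?thesis using norm_triangle_ineq4[of "\<phi> (T n) w" w] that by simp
      qed
    qed (use z in auto)
  qed
  moreover have "B n \<subseteq> sphere 0 1" for n by (auto simp: B_def)
  ultimately have "\<exists>x\<in>sphere 0 1. x islimpt B n" for n
    using compact_sphere[of "0::complex" 1] unfolding compact_eq_Bolzano_Weierstrass by blast
  then obtain q where q: "\<And>n. q n \<in> sphere 0 1" and qlim: "\<And>n. q n islimpt B n" by metis
  obtain p r where r: "strict_mono r" and pr: "(q \<circ> r) \<longlonglongrightarrow> p"
    using compact_sphere[of "0::complex" 1] q unfolding compact_def by blast
  have "\<exists>\<zeta>\<in>B (r n). \<zeta> \<noteq> p \<and> dist (q (r n)) \<zeta> < 1 / real (Suc n)" for n
  proof -
    \<comment> \<open>Every ball around a limit point contains infinitely many points of the set, so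
      \<open>p\<close> can be excluded even if it is that limit point.\<close>
    have "infinite (B (r n) \<inter> ball (q (r n)) (1 / real (Suc n)))"
      using qlim[of "r n"] unfolding islimpt_eq_infinite_ball by simp
    then have "infinite (B (r n) \<inter> ball (q (r n)) (1 / real (Suc n)) - {p})" by simp
    then obtain \<zeta> where "\<zeta> \<in> B (r n) \<inter> ball (q (r n)) (1 / real (Suc n)) - {p}"
      using infinite_imp_nonempty by blast
    then show ?thesis by auto
  qed
  then obtain \<zeta> where \<zeta>: "\<And>n. \<zeta> n \<in> B (r n)" "\<And>n. \<zeta> n \<noteq> p"
    "\<And>n. dist (q (r n)) (\<zeta> n) < 1 / real (Suc n)" by metis
  have "(\<lambda>n. dist (q (r n)) (\<zeta> n)) \<longlonglongrightarrow> 0"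
  proof (rule tendsto_sandwich[OF _ _ tendsto_const])
    show "(\<lambda>n. 1 / real (Suc n)) \<longlonglongrightarrow> 0" by (rule LIMSEQ_Suc) (rule lim_const_over_n)
    show "\<forall>\<^sub>F n in sequentially. dist (q (r n)) (\<zeta> n) \<le> 1 / real (Suc n)"
      using \<zeta>(3) by (intro always_eventually allI less_imp_le)
  qed simp
  then have "(\<lambda>n. q (r n) - \<zeta> n) \<longlonglongrightarrow> 0"
    unfolding dist_norm by (rule tendsto_norm_zero_cancel)
  from tendsto_diff[OF pr[unfolded comp_def] this] have "\<zeta> \<longlonglongrightarrow> p" by simp
  have "\<exists>f\<in>H_infty. \<not> (\<forall>\<^sub>F n in sequentially. \<forall>a\<in>disc. bloch_gap (\<phi> (T (r n))) f a < 1 / 8)"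
  proof (rule gliding_hump[where \<zeta> = \<zeta> and p = p])
    show "\<phi> (T (r n)) holomorphic_on disc" "\<phi> (T (r n)) ` disc \<subseteq> disc" for n
      using hol self T[of "r n"] by (auto simp: less_imp_le)
    show "cmod (\<zeta> n) = 1" "\<not> ((\<lambda>z. \<phi> (T (r n)) z - z) \<longlongrightarrow> 0) (at (\<zeta> n) within disc)" for n
      using \<zeta>(1)[of n] by (auto simp: B_def)
  qed (fact \<zeta>(2) \<open>\<zeta> \<longlonglongrightarrow> p\<close>)+
  then obtain f where f: "f \<in> H_infty"
    and freq: "\<not> (\<forall>\<^sub>F n in sequentially. \<forall>a\<in>disc. bloch_gap (\<phi> (T (r n))) f a < 1 / 8)" by blast
  show ?thesis
  proof (rule that[OF f])
    fix \<delta> :: real assume "0 < \<delta>"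
    then have ev: "\<forall>\<^sub>F n in sequentially. T (r n) < \<delta>"
      using order_tendstoD(2)[OF LIMSEQ_subseq_LIMSEQ[OF Tlim r]] by (simp add: comp_def)
    have "\<exists>n. T (r n) < \<delta> \<and> \<not> (\<forall>a\<in>disc. bloch_gap (\<phi> (T (r n))) f a < 1 / 8)"
    proof (rule ccontr)
      assume "\<not> ?thesis"
      with ev have "\<forall>\<^sub>F n in sequentially. \<forall>a\<in>disc. bloch_gap (\<phi> (T (r n))) f a < 1 / 8"
        by (auto elim!: eventually_mono)
      with freq show False by blast
    qed
    then obtain n a where "T (r n) < \<delta>" "a \<in> disc" "1 / 8 \<le> bloch_gap (\<phi> (T (r n))) f a"
      unfolding ball_simps not_less by blast
    then show "\<exists>t a. 0 < t \<and> t < \<delta> \<and> a \<in> disc \<and> 1 / 8 \<le> bloch_gap (\<phi> t) f a"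
      using T[of "r n"] by blast
  qed
qed

lemma comp_op_diff_in_H_infty:
  assumes sg: "analytic_semigroup \<phi>" and t: "0 \<le> t" and f: "f \<in> H_infty"
  shows "(\<lambda>z. comp_op \<phi> t f z - f z) \<in> H_infty"
proof -
  have hol: "\<phi> t holomorphic_on disc" and self: "\<phi> t ` disc \<subseteq> disc"
    using sg t by (auto simp: analytic_semigroup_def)
  have fhol: "f holomorphic_on disc" and f0: "\<And>z. z \<notin> disc \<Longrightarrow> f z = 0" and fb: "bounded (f ` disc)"
    using f by (auto simp: H_infty_def H_disc_def)
  have "(\<lambda>z. f (\<phi> t z) - f z) holomorphic_on disc"
    using holomorphic_on_compose_gen[OF hol fhol] self fhol
    by (intro holomorphic_intros) (auto simp: comp_def)
  then have "(\<lambda>z. comp_op \<phi> t f z - f z) holomorphic_on disc"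
    by (rule holomorphic_transform) (simp add: comp_op_def)
  moreover have "bounded ((\<lambda>z. comp_op \<phi> t f z - f z) ` disc)"
  proof (rule bounded_minus_comp[OF _ fb])
    have "comp_op \<phi> t f ` disc \<subseteq> f ` disc" using self by (auto simp: comp_op_def)
    then show "bounded (comp_op \<phi> t f ` disc)" using fb bounded_subset by blast
  qed
  ultimately show ?thesis using f0 by (simp add: H_infty_def H_disc_def comp_op_def)
qed

text \<open>Domination of the Bloch density by \<open>N\<close> is the form in which the norm
  enters, so that abstract Banach spaces and \<open>bmoa_norm\<close> are covered together. As
  \<open>max_sc_subspace\<close> is a union, it is enough that no subspace of strong continuity
  contains \<open>f\<close>.\<close>

lemma max_sc_subspace_psubset:
  assumes sg: "analytic_semigroup \<phi>" and nontriv: "\<not> trivial_semigroup \<phi>" and X: "H_infty \<subseteq> X"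
    and C: "\<And>g a. g \<in> X \<Longrightarrow> a \<in> disc \<Longrightarrow> cmod (deriv g a) * (1 - (cmod a)\<^sup>2) \<le> C * N g"
  shows "max_sc_subspace \<phi> X N \<subset> X"
proof -
  obtain f where f: "f \<in> H_infty"
    and gap: "\<And>\<delta>. 0 < \<delta> \<Longrightarrow> \<exists>t a. 0 < t \<and> t < \<delta> \<and> a \<in> disc \<and> 1 / 8 \<le> bloch_gap (\<phi> t) f a"
    using analytic_semigroup_gap[OF sg nontriv] by blast
  have "\<not> ((\<lambda>t. N (\<lambda>z. comp_op \<phi> t f z - f z)) \<longlongrightarrow> 0) (at_right 0)"
  proof
    assume "((\<lambda>t. N (\<lambda>z. comp_op \<phi> t f z - f z)) \<longlongrightarrow> 0) (at_right 0)"
    then have "((\<lambda>t. C * N (\<lambda>z. comp_op \<phi> t f z - f z)) \<longlongrightarrow> 0) (at_right 0)"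
      by (rule tendsto_mult_right_zero)
    then have "\<forall>\<^sub>F t in at_right 0. C * N (\<lambda>z. comp_op \<phi> t f z - f z) < 1 / 8"
      by (rule order_tendstoD) simp
    then obtain \<delta> where \<delta>: "0 < \<delta>"
      and less: "\<And>t. 0 < t \<Longrightarrow> t < \<delta> \<Longrightarrow> C * N (\<lambda>z. comp_op \<phi> t f z - f z) < 1 / 8"
      unfolding eventually_at_right_field by blast
    obtain t a where t: "0 < t" "t < \<delta>" and a: "a \<in> disc" and ge: "1 / 8 \<le> bloch_gap (\<phi> t) f a"
      using gap[OF \<delta>] by blast
    have \<phi>: "\<phi> t holomorphic_on disc" "\<phi> t ` disc \<subseteq> disc"
      using sg t by (auto simp: analytic_semigroup_def)
    have "f holomorphic_on disc" using f by (simp add: H_infty_def H_disc_def)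
    from deriv_comp_diff[OF \<phi> a this]
    have "bloch_gap (\<phi> t) f a = cmod (deriv (\<lambda>z. comp_op \<phi> t f z - f z) a) * (1 - (cmod a)\<^sup>2)"
      by (simp add: bloch_gap_def comp_op_def)
    \<comment> \<open>The difference is again a bounded function, hence an element of
      \<open>X\<close>, which is what makes the estimate applicable to it.\<close>
    also have "\<dots> \<le> C * N (\<lambda>z. comp_op \<phi> t f z - f z)"
      using comp_op_diff_in_H_infty[OF sg _ f, of t] t X by (intro C a) auto
    also have "\<dots> < 1 / 8" by (rule less[OF t])
    finally show False using ge by simp
  qed
  then have "f \<notin> max_sc_subspace \<phi> X N"
    by (auto simp: max_sc_subspace_def strongly_continuous_on_def)
  moreover have "max_sc_subspace \<phi> X N \<subseteq> X"
    by (auto simp: max_sc_subspace_def closed_subspace_def)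
  ultimately show ?thesis using f X by blast
qed

theorem theorem1p1:
  fixes \<phi> :: "real \<Rightarrow> complex \<Rightarrow> complex"
  assumes "analytic_semigroup \<phi>" and "\<not> trivial_semigroup \<phi>"
  shows "(\<forall>X N. banach_space_analytic X N \<longrightarrow> acts_on \<phi> X N \<longrightarrow> H_infty \<subseteq> X \<longrightarrow> X \<subseteq> Bloch \<longrightarrow>
            max_sc_subspace \<phi> X N \<subset> X)
       \<and> max_sc_subspace \<phi> BMOA bmoa_norm \<subset> BMOA"
proof (intro conjI allI impI)
  fix X N assume X: "banach_space_analytic X N" "H_infty \<subseteq> X" "X \<subseteq> Bloch"
  obtain C where "\<And>f z. f \<in> X \<Longrightarrow> z \<in> disc \<Longrightarrow> cmod (deriv f z) * (1 - (cmod z)\<^sup>2) \<le> C * N f"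
    using Bloch_le_norm[OF X(1,3)] by blast
  then show "max_sc_subspace \<phi> X N \<subset> X"
    by (rule max_sc_subspace_psubset[OF assms X(2)])
next
  show "max_sc_subspace \<phi> BMOA bmoa_norm \<subset> BMOA"
    by (rule max_sc_subspace_psubset[OF assms H_infty_subset_BMOA Bloch_le_bmoa_norm])
qed

end
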